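(* Let $0\le\theta<\pi/2$, $A,B\in\mathcal S_\theta$ with $0<mI\le\Re A,\ \Re B\le MI$ ($0<m\le M$), and let $\Phi:\mathbb M_n\to\mathbb M_n$ be a positive unital linear map. Let $\sigma$ be an operator mean and $\sigma_1,\sigma_2$ operator means with $\sigma^*\le\sigma_1,\sigma_2\le\sigma$. Then $$\big(\Re\Phi(A\sigma_1B)\big)^p\le \sec^{2p}\theta\,K^p\,\big(\Re\Phi(A\sigma_2B)\big)^p\qquad (0<p\le 2),$$ $$\big(\Re\Phi(A\sigma_1B)\big)^p\le \sec^{2p}\theta\,4^{p-2}K^p\,\big(\Re\Phi(A\sigma_2B)\big)^p\qquad (p\ge 2),$$ where $K=\frac{(M+m)^2}{4mM}$.
   Context: $\mathbb M_n$ is the space of complex $n\times n$ matrices; $\Re X=\frac{X+X^*}{2}$. For Hermitian $X,Y$, $X\le Y$ means $Y-X$ is positive semidefinite. A matrix $A$ is accretive if $\Re A$ is positive definite. For $0\le\theta<\pi/2$, $\mathcal S_\theta$ denotes the set of $A\in\mathbb M_n$ whose numerical range lies in $\{z\in\mathbb C:\Re z>0,\ |\Im z|\le (\Re z)\tan\theta\}$. An operator mean (Kubo–Ando) $\sigma$ corresponds to an operator monotone $f:(0,\infty)\to(0,\infty)$ with $f(1)=1$, via $A\sigma B=A^{1/2}f(A^{-1/2}BA^{-1/2})A^{1/2}$; the same formula (principal square roots, holomorphic functional calculus) defines $A\sigma B$ for accretive $A,B$. The adjoint mean $\sigma^*$ has representing function $t\mapsto f(t^{-1})^{-1}$. For means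 $\tau_1,\tau_2$ with representing functions $g_1,g_2$, $\tau_1\le\tau_2$ means $g_1\le g_2$ on $(0,\infty)$. A linear map $\Phi$ is positive if it maps positive semidefinite matrices to positive semidefinite ones, unital if $\Phi(I)=I$. $K=\frac{(M+m)^2}{4mM}$ is the Kantorovich constant. *)

theory Defs
  imports "HOL-Analysis.Analysis" "Jordan_Normal_Form.Schur_Decomposition" "Jordan_Normal_Form.Char_Poly"
begin

definition hermitian_mat :: "complex mat \<Rightarrow> bool" where
  "hermitian_mat X \<longleftrightarrow> X \<in> carrier_mat (dim_row X) (dim_row X) \<and> mat_adjoint X = X"

definition mat_re :: "complex mat \<Rightarrow> complex mat" where
  "mat_re X = (1/2 :: complex) \<cdot>\<^sub>m (X + mat_adjoint X)"

definition qform :: "complex mat \<Rightarrow> complex vec \<Rightarrow> complex" where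
  "qform X x = (X *\<^sub>v x) \<bullet>c x"

definition psd_mat :: "complex mat \<Rightarrow> bool" where
  "psd_mat X \<longleftrightarrow> hermitian_mat X \<and>
     (\<forall>x \<in> carrier_vec (dim_row X). Im (qform X x) = 0 \<and> Re (qform X x) \<ge> 0)"

definition pd_mat :: "complex mat \<Rightarrow> bool" where
  "pd_mat X \<longleftrightarrow> hermitian_mat X \<and>
     (\<forall>x \<in> carrier_vec (dim_row X). x \<noteq> 0\<^sub>v (dim_row X) \<longrightarrow> Im (qform X x) = 0 \<and> Re (qform X x) > 0)"

definition loewner_le :: "complex mat \<Rightarrow> complex mat \<Rightarrow> bool" where
  "loewner_le X Y \<longleftrightarrow> dim_row X = dim_row Y \<and> hermitian_mat X \<and> hermitian_mat Y \<and> psd_mat (Y - X)"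

definition sector_mat :: "real \<Rightarrow> complex mat \<Rightarrow> bool" where
  "sector_mat \<theta> A \<longleftrightarrow> A \<in> carrier_mat (dim_row A) (dim_row A) \<and>
     (\<forall>x \<in> carrier_vec (dim_row A). x \<bullet>c x = 1 \<longrightarrow>
        Re (qform A x) > 0 \<and> \<bar>Im (qform A x)\<bar> \<le> Re (qform A x) * tan \<theta>)"

definition mat_poly :: "complex poly \<Rightarrow> complex mat \<Rightarrow> complex mat" where
  "mat_poly p X = foldr (\<lambda>c Y. c \<cdot>\<^sub>m 1\<^sub>m (dim_row X) + X * Y) (coeffs p) (0\<^sub>m (dim_row X) (dim_row X))"

text \<open>f(X) := p(X), where p is any polynomial interpolating f and its derivatives
  up to order (algebraic multiplicity - 1) at every eigenvalue of X (standard definition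
  of a primary matrix function; coincides with the holomorphic functional calculus).\<close>
definition matfun :: "(complex \<Rightarrow> complex) \<Rightarrow> complex mat \<Rightarrow> complex mat" where
  "matfun f X = mat_poly (SOME p. \<forall>\<mu>. poly (char_poly X) \<mu> = 0 \<longrightarrow>
       (\<forall>k < Polynomial.order \<mu> (char_poly X). (deriv ^^ k) f \<mu> = (deriv ^^ k) (poly p) \<mu>)) X"

definition operator_monotone :: "(complex \<Rightarrow> complex) \<Rightarrow> bool" where
  "operator_monotone f \<longleftrightarrow> (\<forall>k X Y. X \<in> carrier_mat k k \<and> Y \<in> carrier_mat k k \<and>
       pd_mat X \<and> loewner_le X Y \<longrightarrow> loewner_le (matfun f X) (matfun f Y))"

text \<open>A representing function of an operator mean, given by its (unique) holomorphic
  extension to the slit plane C \ (-infinity,0].\<close>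
definition op_mean_fun :: "(complex \<Rightarrow> complex) \<Rightarrow> bool" where
  "op_mean_fun f \<longleftrightarrow> f holomorphic_on (- \<real>\<^sub>\<le>\<^sub>0) \<and>
     (\<forall>t::real. t > 0 \<longrightarrow> f (of_real t) \<in> \<real> \<and> Re (f (of_real t)) > 0) \<and>
     f 1 = 1 \<and> operator_monotone f"

definition mean_op :: "(complex \<Rightarrow> complex) \<Rightarrow> complex mat \<Rightarrow> complex mat \<Rightarrow> complex mat" where
  "mean_op f A B = matfun csqrt A *
      matfun f (matfun (\<lambda>z. inverse (csqrt z)) A * B * matfun (\<lambda>z. inverse (csqrt z)) A) *
      matfun csqrt A"

definition adjoint_mean :: "(complex \<Rightarrow> complex) \<Rightarrow> (complex \<Rightarrow> complex)" where
  "adjoint_mean f = (\<lambda>z. inverse (f (inverse z)))"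

definition mean_le :: "(complex \<Rightarrow> complex) \<Rightarrow> (complex \<Rightarrow> complex) \<Rightarrow> bool" where
  "mean_le g1 g2 \<longleftrightarrow> (\<forall>t::real. t > 0 \<longrightarrow> Re (g1 (of_real t)) \<le> Re (g2 (of_real t)))"

definition positive_unital_linear :: "nat \<Rightarrow> (complex mat \<Rightarrow> complex mat) \<Rightarrow> bool" where
  "positive_unital_linear n \<Phi> \<longleftrightarrow>
     (\<forall>X \<in> carrier_mat n n. \<Phi> X \<in> carrier_mat n n) \<and>
     (\<forall>X \<in> carrier_mat n n. \<forall>Y \<in> carrier_mat n n. \<Phi> (X + Y) = \<Phi> X + \<Phi> Y) \<and>
     (\<forall>c. \<forall>X \<in> carrier_mat n n. \<Phi> (c \<cdot>\<^sub>m X) = c \<cdot>\<^sub>m \<Phi> X) \<and>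
     (\<forall>X \<in> carrier_mat n n. psd_mat X \<longrightarrow> psd_mat (\<Phi> X)) \<and>
     \<Phi> (1\<^sub>m n) = 1\<^sub>m n"

definition mat_rpow :: "complex mat \<Rightarrow> real \<Rightarrow> complex mat" where
  "mat_rpow X p = matfun (\<lambda>z. z powr (of_real p)) X"

definition kantorovich :: "real \<Rightarrow> real \<Rightarrow> real" where
  "kantorovich m M = (M + m)^2 / (4 * m * M)"

end

theory Submission
  imports Defs "HOL-Complex_Analysis.Complex_Analysis"
begin

text \<open>
  Every representing function \<open>f\<close> is a locally uniform limit, on the slit plane, of convex combinations
  of the weighted harmonic means \<open>z / (v z + 1 - v)\<close>. To see this, apply operator monotonicity to
  rank-one perturbations of diagonal matrices near the identity: the functional \<open>L\<close> with
  \<open>L(v\<^sup>n) = (-1)\<^sup>n f\<^bsup>(n+1)\<^esup>(1) / (n+1)!\<close> is nonnegative on squares. Holomorphy on the slit plane bounds the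
  growth of \<open>L(v\<^sup>n)\<close> and of \<open>L((1-v)\<^sup>n)\<close>, which confines \<open>L\<close> to \<open>[0,1]\<close>; this is a Hausdorff moment
  problem, whose Bernstein approximants are the required combinations (Montel's theorem extends the
  convergence from a disc to the slit plane).

  For weighted harmonic means, variational arguments give \<open>Re A \<sigma> Re B \<le> Re (A \<sigma> B) \<le> sec\<^sup>2 \<theta> (Re A \<sigma> Re B)\<close>, and the
  approximation carries this over to all means. Let \<open>P = Re A\<close>, \<open>Q = Re B\<close> and \<open>s = f'(1)\<close>. The tangent bound
  \<open>f(t) \<le> 1 - s + s t\<close> gives \<open>P \<sigma>\<^sub>1 Q \<le> (1-s) P + s Q\<close> and \<open>(P \<sigma>\<^sub>2 Q)\<inverse> \<le> (1-s) P\<inverse> + s Q\<inverse>\<close>, and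
  \<open>P + m M P\<inverse> \<le> M + m\<close>, likewise for \<open>Q\<close>. With Choi's inequality, \<open>Z\<^sub>i = Re \<Phi>(A \<sigma>\<^sub>i B)\<close> satisfy
  \<open>cos\<^sup>2 \<theta> Z\<^sub>1 + m M Z\<^sub>2\<inverse> \<le> M + m\<close>. After normalisation this reads \<open>a + b \<le> 1\<close>; then \<open>a\<^sup>r + b\<^sup>r \<le> 1\<close> for
  \<open>r \<ge> 1\<close>, and the Bhatia-Kittaneh inequality \<open>\<parallel>a\<^sup>r b\<^sup>r\<parallel> \<le> 1/4\<close> is the claim for \<open>p = 2 r\<close>. The range \<open>p \<le> 2\<close>
  follows from \<open>p = 2\<close> by the Loewner-Heinz inequality.
\<close>

section \<open>Vectors, adjoints and polynomials of matrices\<close>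

text \<open>All order relations are phrased through real parts of quadratic forms, so that the
  Loewner order, accretivity and the variational arguments share one language. The obstacle is
  \<open>matfun\<close>: it selects an arbitrary Hermite interpolant, and for accretive A, B the
  matrix A^(-1/2) B A^(-1/2) may fail to be normal or even diagonalisable. Cayley-Hamilton makes the
  choice immaterial, and Newton's form of the interpolant makes the calculus continuous under
  locally uniform limits, which is what carries inequalities from harmonic means to all means. In
  the moment problem the variable is v = -1/(z-1): discs around 1 force |v| \<le> 1, Apollonius
  circles force |1-v| \<le> 1, and the real points satisfying both form [0,1]. The tangent of the
  one function f controls both means, so the weight s is common and the two linear bounds can be
  added. The factor sec^2 is paid once, in the upper bound for the first mean; the lower bound used
  for the second has constant 1. Undoing the normalisation gives (4 sec^2 K)^p / 16, whence 4^(p-2);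
  at p = 2 this is exactly (sec^2 K)^2, so Loewner-Heinz continues it to p \<le> 2 with the stated
  constant.\<close>

lemma cip_sum:
  fixes x y :: "complex vec"
  assumes "x \<in> carrier_vec n" "y \<in> carrier_vec n"
  shows "x \<bullet>c y = (\<Sum>i<n. x $ i * cnj (y $ i))"
  using assms by (auto simp: scalar_prod_def lessThan_atLeast0 intro!: sum.cong)

lemma cip_add_left:
  fixes x y z :: "complex vec"
  assumes "x \<in> carrier_vec n" "y \<in> carrier_vec n" "z \<in> carrier_vec n"
  shows "(x + y) \<bullet>c z = x \<bullet>c z + y \<bullet>c z"
  using assms by (simp add: cip_sum[where n=n] sum.distrib algebra_simps)

lemma cip_diff_left:
  fixes x y z :: "complex vec"
  assumes "x \<in> carrier_vec n" "y \<in> carrier_vec n" "z \<in> carrier_vec n"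
  shows "(x - y) \<bullet>c z = x \<bullet>c z - y \<bullet>c z"
  using assms by (simp add: cip_sum[where n=n] sum_subtractf algebra_simps)

lemma cip_smult_left:
  fixes x y :: "complex vec"
  assumes "x \<in> carrier_vec n" "y \<in> carrier_vec n"
  shows "(c \<cdot>\<^sub>v x) \<bullet>c y = c * (x \<bullet>c y)"
  using assms by (simp add: cip_sum[where n=n] sum_distrib_left algebra_simps)

lemma cip_commute:
  fixes x y :: "complex vec"
  assumes "x \<in> carrier_vec n" "y \<in> carrier_vec n"
  shows "x \<bullet>c y = cnj (y \<bullet>c x)"
  using assms by (simp add: cip_sum[where n=n] algebra_simps)

lemma cip_add_right:
  fixes x y z :: "complex vec"
  assumes "x \<in> carrier_vec n" "y \<in> carrier_vec n" "z \<in> carrier_vec n"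
  shows "z \<bullet>c (x + y) = z \<bullet>c x + z \<bullet>c y"
  using assms by (simp add: cip_sum[where n=n] sum.distrib algebra_simps)

lemma cip_diff_right:
  fixes x y z :: "complex vec"
  assumes "x \<in> carrier_vec n" "y \<in> carrier_vec n" "z \<in> carrier_vec n"
  shows "z \<bullet>c (x - y) = z \<bullet>c x - z \<bullet>c y"
  using assms by (simp add: cip_sum[where n=n] sum_subtractf algebra_simps)

lemma cip_smult_right:
  fixes x y :: "complex vec"
  assumes "x \<in> carrier_vec n" "y \<in> carrier_vec n"
  shows "x \<bullet>c (c \<cdot>\<^sub>v y) = cnj c * (x \<bullet>c y)"
  using assms by (simp add: cip_sum[where n=n] sum_distrib_left algebra_simps)

lemmas cip_simps = cip_add_left cip_diff_left cip_smult_left cip_add_right cip_diff_right cip_smult_right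

lemma cip_self:
  fixes x :: "complex vec"
  assumes "x \<in> carrier_vec n"
  shows "Im (x \<bullet>c x) = 0" "Re (x \<bullet>c x) \<ge> 0"
    "Re (x \<bullet>c x) = 0 \<Longrightarrow> x = 0\<^sub>v n"
proof -
  have eq: "x \<bullet>c x = complex_of_real (\<Sum>i<n. (cmod (x $ i))\<^sup>2)"
    using assms by (simp only: cip_sum[where n=n] complex_norm_square of_real_sum)
  show "Im (x \<bullet>c x) = 0" "Re (x \<bullet>c x) \<ge> 0" unfolding eq by (auto intro: sum_nonneg)
  assume "Re (x \<bullet>c x) = 0"
  then have "(\<Sum>i<n. (cmod (x $ i))\<^sup>2) = 0" unfolding eq by simp
  then have "\<forall>i<n. x $ i = 0" by (subst (asm) sum_nonneg_eq_0_iff) auto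
  then show "x = 0\<^sub>v n" using assms by (intro eq_vecI) auto
qed

lemma mat_adjoint_carrier [simp]:
  fixes M :: "complex mat"
  assumes "M \<in> carrier_mat nr nc"
  shows "mat_adjoint M \<in> carrier_mat nc nr"
  using assms unfolding mat_adjoint_def by auto

lemma mat_adjoint_index:
  fixes M :: "complex mat"
  assumes "M \<in> carrier_mat nr nc" "i < nc" "j < nr"
  shows "mat_adjoint M $$ (i,j) = cnj (M $$ (j,i))"
  using assms unfolding mat_adjoint_def by (auto simp: mat_of_rows_def)

lemma mult_mat_vec_index_sum:
  fixes M :: "complex mat"
  assumes "M \<in> carrier_mat n k" "x \<in> carrier_vec k" "i < n"
  shows "(M *\<^sub>v x) $ i = (\<Sum>j<k. M $$ (i,j) * x $ j)"
  using assms by (auto simp: scalar_prod_def lessThan_atLeast0 intro!: sum.cong)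

lemma cip_adjoint:
  fixes M :: "complex mat"
  assumes M: "M \<in> carrier_mat n n" and x: "x \<in> carrier_vec n" and y: "y \<in> carrier_vec n"
  shows "(M *\<^sub>v x) \<bullet>c y = x \<bullet>c (mat_adjoint M *\<^sub>v y)"
proof -
  have "(M *\<^sub>v x) \<bullet>c y = (\<Sum>i<n. \<Sum>j<n. M $$ (i,j) * x $ j * cnj (y $ i))"
    using M x y by (simp add: cip_sum[where n=n] mult_mat_vec_index_sum[OF M x] sum_distrib_right
        del: index_mult_mat_vec)
  also have "\<dots> = (\<Sum>j<n. \<Sum>i<n. M $$ (i,j) * x $ j * cnj (y $ i))" by (rule sum.swap)
  also have "\<dots> = x \<bullet>c (mat_adjoint M *\<^sub>v y)"
    using M x y mult_mat_vec_carrier[OF mat_adjoint_carrier[OF M] y]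
    by (simp add: cip_sum[where n=n] mult_mat_vec_index_sum[OF mat_adjoint_carrier[OF M] y] sum_distrib_left
        mat_adjoint_index[OF M] algebra_simps del: index_mult_mat_vec)
  finally show ?thesis .
qed

section \<open>Sesquilinear and quadratic forms of matrices\<close>

lemma mat_eqI_cip:
  fixes M N :: "complex mat"
  assumes M: "M \<in> carrier_mat n n" and N: "N \<in> carrier_mat n n"
    and eq: "\<And>x y. x \<in> carrier_vec n \<Longrightarrow> y \<in> carrier_vec n \<Longrightarrow> (M *\<^sub>v x) \<bullet>c y = (N *\<^sub>v x) \<bullet>c y"
  shows "M = N"
proof (rule eq_matI)
  fix i j assume "i < dim_row N" "j < dim_col N"
  then have ij: "i < n" "j < n" using N by auto
  have *: "(K *\<^sub>v unit_vec n j) \<bullet>c unit_vec n i = K $$ (i,j)" if K: "K \<in> carrier_mat n n" for K :: "complex mat"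
  proof -
    have "(K *\<^sub>v unit_vec n j) \<bullet>c unit_vec n i = (\<Sum>l<n. (K *\<^sub>v unit_vec n j) $ l * cnj (unit_vec n i $ l))"
      using K by (intro cip_sum) auto
    also have "\<dots> = (\<Sum>l<n. if l = i then (K *\<^sub>v unit_vec n j) $ l else 0)"
      using ij by (intro sum.cong) (auto simp: unit_vec_def)
    also have "\<dots> = (K *\<^sub>v unit_vec n j) $ i" using ij by simp
    also have "\<dots> = (\<Sum>l<n. K $$ (i,l) * unit_vec n j $ l)"
      using K ij by (intro mult_mat_vec_index_sum) auto
    also have "\<dots> = (\<Sum>l<n. if l = j then K $$ (i,l) else 0)"
      using ij by (intro sum.cong) (auto simp: unit_vec_def)
    also have "\<dots> = K $$ (i,j)" using ij by simp
    finally show ?thesis .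
  qed
  show "M $$ (i,j) = N $$ (i,j)"
    using eq[of "unit_vec n j" "unit_vec n i"] *[OF M] *[OF N] by simp
qed (use M N in auto)

lemma mat_add_vec [simp]:
  fixes M N :: "complex mat"
  assumes "M \<in> carrier_mat n n" "N \<in> carrier_mat n n" "x \<in> carrier_vec n"
  shows "(M + N) *\<^sub>v x = M *\<^sub>v x + N *\<^sub>v x"
  using assms by (rule add_mult_distrib_mat_vec)

lemma mat_minus_vec [simp]:
  fixes M N :: "complex mat"
  assumes "M \<in> carrier_mat n n" "N \<in> carrier_mat n n" "x \<in> carrier_vec n"
  shows "(M - N) *\<^sub>v x = M *\<^sub>v x - N *\<^sub>v x"
  using assms by (rule minus_mult_distrib_mat_vec)

lemma mat_smult_vec [simp]:
  fixes M :: "complex mat"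
  assumes "M \<in> carrier_mat n n" "x \<in> carrier_vec n"
  shows "(c \<cdot>\<^sub>m M) *\<^sub>v x = c \<cdot>\<^sub>v (M *\<^sub>v x)"
  using assms by (intro eq_vecI) auto

lemma mat_mult_vec [simp]:
  fixes M N :: "complex mat"
  assumes "M \<in> carrier_mat n n" "N \<in> carrier_mat n n" "x \<in> carrier_vec n"
  shows "(M * N) *\<^sub>v x = M *\<^sub>v (N *\<^sub>v x)"
  using assms by (rule assoc_mult_mat_vec)

lemma mv_add [simp]:
  fixes M :: "complex mat"
  assumes "M \<in> carrier_mat n n" "x \<in> carrier_vec n" "y \<in> carrier_vec n"
  shows "M *\<^sub>v (x + y) = M *\<^sub>v x + M *\<^sub>v y"
  using assms by (rule mult_add_distrib_mat_vec)

lemma mv_minus [simp]: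
  fixes M :: "complex mat"
  assumes "M \<in> carrier_mat n n" "x \<in> carrier_vec n" "y \<in> carrier_vec n"
  shows "M *\<^sub>v (x - y) = M *\<^sub>v x - M *\<^sub>v y"
  using assms by (rule mult_minus_distrib_mat_vec)

lemma mv_smult [simp]:
  fixes M :: "complex mat"
  assumes "M \<in> carrier_mat n n" "x \<in> carrier_vec n"
  shows "M *\<^sub>v (c \<cdot>\<^sub>v x) = c \<cdot>\<^sub>v (M *\<^sub>v x)"
  using assms by (rule mult_mat_vec)

text \<open>Polarisation over the complex field: the forms at x + y and at x + i y determine the sum
  and the difference of the two mixed terms, hence each of them.\<close>

lemma mat_eqI_qform:
  fixes M N :: "complex mat"
  assumes M: "M \<in> carrier_mat n n" and N: "N \<in> carrier_mat n n"
    and eq: "\<And>x. x \<in> carrier_vec n \<Longrightarrow> qform M x = qform N x"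
  shows "M = N"
proof (rule mat_eqI_cip[OF M N])
  fix x y :: "complex vec" assume x: "x \<in> carrier_vec n" and y: "y \<in> carrier_vec n"
  let ?d = "\<lambda>u v. (M *\<^sub>v u) \<bullet>c v - (N *\<^sub>v u) \<bullet>c v"
  have 0: "?d u u = 0" if "u \<in> carrier_vec n" for u using eq[OF that] by (simp add: qform_def)
  note c = mult_mat_vec_carrier[OF M] mult_mat_vec_carrier[OF N]
  have 1: "?d x y + ?d y x = 0"
    using 0[of "x + y"] 0[OF x] 0[OF y] x y M N
    by (simp add: cip_simps[where n=n] c algebra_simps)
  have 2: "?d y x - ?d x y = 0"
  proof -
    have "\<i> * (?d y x - ?d x y) = 0"
      using 0[of "x + \<i> \<cdot>\<^sub>v y"] 0[OF x] 0[OF y] x y M N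
      by (simp add: cip_simps[where n=n] c algebra_simps)
    then show ?thesis by simp
  qed
  have "a + b = 0 \<Longrightarrow> b - a = 0 \<Longrightarrow> a = 0" for a b :: complex
    by (auto simp: complex_eq_iff)
  from this[OF 1 2] show "(M *\<^sub>v x) \<bullet>c y = (N *\<^sub>v x) \<bullet>c y" by simp
qed

lemma qform_adjoint:
  assumes M: "M \<in> carrier_mat n n" and x: "x \<in> carrier_vec n"
  shows "qform (mat_adjoint M) x = cnj (qform M x)"
  unfolding qform_def
  using cip_adjoint[OF M x x] cip_commute[OF mult_mat_vec_carrier[OF mat_adjoint_carrier[OF M] x] x]
  by simp

text \<open>The forms of M and of its adjoint are conjugate, so a real form means that they agree,
  and \<open>mat_eqI_qform\<close> identifies the matrices. Hermiticity goals below thus become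
  computations of imaginary parts.\<close>

lemma hermitian_iff:
  assumes M: "M \<in> carrier_mat n n"
  shows "hermitian_mat M \<longleftrightarrow> (\<forall>x \<in> carrier_vec n. Im (qform M x) = 0)"
proof
  assume "hermitian_mat M"
  then have "mat_adjoint M = M" by (simp add: hermitian_mat_def)
  then show "\<forall>x \<in> carrier_vec n. Im (qform M x) = 0"
    using qform_adjoint[OF M] by (metis cnj.simps(2) neg_equal_zero)
next
  assume *: "\<forall>x \<in> carrier_vec n. Im (qform M x) = 0"
  have "mat_adjoint M = M"
    by (rule mat_eqI_qform[OF mat_adjoint_carrier[OF M] M])
      (use * qform_adjoint[OF M] in \<open>auto simp: complex_eq_iff\<close>)
  then show "hermitian_mat M" using M by (simp add: hermitian_mat_def)
qed

lemma hermitian_cip: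
  assumes "hermitian_mat M" and M: "M \<in> carrier_mat n n" and x: "x \<in> carrier_vec n" and y: "y \<in> carrier_vec n"
  shows "(M *\<^sub>v x) \<bullet>c y = x \<bullet>c (M *\<^sub>v y)"
  using cip_adjoint[OF M x y] assms(1) by (simp add: hermitian_mat_def)

lemma qform_linear:
  assumes "M \<in> carrier_mat n n" "N \<in> carrier_mat n n" "x \<in> carrier_vec n"
  shows "qform (M + N) x = qform M x + qform N x" "qform (M - N) x = qform M x - qform N x"
    "qform (c \<cdot>\<^sub>m M) x = c * qform M x"
  using assms mult_mat_vec_carrier[of M n n x] mult_mat_vec_carrier[of N n n x]
  unfolding qform_def by (simp_all add: cip_simps[where n=n])

lemma qform_one:
  assumes "x \<in> carrier_vec n"
  shows "qform (1\<^sub>m n) x = x \<bullet>c x"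
  using assms unfolding qform_def by simp

text \<open>The interface to the Loewner order: from here on the order is a pointwise inequality
  between real parts of forms.\<close>

lemma loewner_le_iff:
  assumes X: "X \<in> carrier_mat n n" and Y: "Y \<in> carrier_mat n n"
  shows "loewner_le X Y \<longleftrightarrow> hermitian_mat X \<and> hermitian_mat Y \<and>
    (\<forall>x \<in> carrier_vec n. Re (qform X x) \<le> Re (qform Y x))"
proof -
  have d: "Y - X \<in> carrier_mat n n" using X Y by auto
  show ?thesis
    unfolding loewner_le_def psd_mat_def hermitian_iff[OF d]
    using X Y d hermitian_iff[OF X] hermitian_iff[OF Y]
    by (auto simp: qform_linear[OF Y X])
qed

lemma mat_re_carrier [simp]: "X \<in> carrier_mat n n \<Longrightarrow> mat_re X \<in> carrier_mat n n"
  unfolding mat_re_def by simp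

lemma qform_mat_re:
  assumes X: "X \<in> carrier_mat n n" and x: "x \<in> carrier_vec n"
  shows "qform (mat_re X) x = complex_of_real (Re (qform X x))"
proof -
  have "X + mat_adjoint X \<in> carrier_mat n n" using X by simp
  then have "qform (mat_re X) x = (1/2) * (qform X x + cnj (qform X x))"
    unfolding mat_re_def using X x
    by (simp add: qform_linear[where n=n] qform_adjoint[OF X x])
  then show ?thesis by (simp add: complex_eq_iff)
qed

lemma hermitian_mat_re: "X \<in> carrier_mat n n \<Longrightarrow> hermitian_mat (mat_re X)"
  by (subst hermitian_iff[OF mat_re_carrier]) (auto simp: qform_mat_re)

section \<open>Polynomials of a matrix and the Cayley-Hamilton theorem\<close>

lemma mat_poly_0 [simp]: "mat_poly 0 X = 0\<^sub>m (dim_row X) (dim_row X)"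
  by (simp add: mat_poly_def)

lemma mat_poly_carrier [simp]:
  assumes X: "X \<in> carrier_mat n n" shows "mat_poly p X \<in> carrier_mat n n"
proof -
  have "foldr (\<lambda>c Y. c \<cdot>\<^sub>m 1\<^sub>m (dim_row X) + X * Y) cs (0\<^sub>m (dim_row X) (dim_row X)) \<in> carrier_mat n n" for cs
    using X by (induction cs) auto
  then show ?thesis by (simp add: mat_poly_def)
qed

lemma mat_poly_pCons:
  assumes X: "X \<in> carrier_mat n n"
  shows "mat_poly (pCons c p) X = c \<cdot>\<^sub>m 1\<^sub>m n + X * mat_poly p X"
\<comment> \<open>The zero polynomial has the empty coefficient list, so the Horner fold does not
  unfold there and this case is separate.\<close>
proof (cases "pCons c p = 0")
  case True
  then show ?thesis using X by (auto intro!: eq_matI)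
next
  case False
  then show ?thesis using X by (auto simp: mat_poly_def)
qed

lemma mat_poly_vec_pCons:
  assumes X: "X \<in> carrier_mat n n" and x: "x \<in> carrier_vec n"
  shows "mat_poly (pCons c p) X *\<^sub>v x = c \<cdot>\<^sub>v x + X *\<^sub>v (mat_poly p X *\<^sub>v x)"
  using x X mat_poly_carrier[OF X, of p] by (simp add: mat_poly_pCons[OF X] mat_add_vec[where n=n] mat_smult_vec[where n=n] mat_mult_vec[where n=n])

lemma mat_poly_vec_0:
  assumes X: "X \<in> carrier_mat n n" and x: "x \<in> carrier_vec n"
  shows "mat_poly 0 X *\<^sub>v x = 0\<^sub>v n"
  using X x by auto

lemma mat_poly_vec_carrier:
  assumes "X \<in> carrier_mat n n" "x \<in> carrier_vec n"
  shows "mat_poly p X *\<^sub>v x \<in> carrier_vec n"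
  using assms mult_mat_vec_carrier mat_poly_carrier by blast

lemma mat_poly_vec_add:
  assumes X: "X \<in> carrier_mat n n" and x: "x \<in> carrier_vec n"
  shows "mat_poly (p + q) X *\<^sub>v x = mat_poly p X *\<^sub>v x + mat_poly q X *\<^sub>v x"
proof (induction p q rule: poly_induct2)
  case 0
  show ?case using X x by (simp add: mat_poly_vec_0[OF X x] del: mat_poly_0)
next
  case (pCons a p b q)
  have c: "mat_poly p X *\<^sub>v x \<in> carrier_vec n" "mat_poly q X *\<^sub>v x \<in> carrier_vec n"
    using X x by (simp_all add: mat_poly_vec_carrier)
  have c': "X *\<^sub>v (mat_poly p X *\<^sub>v x) \<in> carrier_vec n" "X *\<^sub>v (mat_poly q X *\<^sub>v x) \<in> carrier_vec n"
    using X c by (auto intro: mult_mat_vec_carrier)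
  have "mat_poly (pCons a p + pCons b q) X *\<^sub>v x =
    (a + b) \<cdot>\<^sub>v x + X *\<^sub>v (mat_poly p X *\<^sub>v x + mat_poly q X *\<^sub>v x)"
    using X x pCons by (simp add: mat_poly_vec_pCons)
  also have "\<dots> = (a \<cdot>\<^sub>v x + X *\<^sub>v (mat_poly p X *\<^sub>v x)) + (b \<cdot>\<^sub>v x + X *\<^sub>v (mat_poly q X *\<^sub>v x))"
    unfolding mv_add[OF X c] using c' x X by (intro eq_vecI) (auto simp: algebra_simps)
  finally show ?case using X x by (simp add: mat_poly_vec_pCons)
qed

lemma mat_poly_vec_smult:
  assumes X: "X \<in> carrier_mat n n" and x: "x \<in> carrier_vec n"
  shows "mat_poly (Polynomial.smult a p) X *\<^sub>v x = a \<cdot>\<^sub>v (mat_poly p X *\<^sub>v x)"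
proof (induction p)
  case 0
  have "0\<^sub>v n = a \<cdot>\<^sub>v (0\<^sub>v n :: complex vec)" by (intro eq_vecI) auto
  then show ?case using X x by (simp add: mat_poly_vec_0[OF X x] del: mat_poly_0)
next
  case (pCons b p)
  have c: "mat_poly p X *\<^sub>v x \<in> carrier_vec n" using X x by (simp add: mat_poly_vec_carrier)
  then have "X *\<^sub>v (mat_poly p X *\<^sub>v x) \<in> carrier_vec n" using X by (auto intro: mult_mat_vec_carrier)
  then show ?case using X x c pCons
    by (simp add: mat_poly_vec_pCons mv_smult[OF X c]) (auto simp: algebra_simps intro!: eq_vecI)
qed

lemma mat_poly_vec_mult:
  assumes X: "X \<in> carrier_mat n n" and x: "x \<in> carrier_vec n"
  shows "mat_poly (p * q) X *\<^sub>v x = mat_poly p X *\<^sub>v (mat_poly q X *\<^sub>v x)"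
proof (induction p)
  case 0
  show ?case using X x by (simp add: mat_poly_vec_0[OF X] mat_poly_vec_carrier[OF X] del: mat_poly_0)
next
  case (pCons a p)
  have c: "mat_poly q X *\<^sub>v x \<in> carrier_vec n" "mat_poly (p * q) X *\<^sub>v x \<in> carrier_vec n"
    using X x by (simp_all add: mat_poly_vec_carrier)
  have c': "X *\<^sub>v (mat_poly (p * q) X *\<^sub>v x) \<in> carrier_vec n" using X c by (auto intro: mult_mat_vec_carrier)
  have "mat_poly (pCons a p * q) X *\<^sub>v x = a \<cdot>\<^sub>v (mat_poly q X *\<^sub>v x) + (0 \<cdot>\<^sub>v x + X *\<^sub>v (mat_poly (p * q) X *\<^sub>v x))"
    by (simp add: mat_poly_vec_add[OF X x] mat_poly_vec_smult[OF X x] mat_poly_vec_pCons[OF X x])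
  also have "\<dots> = a \<cdot>\<^sub>v (mat_poly q X *\<^sub>v x) + X *\<^sub>v (mat_poly (p * q) X *\<^sub>v x)"
    using c c' x X by (intro eq_vecI) auto
  also have "\<dots> = mat_poly (pCons a p) X *\<^sub>v (mat_poly q X *\<^sub>v x)"
    using pCons c by (simp add: mat_poly_vec_pCons[OF X])
  finally show ?case .
qed

lemma mat_eqI_vec:
  fixes M N :: "complex mat"
  assumes "M \<in> carrier_mat n n" "N \<in> carrier_mat n n"
    "\<And>x. x \<in> carrier_vec n \<Longrightarrow> M *\<^sub>v x = N *\<^sub>v x"
  shows "M = N"
  by (rule mat_eqI_cip[OF assms(1,2)]) (simp add: assms(3))

lemma mat_poly_mult:
  assumes X: "X \<in> carrier_mat n n"
  shows "mat_poly (p * q) X = mat_poly p X * mat_poly q X"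
proof (rule mat_eqI_vec[where n=n])
  show "mat_poly p X * mat_poly q X \<in> carrier_mat n n"
    using mult_carrier_mat mat_poly_carrier[OF X] by blast
qed (use X in \<open>auto simp: mat_poly_vec_mult mat_mult_vec[OF mat_poly_carrier mat_poly_carrier]\<close>)

lemma mat_poly_linear_vec:
  assumes X: "X \<in> carrier_mat n n" and x: "x \<in> carrier_vec n"
  shows "mat_poly [:- e, 1:] X *\<^sub>v x = X *\<^sub>v x - e \<cdot>\<^sub>v x"
proof -
  have "X *\<^sub>v x \<in> carrier_vec n" using X x by (rule mult_mat_vec_carrier)
  moreover have "X *\<^sub>v 0\<^sub>v n = 0\<^sub>v n" using X by auto
  ultimately show ?thesis using X x
    by (simp add: mat_poly_vec_pCons[OF X] mat_poly_vec_0[OF X] del: mat_poly_0) (auto intro!: eq_vecI)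
qed

lemma mat_poly_const_vec:
  assumes X: "X \<in> carrier_mat n n" and x: "x \<in> carrier_vec n"
  shows "mat_poly [:c:] X *\<^sub>v x = c \<cdot>\<^sub>v x"
proof -
  have "X *\<^sub>v 0\<^sub>v n = 0\<^sub>v n" using X by auto
  then show ?thesis using X x
    by (simp add: mat_poly_vec_pCons[OF X] mat_poly_vec_0[OF X] del: mat_poly_0)
qed

lemma mat_poly_similar:
  assumes X: "X \<in> carrier_mat n n" and wit: "similar_mat_wit X B P Q" and x: "x \<in> carrier_vec n"
  shows "mat_poly p X *\<^sub>v x = P *\<^sub>v (mat_poly p B *\<^sub>v (Q *\<^sub>v x))"
proof -
  from similar_mat_witD2[OF X wit] have 
    PQ: "P * Q = 1\<^sub>m n" "Q * P = 1\<^sub>m n" and Xe: "X = P * B * Q" and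
    B: "B \<in> carrier_mat n n" and P: "P \<in> carrier_mat n n" and Q: "Q \<in> carrier_mat n n" by auto
  have cv: "M *\<^sub>v y \<in> carrier_vec n" if "M \<in> carrier_mat n n" "y \<in> carrier_vec n" for M :: "complex mat" and y
    using that by (rule mult_mat_vec_carrier)
  have PQv: "P *\<^sub>v (Q *\<^sub>v y) = y" "Q *\<^sub>v (P *\<^sub>v y) = y" if y: "y \<in> carrier_vec n" for y
    using PQ mat_mult_vec[OF P Q y] mat_mult_vec[OF Q P y] y by simp_all
  have Xv: "X *\<^sub>v y = P *\<^sub>v (B *\<^sub>v (Q *\<^sub>v y))" if y: "y \<in> carrier_vec n" for y
    unfolding Xe using P B Q y by (simp add: mat_mult_vec[OF mult_carrier_mat[OF P B] Q y] mat_mult_vec[OF P B] cv[OF Q y])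
  show ?thesis
  proof (induction p)
    case 0
    have "P *\<^sub>v 0\<^sub>v n = 0\<^sub>v n" using P by auto
    then show ?case using X x B Q cv[OF Q x] by (simp add: mat_poly_vec_0[OF X] mat_poly_vec_0[OF B] del: mat_poly_0)
  next
    case (pCons a p)
    let ?y = "mat_poly p B *\<^sub>v (Q *\<^sub>v x)"
    have y: "?y \<in> carrier_vec n" using mat_poly_vec_carrier[OF B] cv[OF Q x] by auto
    have "mat_poly (pCons a p) X *\<^sub>v x = a \<cdot>\<^sub>v x + P *\<^sub>v (B *\<^sub>v ?y)"
      using pCons by (simp add: mat_poly_vec_pCons[OF X x] Xv cv[OF P y] PQv y)
    also have "\<dots> = P *\<^sub>v (a \<cdot>\<^sub>v (Q *\<^sub>v x) + B *\<^sub>v ?y)"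
      by (subst mv_add[OF P]) (simp_all add: cv[OF Q x] cv[OF B y] mv_smult[OF P] PQv x)
    finally show ?case by (simp add: mat_poly_vec_pCons[OF B cv[OF Q x]])
  qed
qed

text \<open>Schur triangularisation reduces the claim to an upper triangular B with the eigenvalues
  on its diagonal. The fact \<open>kill\<close> is the flag argument: B minus its k-th diagonal
  entry (counting from 0) maps vectors supported on the first k+1 coordinates to vectors supported
  on the first k.\<close>

lemma cayley_hamilton:
  fixes X :: "complex mat"
  assumes X: "X \<in> carrier_mat n n" and x: "x \<in> carrier_vec n"
  shows "mat_poly (char_poly X) X *\<^sub>v x = 0\<^sub>v n"
proof -
  obtain es where cp: "char_poly X = (\<Prod>e\<leftarrow>es. [:- e, 1:])" and len: "length es = n"
    using char_poly_factorized[OF X] by blast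
  obtain B P Q where sd: "schur_decomposition X es = (B,P,Q)" by (cases "schur_decomposition X es") auto
  from schur_decomposition[OF X cp sd] have wit: "similar_mat_wit X B P Q" and ut: "upper_triangular B" and dg: "diag_mat B = es" by auto
  from similar_mat_witD2[OF X wit] have B: "B \<in> carrier_mat n n" and P: "P \<in> carrier_mat n n" and Q: "Q \<in> carrier_mat n n" by auto
  have kill: "mat_poly (\<Prod>e\<leftarrow>take k es. [:- e, 1:]) B *\<^sub>v y = 0\<^sub>v n"
    if "k \<le> n" "y \<in> carrier_vec n" "\<forall>i<n. k \<le> i \<longrightarrow> y $ i = 0" for k and y :: "complex vec"
    using that
  proof (induction k arbitrary: y)
    case 0
    then have "y = 0\<^sub>v n" by (intro eq_vecI) auto
    moreover have "mat_poly 1 B *\<^sub>v 0\<^sub>v n = 0\<^sub>v n" using mat_poly_carrier[OF B, of 1] by auto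
    ultimately show ?case by simp
  next
    case (Suc k)
    have k: "k < n" using Suc by simp
    have ek: "es ! k = B $$ (k,k)" using dg k B by (auto simp: diag_mat_def)
    let ?z = "B *\<^sub>v y - es ! k \<cdot>\<^sub>v y"
    have By: "B *\<^sub>v y \<in> carrier_vec n" using B Suc by (auto intro: mult_mat_vec_carrier)
    have z: "?z \<in> carrier_vec n" using By Suc by auto
    have zero: "?z $ i = 0" if i: "i < n" "k \<le> i" for i
    proof -
      have "(B *\<^sub>v y) $ i = (\<Sum>j<n. B $$ (i,j) * y $ j)"
        using B Suc i by (intro mult_mat_vec_index_sum) auto
      also have "\<dots> = (\<Sum>j<n. if j = k then B $$ (i,j) * y $ j else 0)"
      proof (rule sum.cong, simp)
        fix j assume j: "j \<in> {..<n}"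
        show "B $$ (i,j) * y $ j = (if j = k then B $$ (i,j) * y $ j else 0)"
        proof (cases "j < k")
          case True
          then have "B $$ (i,j) = 0" using ut i B by (intro upper_triangularD[OF ut]) auto
          then show ?thesis using True by simp
        next
          case False
          then show ?thesis using Suc.prems(3) j by auto
        qed
      qed
      also have "\<dots> = B $$ (i,k) * y $ k" using k by simp
      finally have e: "(B *\<^sub>v y) $ i = B $$ (i,k) * y $ k" .
      have "?z $ i = (B *\<^sub>v y) $ i - es ! k * y $ i" using i By Suc.prems by auto
      moreover have "B $$ (i,k) = 0 \<and> y $ i = 0" if "i \<noteq> k"
      proof
        show "B $$ (i,k) = 0" using i that B by (intro upper_triangularD[OF ut]) auto
        show "y $ i = 0" using Suc.prems(3) i that by auto
      qed
      ultimately show ?thesis using e ek by (cases "i = k") auto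
    qed
    have tk: "take (Suc k) es = take k es @ [es ! k]" using k len by (simp add: take_Suc_conv_app_nth)
    have "mat_poly (\<Prod>e\<leftarrow>take (Suc k) es. [:- e, 1:]) B *\<^sub>v y = mat_poly (\<Prod>e\<leftarrow>take k es. [:- e, 1:]) B *\<^sub>v ?z"
      unfolding tk map_append prod_list.append
      using Suc.prems(2) by (simp add: mat_poly_vec_mult[OF B Suc.prems(2)] mat_poly_linear_vec[OF B] del: mult_pCons_right)
    also have "\<dots> = 0\<^sub>v n" using Suc.IH[OF _ z] zero k by auto
    finally show ?case .
  qed
  have "mat_poly (char_poly X) B *\<^sub>v (Q *\<^sub>v x) = 0\<^sub>v n"
    using kill[of n "Q *\<^sub>v x"] Q x len by (auto simp: cp)
  moreover have "P *\<^sub>v 0\<^sub>v n = 0\<^sub>v n" using P by auto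
  ultimately show ?thesis by (simp add: mat_poly_similar[OF X wit x])
qed

lemma mat_poly_cong_char_poly:
  fixes X :: "complex mat"
  assumes X: "X \<in> carrier_mat n n" and dvd: "char_poly X dvd p - q"
  shows "mat_poly p X = mat_poly q X"
proof (rule mat_eqI_vec[where n=n])
  fix x :: "complex vec" assume x: "x \<in> carrier_vec n"
  obtain s where "p - q = char_poly X * s" using dvd by (rule dvdE)
  then have "p = q + s * char_poly X" by (simp add: algebra_simps)
  then have "mat_poly p X *\<^sub>v x = mat_poly q X *\<^sub>v x + mat_poly s X *\<^sub>v 0\<^sub>v n"
    by (simp add: mat_poly_vec_add[OF X x] mat_poly_vec_mult[OF X x] cayley_hamilton[OF X x])
  also have "mat_poly s X *\<^sub>v 0\<^sub>v n = 0\<^sub>v n" using mat_poly_carrier[OF X, of s] by auto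
  also have "mat_poly q X *\<^sub>v x + 0\<^sub>v n = mat_poly q X *\<^sub>v x" using mat_poly_vec_carrier[OF X x] by simp
  finally show "mat_poly p X *\<^sub>v x = mat_poly q X *\<^sub>v x" .
qed (use X in auto)

section \<open>Primary matrix functions\<close>

text \<open>The divided difference of f at a, with the removable singularity filled in by the
  derivative.\<close>

definition dquot :: "complex \<Rightarrow> (complex \<Rightarrow> complex) \<Rightarrow> complex \<Rightarrow> complex" where
  "dquot a f z = (if z = a then deriv f a else (f z - f a) / (z - a))"

text \<open>Newton's form of the Hermite interpolant. A node may be repeated: the derivative value
  in \<open>dquot\<close> then supplies the higher-order conditions.\<close>

fun newton_poly :: "complex list \<Rightarrow> (complex \<Rightarrow> complex) \<Rightarrow> complex poly" where
  "newton_poly [] f = 0"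
| "newton_poly (a # as) f = [:f a:] + [:- a, 1:] * newton_poly as (dquot a f)"

fun newton_rem :: "complex list \<Rightarrow> (complex \<Rightarrow> complex) \<Rightarrow> complex \<Rightarrow> complex" where
  "newton_rem [] f = f"
| "newton_rem (a # as) f = newton_rem as (dquot a f)"

text \<open>A purely algebraic identity, valid for every f and z. Holomorphy enters only afterwards,
  to make the remainder \<open>newton_rem\<close> holomorphic.\<close>

lemma newton_expansion:
  "f z = poly (newton_poly as f) z + poly (\<Prod>a\<leftarrow>as. [:- a, 1:]) z * newton_rem as f z"
proof (induction as arbitrary: f)
  case (Cons a as)
  have "f z = f a + (z - a) * dquot a f z" by (simp add: dquot_def)
  then show ?case by (subst (asm) Cons.IH) (simp add: algebra_simps)
qed simp

lemma dquot_holomorphic: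
  assumes "f holomorphic_on S" "open S" "a \<in> S"
  shows "dquot a f holomorphic_on S"
proof (rule pole_theorem_open_0[of "\<lambda>z. f z - f a"])
  show "(\<lambda>z. f z - f a) holomorphic_on S" using assms by (intro holomorphic_intros)
  have "f field_differentiable at a" using assms by (simp add: holomorphic_on_imp_differentiable_at)
  then show "dquot a f a = deriv (\<lambda>z. f z - f a) a" by (simp add: dquot_def)
qed (use assms in \<open>auto simp: dquot_def\<close>)

lemma newton_rem_holomorphic:
  "f holomorphic_on S \<Longrightarrow> open S \<Longrightarrow> set as \<subseteq> S \<Longrightarrow> newton_rem as f holomorphic_on S"
  by (induction as arbitrary: f) (auto intro: dquot_holomorphic)

lemma higher_deriv_poly: "(deriv ^^ k) (poly p) = poly ((pderiv ^^ k) (p :: complex poly))"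
proof (induction k)
  case (Suc k)
  have "deriv (poly q) = poly (pderiv q)" for q :: "complex poly"
    by (intro ext DERIV_imp_deriv poly_DERIV)
  then show ?case using Suc by simp
qed simp

text \<open>In characteristic zero differentiation lowers the order of a root by exactly one, so m
  vanishing derivatives give order at least m.\<close>

lemma order_ge_if_pderiv_zero:
  fixes s :: "complex poly"
  assumes "s \<noteq> 0" "\<forall>k<m. poly ((pderiv ^^ k) s) a = 0"
  shows "m \<le> Polynomial.order a s"
  using assms
proof (induction m arbitrary: s)
  case (Suc m)
  have "poly s a = 0" using Suc.prems(2) by (metis funpow_0 zero_less_Suc)
  then have o: "Polynomial.order a s = Suc (Polynomial.order a (pderiv s))"
    using Suc.prems(1) by (rule order_pderiv[rotated])
  have "pderiv s \<noteq> 0"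
  proof
    assume "pderiv s = 0"
    then obtain c where "s = [:c:]" by (metis pderiv_iszero)
    then show False using \<open>poly s a = 0\<close> Suc.prems(1) by auto
  qed
  moreover have "\<forall>k<m. poly ((pderiv ^^ k) (pderiv s)) a = 0"
    using Suc.prems(2) by (metis Suc_less_eq funpow_Suc_right o_apply)
  ultimately have "m \<le> Polynomial.order a (pderiv s)" by (rule Suc.IH)
  then show ?case using o by simp
qed simp

lemma dvd_if_order_le:
  fixes c s :: "complex poly"
  assumes "c \<noteq> 0" "s \<noteq> 0" "\<And>a. poly c a = 0 \<Longrightarrow> Polynomial.order a c \<le> Polynomial.order a s"
  shows "c dvd s"
  using assms
proof (induction "degree c" arbitrary: c s)
  case 0
  then have "is_unit c" by (simp add: is_unit_iff_degree)
  then show ?case by (rule unit_imp_dvd)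
next
  case (Suc d)
  then have "\<not> constant (poly c)" by (simp add: constant_degree)
  from Fundamental_Theorem_Algebra.fundamental_theorem_of_algebra[OF this] obtain a where a: "poly c a = 0" by auto
  then have "Polynomial.order a c \<noteq> 0" using Suc.prems(1) by (simp add: order_root)
  then have "poly s a = 0" using Suc.prems a by (metis le_zero_eq order_root)
  obtain c' where c': "c = [:- a, 1:] * c'" using a poly_eq_0_iff_dvd by (metis dvdE)
  obtain s' where s': "s = [:- a, 1:] * s'" using \<open>poly s a = 0\<close> poly_eq_0_iff_dvd by (metis dvdE)
  have nz: "c' \<noteq> 0" "s' \<noteq> 0" using c' s' Suc.prems by auto
  have "degree c = degree [:- a, 1:] + degree c'"
    unfolding c' using nz by (intro degree_mult_eq) auto
  then have deg: "d = degree c'" using Suc(2) by simp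
  have "c' dvd s'"
  proof (rule Suc.hyps(1)[OF deg nz])
    fix b assume "poly c' b = 0"
    then have "poly c b = 0" using c' by simp
    then have "Polynomial.order b c \<le> Polynomial.order b s" by (rule Suc.prems(3))
    moreover have "Polynomial.order b c = Polynomial.order b [:- a, 1:] + Polynomial.order b c'"
      using Suc.prems(1) unfolding c' by (intro order_mult) auto
    moreover have "Polynomial.order b s = Polynomial.order b [:- a, 1:] + Polynomial.order b s'"
      using Suc.prems(2) unfolding s' by (intro order_mult) auto
    ultimately show "Polynomial.order b c' \<le> Polynomial.order b s'" by simp
  qed
  then show ?case unfolding c' s' by (rule mult_dvd_mono[OF dvd_refl])
qed

section \<open>Independence of the interpolant and the functional calculus\<close>

definition spec_in :: "nat \<Rightarrow> complex mat \<Rightarrow> complex set \<Rightarrow> bool" where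
  "spec_in n X S \<longleftrightarrow> X \<in> carrier_mat n n \<and> open S \<and> (\<forall>\<mu>. poly (char_poly X) \<mu> = 0 \<longrightarrow> \<mu> \<in> S)"

lemma char_poly_nonzero: "X \<in> carrier_mat n n \<Longrightarrow> char_poly X \<noteq> (0 :: complex poly)"
  using degree_monic_char_poly[of X n] by auto

text \<open>This frees \<open>matfun\<close> from its choice operator. A decomposition of f into p
  plus a holomorphic multiple of the characteristic polynomial shows that p satisfies the
  interpolation conditions. The polynomial actually chosen satisfies them too, so the two differ by
  a multiple of the characteristic polynomial, which Cayley-Hamilton kills.\<close>

lemma matfun_eqI:
  assumes X: "spec_in n X S" and r: "r holomorphic_on S"
    and f: "\<And>z. z \<in> S \<Longrightarrow> f z = poly p z + poly (char_poly X) z * r z"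
  shows "matfun f X = mat_poly p X"
proof -
  let ?c = "char_poly X"
  have Xc: "X \<in> carrier_mat n n" and S: "open S" using X by (auto simp: spec_in_def)
  let ?P = "\<lambda>p. \<forall>\<mu>. poly ?c \<mu> = 0 \<longrightarrow>
       (\<forall>k < Polynomial.order \<mu> ?c. (deriv ^^ k) f \<mu> = (deriv ^^ k) (poly p) \<mu>)"
  have P: "?P p"
  proof (intro allI impI)
    fix \<mu> k assume root: "poly ?c \<mu> = 0" and k: "k < Polynomial.order \<mu> ?c"
    have \<mu>: "\<mu> \<in> S" using X root by (simp add: spec_in_def)
    let ?m = "Polynomial.order \<mu> ?c"
    obtain q where q: "?c = [:- \<mu>, 1:] ^ ?m * q" using order_1[of \<mu> ?c] by (rule dvdE)
    define g where "g = (\<lambda>z. poly q z * r z)"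
    have g: "g holomorphic_on S" unfolding g_def using r by (intro holomorphic_intros)
    have w: "(\<lambda>w. (w - \<mu>) ^ ?m) holomorphic_on S" by (intro holomorphic_intros)
    have pc: "poly ?c z = (z - \<mu>) ^ ?m * poly q z" for z
      using arg_cong[OF q, of "\<lambda>p. poly p z"] by (simp add: poly_power)
    have fz: "f z = poly p z + (z - \<mu>) ^ ?m * g z" if "z \<in> S" for z
      using f[OF that] by (simp only: pc g_def mult.assoc)
    \<comment> \<open>Leibniz: each term differentiates the factor of order \<open>?m\<close> at
      most k < \<open>?m\<close> times, which leaves a zero at the eigenvalue.\<close>
    have zero: "(deriv ^^ k) (\<lambda>w. (w - \<mu>) ^ ?m * g w) \<mu> = 0"
      unfolding higher_deriv_mult[OF w g S \<mu>]
      using k by (intro sum.neutral) (auto simp: higher_deriv_power)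
    have hol: "(\<lambda>z. (z - \<mu>) ^ ?m * g z) holomorphic_on S" using w g by (rule holomorphic_on_mult)
    have ph: "poly p holomorphic_on S" by (intro holomorphic_intros)
    have "(deriv ^^ k) f \<mu> = (deriv ^^ k) (\<lambda>z. poly p z + (z - \<mu>) ^ ?m * g z) \<mu>"
    proof (rule higher_deriv_transform_within_open[OF _ _ S \<mu> fz])
      show "(\<lambda>z. poly p z + (z - \<mu>) ^ ?m * g z) holomorphic_on S"
        using ph hol by (rule holomorphic_on_add)
      then show "f holomorphic_on S" by (rule holomorphic_transform) (simp add: fz)
    qed
    also have "\<dots> = (deriv ^^ k) (poly p) \<mu> + (deriv ^^ k) (\<lambda>z. (z - \<mu>) ^ ?m * g z) \<mu>"
      using ph hol S \<mu> by (rule higher_deriv_add)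
    finally show "(deriv ^^ k) f \<mu> = (deriv ^^ k) (poly p) \<mu>" using zero by simp
  qed
  define q where "q = (SOME p. ?P p)"
  have Pq: "?P q" unfolding q_def using P by (rule someI)
  have "?c dvd q - p"
  proof (cases "q - p = 0")
    case False
    show ?thesis
    proof (rule dvd_if_order_le[OF char_poly_nonzero[OF Xc] False])
      fix a assume a: "poly ?c a = 0"
      have pd: "(pderiv ^^ k) (u - v) = (pderiv ^^ k) u - (pderiv ^^ k) v" for k and u v :: "complex poly"
        by (induction k) (simp_all add: pderiv_diff)
      show "Polynomial.order a ?c \<le> Polynomial.order a (q - p)"
        by (rule order_ge_if_pderiv_zero[OF False]) (use P Pq a in \<open>auto simp: pd higher_deriv_poly\<close>)
    qed
  qed simp
  then have "mat_poly q X = mat_poly p X" by (rule mat_poly_cong_char_poly[OF Xc])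
  then show ?thesis unfolding matfun_def q_def .
qed

lemma matfun_newton:
  assumes X: "spec_in n X S" and f: "f holomorphic_on S" and es: "char_poly X = (\<Prod>e\<leftarrow>es. [:- e, 1:])"
  shows "matfun f X = mat_poly (newton_poly es f) X"
proof -
  have "set es \<subseteq> S"
  proof
    fix e assume "e \<in> set es"
    then have "poly (char_poly X) e = 0" unfolding es by (induction es) auto
    then show "e \<in> S" using X by (simp add: spec_in_def)
  qed
  then have "newton_rem es f holomorphic_on S"
    using f X by (intro newton_rem_holomorphic) (auto simp: spec_in_def)
  then show ?thesis
    by (rule matfun_eqI[OF X]) (unfold es, rule newton_expansion)
qed

lemma matfun_rep:
  assumes X: "spec_in n X S" and f: "f holomorphic_on S"
  obtains p r where "r holomorphic_on S" "\<And>z. z \<in> S \<Longrightarrow> f z = poly p z + poly (char_poly X) z * r z"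
    "matfun f X = mat_poly p X"
proof -
  obtain es where es: "char_poly X = (\<Prod>e\<leftarrow>es. [:- e, 1:])"
    using char_poly_factorized[of X n] X by (auto simp: spec_in_def)
  have "set es \<subseteq> S"
  proof
    fix e assume "e \<in> set es"
    then have "poly (char_poly X) e = 0" unfolding es by (induction es) auto
    then show "e \<in> S" using X by (simp add: spec_in_def)
  qed
  then have "newton_rem es f holomorphic_on S"
    using f X by (intro newton_rem_holomorphic) (auto simp: spec_in_def)
  then show ?thesis
  proof (rule that)
    show "f z = poly (newton_poly es f) z + poly (char_poly X) z * newton_rem es f z" for z
      unfolding es by (rule newton_expansion)
    show "matfun f X = mat_poly (newton_poly es f) X" using X f es by (rule matfun_newton)
  qed
qed

lemma matfun_carrier [simp]: "X \<in> carrier_mat n n \<Longrightarrow> matfun f X \<in> carrier_mat n n"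
  unfolding matfun_def by simp

lemma matfun_cong:
  assumes X: "spec_in n X S" and f: "f holomorphic_on S" and eq: "\<And>z. z \<in> S \<Longrightarrow> g z = f z"
  shows "matfun g X = matfun f X"
proof -
  obtain p r where "r holomorphic_on S" "\<And>z. z \<in> S \<Longrightarrow> f z = poly p z + poly (char_poly X) z * r z"
    and m: "matfun f X = mat_poly p X" using matfun_rep[OF X f] by metis
  then have "matfun g X = mat_poly p X" by (intro matfun_eqI[OF X]) (auto simp: eq)
  then show ?thesis using m by simp
qed

lemma matfun_mult:
  assumes X: "spec_in n X S" and f: "f holomorphic_on S" and g: "g holomorphic_on S"
  shows "matfun (\<lambda>z. f z * g z) X = matfun f X * matfun g X"
proof -
  obtain p r where 1: "r holomorphic_on S" "\<And>z. z \<in> S \<Longrightarrow> f z = poly p z + poly (char_poly X) z * r z"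
    "matfun f X = mat_poly p X" using matfun_rep[OF X f] by metis
  obtain q s where 2: "s holomorphic_on S" "\<And>z. z \<in> S \<Longrightarrow> g z = poly q z + poly (char_poly X) z * s z"
    "matfun g X = mat_poly q X" using matfun_rep[OF X g] by metis
  have "matfun (\<lambda>z. f z * g z) X = mat_poly (p * q) X"
  proof (rule matfun_eqI[OF X])
    \<comment> \<open>The remainder read off from (p + c r)(q + c s) = p q + c (p s + q r + c r s),
      with c the characteristic polynomial.\<close>
    show "(\<lambda>z. poly p z * s z + poly q z * r z + poly (char_poly X) z * r z * s z) holomorphic_on S"
      using 1 2 by (intro holomorphic_intros)
  qed (simp add: 1 2 algebra_simps)
  moreover have "X \<in> carrier_mat n n" using X by (simp add: spec_in_def)
  ultimately show ?thesis using 1 2 mat_poly_mult by metis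
qed

lemma matfun_add_vec:
  assumes X: "spec_in n X S" and f: "f holomorphic_on S" and g: "g holomorphic_on S" and x: "x \<in> carrier_vec n"
  shows "matfun (\<lambda>z. f z + g z) X *\<^sub>v x = matfun f X *\<^sub>v x + matfun g X *\<^sub>v x"
proof -
  obtain p r where 1: "r holomorphic_on S" "\<And>z. z \<in> S \<Longrightarrow> f z = poly p z + poly (char_poly X) z * r z"
    "matfun f X = mat_poly p X" using matfun_rep[OF X f] by metis
  obtain q s where 2: "s holomorphic_on S" "\<And>z. z \<in> S \<Longrightarrow> g z = poly q z + poly (char_poly X) z * s z"
    "matfun g X = mat_poly q X" using matfun_rep[OF X g] by metis
  have "matfun (\<lambda>z. f z + g z) X = mat_poly (p + q) X"
  proof (rule matfun_eqI[OF X])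
    show "(\<lambda>z. r z + s z) holomorphic_on S"
      using 1 2 by (intro holomorphic_intros)
  qed (simp add: 1 2 algebra_simps)
  moreover have "X \<in> carrier_mat n n" using X by (simp add: spec_in_def)
  ultimately show ?thesis using 1 2 mat_poly_vec_add x by metis
qed

lemma matfun_const_vec:
  assumes X: "spec_in n X S" and x: "x \<in> carrier_vec n"
  shows "matfun (\<lambda>_. c) X *\<^sub>v x = c \<cdot>\<^sub>v x"
proof -
  have "matfun (\<lambda>_. c) X = mat_poly [:c:] X"
    by (rule matfun_eqI[OF X, of "\<lambda>_. 0"]) auto
  moreover have "X \<in> carrier_mat n n" using X by (simp add: spec_in_def)
  ultimately show ?thesis using mat_poly_const_vec[OF _ x] by simp
qed

lemma matfun_id:
  assumes X: "spec_in n X S"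
  shows "matfun (\<lambda>z. z) X = X"
proof (rule mat_eqI_vec[where n=n])
  have Xc: "X \<in> carrier_mat n n" using X by (simp add: spec_in_def)
  then show "matfun (\<lambda>z. z) X \<in> carrier_mat n n" "X \<in> carrier_mat n n" by auto
  fix x :: "complex vec" assume x: "x \<in> carrier_vec n"
  have "matfun (\<lambda>z. z) X = mat_poly [:-0, 1:] X"
    by (rule matfun_eqI[OF X, of "\<lambda>_. 0"]) auto
  then have "matfun (\<lambda>z. z) X *\<^sub>v x = X *\<^sub>v x - 0 \<cdot>\<^sub>v x" using mat_poly_linear_vec[OF Xc x] by metis
  then show "matfun (\<lambda>z. z) X *\<^sub>v x = X *\<^sub>v x" using Xc x by auto
qed

lemma matfun_smult_vec:
  assumes X: "spec_in n X S" and f: "f holomorphic_on S" and x: "x \<in> carrier_vec n"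
  shows "matfun (\<lambda>z. c * f z) X *\<^sub>v x = c \<cdot>\<^sub>v (matfun f X *\<^sub>v x)"
proof -
  have Xc: "X \<in> carrier_mat n n" using X by (simp add: spec_in_def)
  have v: "matfun f X *\<^sub>v x \<in> carrier_vec n" using Xc x by (metis mult_mat_vec_carrier matfun_carrier)
  have "matfun (\<lambda>z. c * f z) X = matfun (\<lambda>_. c) X * matfun f X"
    using f by (intro matfun_mult[OF X]) auto
  then show ?thesis
    using mat_mult_vec[OF matfun_carrier[OF Xc] matfun_carrier[OF Xc] x] matfun_const_vec[OF X v] by simp
qed

lemma matfun_mult_vec:
  assumes X: "spec_in n X S" and f: "f holomorphic_on S" and g: "g holomorphic_on S" and x: "x \<in> carrier_vec n"
  shows "matfun f X *\<^sub>v (matfun g X *\<^sub>v x) = matfun (\<lambda>z. f z * g z) X *\<^sub>v x"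
proof -
  have Xc: "X \<in> carrier_mat n n" using X by (simp add: spec_in_def)
  show ?thesis unfolding matfun_mult[OF X f g]
    using mat_mult_vec[OF matfun_carrier[OF Xc] matfun_carrier[OF Xc] x] by simp
qed

lemma matfun_sum_cip:
  assumes X: "spec_in n X S" and f: "\<And>i. i \<in> I \<Longrightarrow> f i holomorphic_on S" and "finite I"
    and x: "x \<in> carrier_vec n" and y: "y \<in> carrier_vec n"
  shows "(matfun (\<lambda>z. \<Sum>i\<in>I. c i * f i z) X *\<^sub>v x) \<bullet>c y = (\<Sum>i\<in>I. c i * ((matfun (f i) X *\<^sub>v x) \<bullet>c y))"
  using \<open>finite I\<close> f
proof (induction I rule: finite_induct)
  case empty
  show ?case using matfun_const_vec[OF X x, of 0] x y by (simp add: cip_smult_left[where n=n])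
next
  case (insert i I)
  have Xc: "X \<in> carrier_mat n n" using X by (simp add: spec_in_def)
  have v: "matfun g X *\<^sub>v x \<in> carrier_vec n" for g using Xc x by (metis mult_mat_vec_carrier matfun_carrier)
  have h: "(\<lambda>z. c i * f i z) holomorphic_on S" "(\<lambda>z. \<Sum>i\<in>I. c i * f i z) holomorphic_on S"
    using insert.prems by (auto intro!: holomorphic_intros)
  have "matfun (\<lambda>z. \<Sum>i\<in>insert i I. c i * f i z) X *\<^sub>v x
      = matfun (\<lambda>z. c i * f i z + (\<Sum>i\<in>I. c i * f i z)) X *\<^sub>v x"
    using insert.hyps by simp
  also have "\<dots> = c i \<cdot>\<^sub>v (matfun (f i) X *\<^sub>v x) + matfun (\<lambda>z. \<Sum>i\<in>I. c i * f i z) X *\<^sub>v x"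
    using insert.prems by (simp add: matfun_add_vec[OF X h x] matfun_smult_vec[OF X _ x])
  finally show ?case using insert y v by (simp add: cip_simps[where n=n])
qed

section \<open>Continuity of the functional calculus under locally uniform limits\<close>

text \<open>Off the ball of radius r around a the quotient is at most 2 e / r because its
  denominator is at least r. Inside, where the denominator degenerates, the maximum modulus
  principle carries the bound in from the sphere.\<close>

lemma dquot_bound:
  assumes h: "h holomorphic_on S" and S: "open S" and r: "0 < r" "cball a r \<subseteq> S"
    and bd: "\<And>z. z \<in> K \<union> cball a r \<Longrightarrow> cmod (h z) \<le> e" and z: "z \<in> K"
  shows "cmod (dquot a h z) \<le> 2 * e / r"
proof -
  have aS: "a \<in> S" using r by auto
  have d: "dquot a h holomorphic_on S" using dquot_holomorphic[OF h S aS] .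
  have ha: "cmod (h a) \<le> e" using bd[of a] r by auto
  have far: "cmod (dquot a h w) \<le> 2 * e / r" if w: "w \<in> K \<union> cball a r" "r \<le> cmod (w - a)" for w
  proof -
    have ne: "w \<noteq> a" using w r by auto
    have "cmod (h w - h a) \<le> e + e" using norm_triangle_ineq4[of "h w" "h a"] bd[OF w(1)] ha by linarith
    then have "cmod (h w - h a) / cmod (w - a) \<le> (e + e) / r"
      using w r by (intro frac_le) (use order_trans[OF norm_ge_zero ha] in auto)
    then show ?thesis using ne by (simp add: dquot_def norm_divide)
  qed
  show ?thesis
  proof (cases "r \<le> cmod (z - a)")
    case True
    then show ?thesis using far z by auto
  next
    case False
    then have zb: "z \<in> ball a r" by (simp add: dist_norm norm_minus_commute)
    show ?thesis
    proof (rule maximum_modulus_frontier[of "dquot a h" "ball a r"])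
      show "dquot a h holomorphic_on interior (ball a r)"
        using d r by (rule_tac holomorphic_on_subset) (auto simp: interior_open)
      show "continuous_on (closure (ball a r)) (dquot a h)"
        using holomorphic_on_imp_continuous_on[OF holomorphic_on_subset[OF d r(2)]] r(1) by simp
      fix w assume "w \<in> frontier (ball a r)"
      then have "w \<in> cball a r" "r \<le> cmod (w - a)" using r(1) by (auto simp: dist_norm norm_minus_commute)
      then show "cmod (dquot a h w) \<le> 2 * e / r" using far by auto
    qed (use zb in auto)
  qed
qed

text \<open>\<open>dquot\<close> is linear in the function, so the bound applies to g N - f. The
  compact set must be enlarged by a closed ball around the node, since the estimate near a uses
  values on that ball.\<close>

lemma dquot_uniform_limit:
  assumes g: "\<And>N. g N holomorphic_on S" and f: "f holomorphic_on S" and S: "open S" and a: "a \<in> S"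
    and lim: "\<And>K. compact K \<Longrightarrow> K \<subseteq> S \<Longrightarrow> uniform_limit K g f sequentially"
    and K: "compact K" "K \<subseteq> S"
  shows "uniform_limit K (\<lambda>N. dquot a (g N)) (dquot a f) sequentially"
proof (rule uniform_limitI)
  fix e :: real assume e: "e > 0"
  obtain r where r: "r > 0" "cball a r \<subseteq> S" using S a open_contains_cball by metis
  \<comment> \<open>Chosen so that the bound 2 d / r equals e / 2.\<close>
  define d where "d = e * r / 4"
  have d: "d > 0" using e r by (simp add: d_def)
  have "uniform_limit (K \<union> cball a r) g f sequentially" using K r by (intro lim) auto
  then have "\<forall>\<^sub>F N in sequentially. \<forall>z\<in>K \<union> cball a r. dist (g N z) (f z) < d"
    using d by (rule uniform_limitD)
  then show "\<forall>\<^sub>F N in sequentially. \<forall>z\<in>K. dist (dquot a (g N) z) (dquot a f z) < e"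
  proof (rule eventually_mono)
    fix N assume *: "\<forall>z\<in>K \<union> cball a r. dist (g N z) (f z) < d"
    have hh: "(\<lambda>z. g N z - f z) holomorphic_on S" using g f by (intro holomorphic_intros)
    have fd: "g N field_differentiable at a" "f field_differentiable at a"
      using g f S a holomorphic_on_imp_differentiable_at by blast+
    have dd: "dquot a (g N) z - dquot a f z = dquot a (\<lambda>z. g N z - f z) z" for z
      using fd by (auto simp: dquot_def diff_divide_distrib)
    show "\<forall>z\<in>K. dist (dquot a (g N) z) (dquot a f z) < e"
    proof
      fix z assume "z \<in> K"
      then have "cmod (dquot a (\<lambda>z. g N z - f z) z) \<le> 2 * d / r"
        using * by (intro dquot_bound[OF hh S r, where K=K]) (auto simp: dist_norm less_imp_le)
      also have "\<dots> < e" using e r by (simp add: d_def)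
      finally show "dist (dquot a (g N) z) (dquot a f z) < e" by (simp add: dist_norm dd)
    qed
  qed
qed

text \<open>The nodes in Newton's form are the fixed eigenvalues of X, and the coefficients are
  iterated divided differences, each continuous in f. The argument covers matrices that are not
  diagonalisable, as is required for the means of accretive matrices.\<close>

lemma matfun_tendsto:
  assumes X: "spec_in n X S" and g: "\<And>N. g N holomorphic_on S" and f: "f holomorphic_on S"
    and lim: "\<And>K. compact K \<Longrightarrow> K \<subseteq> S \<Longrightarrow> uniform_limit K g f sequentially"
    and x: "x \<in> carrier_vec n" and y: "y \<in> carrier_vec n"
  shows "(\<lambda>N. (matfun (g N) X *\<^sub>v x) \<bullet>c y) \<longlonglongrightarrow> (matfun f X *\<^sub>v x) \<bullet>c y"
proof -
  have Xc: "X \<in> carrier_mat n n" and S: "open S" using X by (auto simp: spec_in_def)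
  obtain es where es: "char_poly X = (\<Prod>e\<leftarrow>es. [:- e, 1:])"
    using char_poly_factorized[OF Xc] by auto
  have esS: "set es \<subseteq> S"
  proof
    fix e assume "e \<in> set es"
    then have "poly (char_poly X) e = 0" unfolding es by (induction es) auto
    then show "e \<in> S" using X by (simp add: spec_in_def)
  qed
  have "(\<lambda>N. (mat_poly (newton_poly as (g N)) X *\<^sub>v x) \<bullet>c y) \<longlonglongrightarrow> (mat_poly (newton_poly as f) X *\<^sub>v x) \<bullet>c y"
    if "set as \<subseteq> S" "y \<in> carrier_vec n" for as y
    using that g f lim
  proof (induction as arbitrary: g f y)
    case Nil
    show ?case by simp
  next
    case (Cons a as)
    \<comment> \<open>The factor X - a is moved to the other side of the inner product as its
      adjoint; this is why the induction generalises over y.\<close>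
    let ?y = "mat_adjoint (mat_poly [:- a, 1:] X) *\<^sub>v y"
    have y: "?y \<in> carrier_vec n" using Xc Cons.prems by (intro mult_mat_vec_carrier) auto
    have eq: "(mat_poly (newton_poly (a # as) h) X *\<^sub>v x) \<bullet>c y
      = h a * (x \<bullet>c y) + (mat_poly (newton_poly as (dquot a h)) X *\<^sub>v x) \<bullet>c ?y" for h
    proof -
      let ?v = "mat_poly (newton_poly as (dquot a h)) X *\<^sub>v x"
      have v: "?v \<in> carrier_vec n" using Xc x by (rule mat_poly_vec_carrier)
      have "mat_poly (newton_poly (a # as) h) X *\<^sub>v x = h a \<cdot>\<^sub>v x + mat_poly [:- a, 1:] X *\<^sub>v ?v"
        unfolding newton_poly.simps
        by (simp only: mat_poly_vec_add[OF Xc x] mat_poly_vec_mult[OF Xc x] mat_poly_const_vec[OF Xc x])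
      moreover have "mat_poly [:- a, 1:] X *\<^sub>v ?v \<in> carrier_vec n" using Xc v by (rule mat_poly_vec_carrier)
      ultimately have "(mat_poly (newton_poly (a # as) h) X *\<^sub>v x) \<bullet>c y
         = h a * (x \<bullet>c y) + (mat_poly [:- a, 1:] X *\<^sub>v ?v) \<bullet>c y"
        using x Cons.prems(2) by (simp add: cip_simps[where n=n])
      then show ?thesis using cip_adjoint[OF mat_poly_carrier[OF Xc] v Cons.prems(2)] by simp
    qed
    have a: "a \<in> S" using Cons.prems by auto
    have "uniform_limit {a} g f sequentially" using a by (intro Cons.prems) auto
    then have 1: "(\<lambda>N. g N a) \<longlonglongrightarrow> f a" by (rule tendsto_uniform_limitI) auto
    have 2: "(\<lambda>N. (mat_poly (newton_poly as (dquot a (g N))) X *\<^sub>v x) \<bullet>c ?y) \<longlonglongrightarrow> (mat_poly (newton_poly as (dquot a f)) X *\<^sub>v x) \<bullet>c ?y"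
    proof (rule Cons.IH[OF _ y])
      show "dquot a (g N) holomorphic_on S" for N using Cons.prems S a by (intro dquot_holomorphic) auto
      show "dquot a f holomorphic_on S" using Cons.prems S a by (intro dquot_holomorphic) auto
      show "uniform_limit K (\<lambda>x. dquot a (g x)) (dquot a f) sequentially" if "compact K" "K \<subseteq> S" for K
        using Cons.prems S a that by (intro dquot_uniform_limit[where S=S]) auto
    qed (use Cons.prems in auto)
    show ?case unfolding eq using 1 2 by (intro tendsto_intros)
  qed
  from this[OF esS y] show ?thesis
    using matfun_newton[OF X _ es] g f by simp
qed

section \<open>Spectral calculus of Hermitian matrices\<close>

definition eigs :: "complex mat \<Rightarrow> complex set" where
  "eigs X = {\<mu>. poly (char_poly X) \<mu> = 0}"

lemma finite_eigs: "X \<in> carrier_mat n n \<Longrightarrow> finite (eigs X)"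
  unfolding eigs_def by (rule poly_roots_finite) (rule char_poly_nonzero)

lemma eigs_eigenvector:
  assumes X: "X \<in> carrier_mat n n" and "\<mu> \<in> eigs X"
  obtains v where "v \<in> carrier_vec n" "v \<noteq> 0\<^sub>v n" "X *\<^sub>v v = \<mu> \<cdot>\<^sub>v v"
  using assms eigenvalue_root_char_poly[OF X, of \<mu>] unfolding eigs_def eigenvalue_def eigenvector_def by auto

lemma poly_interpolation_exists:
  fixes g :: "complex \<Rightarrow> complex"
  assumes "finite A"
  shows "\<exists>p. \<forall>a\<in>A. poly p a = g a"
  using assms
proof (induction A rule: finite_induct)
  case (insert b A)
  then obtain p where p: "\<forall>a\<in>A. poly p a = g a" by auto
  define q where "q = (\<Prod>a\<in>A. [:- a, 1:])"
  have q0: "poly q a = 0" if "a \<in> A" for a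
    using that insert.hyps(1) unfolding q_def poly_prod by (intro prod_zero) auto
  have qb: "poly q b \<noteq> 0" using insert.hyps unfolding q_def poly_prod by auto
  have "\<forall>a\<in>insert b A. poly (p + Polynomial.smult ((g b - poly p b) / poly q b) q) a = g a"
    using p q0 qb by auto
  then show ?case by blast
qed simp

lemma prod_linear_dvd:
  fixes p :: "complex poly"
  assumes "finite A" "\<forall>a\<in>A. poly p a = 0"
  shows "(\<Prod>a\<in>A. [:- a, 1:]) dvd p"
  using assms
proof (induction A arbitrary: p rule: finite_induct)
  case (insert b A)
  obtain q where q: "p = [:- b, 1:] * q" using insert.prems poly_eq_0_iff_dvd by (metis dvdE insertI1)
  have "\<forall>a\<in>A. poly q a = 0" using insert.prems insert.hyps q by auto
  then have "(\<Prod>a\<in>A. [:- a, 1:]) dvd q" by (rule insert.IH)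
  then have "[:- b, 1:] * (\<Prod>a\<in>A. [:- a, 1:]) dvd [:- b, 1:] * q" by (rule mult_dvd_mono[OF dvd_refl])
  then show ?case using insert.hyps unfolding q by simp
qed simp

lemma mv_zero:
  fixes M :: "complex mat"
  assumes "M \<in> carrier_mat n n" shows "M *\<^sub>v 0\<^sub>v n = 0\<^sub>v n"
  using assms by auto

lemma zero_smult_add_vec:
  fixes x y :: "complex vec"
  assumes "x \<in> carrier_vec n" "y \<in> carrier_vec n"
  shows "0 \<cdot>\<^sub>v x + y = y"
  using assms by (intro eq_vecI) auto

lemma mat_poly_X_vec:
  assumes X: "X \<in> carrier_mat n n" and x: "x \<in> carrier_vec n"
  shows "mat_poly [:0, 1:] X *\<^sub>v x = X *\<^sub>v x"
  using zero_smult_add_vec[OF x mult_mat_vec_carrier[OF X x]] x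
  by (simp only: mat_poly_vec_pCons[OF X x, of 0 "[:1:]"] mat_poly_const_vec[OF X x] one_smult_vec)

locale herm =
  fixes n :: nat and X :: "complex mat"
  assumes carr [simp]: "X \<in> carrier_mat n n" and herm: "hermitian_mat X"
begin

lemma eigs_real: "\<mu> \<in> eigs X \<Longrightarrow> \<mu> = complex_of_real (Re \<mu>)"
proof -
  assume "\<mu> \<in> eigs X"
  then obtain v where v: "v \<in> carrier_vec n" "v \<noteq> 0\<^sub>v n" "X *\<^sub>v v = \<mu> \<cdot>\<^sub>v v" by (rule eigs_eigenvector[OF carr])
  have "Im (qform X v) = 0" using herm v(1) by (simp add: hermitian_iff[OF carr])
  moreover have "qform X v = \<mu> * (v \<bullet>c v)" using v by (simp add: qform_def cip_smult_left[where n=n])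
  moreover have "Im (v \<bullet>c v) = 0" "Re (v \<bullet>c v) \<noteq> 0" using cip_self[OF v(1)] v(2) by auto
  ultimately have "Im \<mu> = 0" by simp
  then show ?thesis by (simp add: complex_eq_iff)
qed

text \<open>The eigenvalue e is real, so L = X - e is self-adjoint and the squared norm of L y is
  the inner product of L (L y) with y.\<close>

lemma square_kernel:
  assumes e: "e \<in> eigs X" and y: "y \<in> carrier_vec n"
    and zero: "mat_poly ([:- e, 1:] * [:- e, 1:]) X *\<^sub>v y = 0\<^sub>v n"
  shows "mat_poly [:- e, 1:] X *\<^sub>v y = 0\<^sub>v n"
proof -
  let ?L = "mat_poly [:- e, 1:] X"
  have er: "cnj e = e" using eigs_real[OF e] by (metis complex_cnj_complex_of_real)
  have c: "?L *\<^sub>v u \<in> carrier_vec n" "X *\<^sub>v u \<in> carrier_vec n" if "u \<in> carrier_vec n" for u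
    using mat_poly_vec_carrier[OF carr that] mult_mat_vec_carrier[OF carr that] .
  have sym: "(?L *\<^sub>v u) \<bullet>c w = u \<bullet>c (?L *\<^sub>v w)" if u: "u \<in> carrier_vec n" and w: "w \<in> carrier_vec n" for u w
    using c(2)[OF u] c(2)[OF w] u w hermitian_cip[OF herm carr u w] er
    by (simp add: mat_poly_linear_vec[OF carr] cip_simps[where n=n] del: mat_poly_pCons)
  have "(?L *\<^sub>v y) \<bullet>c (?L *\<^sub>v y) = (?L *\<^sub>v (?L *\<^sub>v y)) \<bullet>c y" using sym[OF c(1)[OF y] y] by simp
  also have "\<dots> = 0" using zero y unfolding mat_poly_vec_mult[OF carr y] by simp
  finally show ?thesis using cip_self(3)[OF c(1)[OF y]] by simp
qed

text \<open>Multiplicities are removed one at a time by \<open>square_kernel\<close>: the minimal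
  polynomial of a Hermitian matrix is square-free.\<close>

lemma list_to_set_kernel:
  assumes "set es \<subseteq> eigs X" "y \<in> carrier_vec n" "mat_poly (\<Prod>e\<leftarrow>es. [:- e, 1:]) X *\<^sub>v y = 0\<^sub>v n"
  shows "mat_poly (\<Prod>e\<in>set es. [:- e, 1:]) X *\<^sub>v y = 0\<^sub>v n"
  using assms
proof (induction es arbitrary: y)
  case (Cons e es)
  let ?L = "mat_poly [:- e, 1:] X" and ?P = "\<Prod>e\<in>set es. [:- e, 1:]"
  have c: "mat_poly p X *\<^sub>v u \<in> carrier_vec n" if "u \<in> carrier_vec n" for u p
    using mat_poly_vec_carrier[OF carr that] .
  have y: "y \<in> carrier_vec n" by fact
  have "mat_poly (\<Prod>e\<leftarrow>es. [:- e, 1:]) X *\<^sub>v (?L *\<^sub>v y) = 0\<^sub>v n"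
    using Cons.prems(3) unfolding mat_poly_vec_mult[OF carr y, symmetric] by (simp add: mult.commute)
  then have *: "mat_poly (?P * [:- e, 1:]) X *\<^sub>v y = 0\<^sub>v n"
    using Cons.IH[OF _ c[OF y]] Cons.prems(1) unfolding mat_poly_vec_mult[OF carr y] by auto
  show ?case
  proof (cases "e \<in> set es")
    case False
    then have "(\<Prod>e\<in>set (e # es). [:- e, 1:]) = ?P * [:- e, 1:]" by (simp add: mult.commute)
    then show ?thesis using * by simp
  next
    case True
    let ?R = "\<Prod>e\<in>set es - {e}. [:- e, 1:]"
    have P: "?P = [:- e, 1:] * ?R" using True by (intro prod.remove) auto
    have "?P * [:- e, 1:] = ([:- e, 1:] * [:- e, 1:]) * ?R" unfolding P by (simp only: ac_simps)
    then have "mat_poly ([:- e, 1:] * [:- e, 1:]) X *\<^sub>v (mat_poly ?R X *\<^sub>v y) = 0\<^sub>v n"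
      using * mat_poly_vec_mult[OF carr y] by metis
    then have "?L *\<^sub>v (mat_poly ?R X *\<^sub>v y) = 0\<^sub>v n"
      using Cons.prems(1) c[OF y] by (intro square_kernel) auto
    then have "mat_poly ?P X *\<^sub>v y = 0\<^sub>v n" unfolding P mat_poly_vec_mult[OF carr y] .
    moreover have "set (e # es) = set es" using True by auto
    ultimately show ?thesis by simp
  qed
qed simp

text \<open>For Hermitian X only the values on the spectrum matter, not the derivatives. This is
  what makes \<open>hfun\<close> meaningful for arbitrary functions, in particular for indicators of
  eigenvalues.\<close>

lemma poly_vanish:
  assumes "\<forall>\<mu>\<in>eigs X. poly p \<mu> = 0" and y: "y \<in> carrier_vec n"
  shows "mat_poly p X *\<^sub>v y = 0\<^sub>v n"
proof -
  obtain es where es: "char_poly X = (\<Prod>e\<leftarrow>es. [:- e, 1:])" using char_poly_factorized[OF carr] by auto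
  have set: "set es = eigs X"
  proof -
    have "poly (\<Prod>e\<leftarrow>es. [:- e, 1:]) z = 0 \<longleftrightarrow> z \<in> set es" for z by (induction es) auto
    then show ?thesis unfolding eigs_def es by auto
  qed
  have "mat_poly (\<Prod>e\<in>set es. [:- e, 1:]) X *\<^sub>v y = 0\<^sub>v n"
    using list_to_set_kernel[of es y] set y cayley_hamilton[OF carr y] es by simp
  moreover obtain q where "p = (\<Prod>e\<in>set es. [:- e, 1:]) * q"
    using prod_linear_dvd[of "set es" p] assms(1) set by (metis List.finite_set dvdE)
  then have "p = q * (\<Prod>e\<in>set es. [:- e, 1:])" by (simp add: mult.commute)
  moreover have "mat_poly q X *\<^sub>v 0\<^sub>v n = 0\<^sub>v n" by (rule mv_zero[OF mat_poly_carrier[OF carr]])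
  ultimately show ?thesis by (simp add: mat_poly_vec_mult[OF carr y])
qed

lemma poly_cong:
  assumes "\<forall>\<mu>\<in>eigs X. poly p \<mu> = poly q \<mu>"
  shows "mat_poly p X = mat_poly q X"
proof (rule mat_eqI_vec[where n=n])
  fix y :: "complex vec" assume y: "y \<in> carrier_vec n"
  have "mat_poly (q + (p - q)) X *\<^sub>v y = mat_poly q X *\<^sub>v y + 0\<^sub>v n"
    unfolding mat_poly_vec_add[OF carr y] using poly_vanish[OF _ y, of "p - q"] assms by simp
  then show "mat_poly p X *\<^sub>v y = mat_poly q X *\<^sub>v y" using mat_poly_vec_carrier[OF carr y] by simp
qed auto

definition hfun :: "(complex \<Rightarrow> complex) \<Rightarrow> complex mat" where
  "hfun g = mat_poly (SOME p. \<forall>\<mu>\<in>eigs X. poly p \<mu> = g \<mu>) X"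

lemma hfun_eq:
  assumes "\<And>\<mu>. \<mu> \<in> eigs X \<Longrightarrow> poly p \<mu> = g \<mu>"
  shows "hfun g = mat_poly p X"
proof -
  have "\<forall>\<mu>\<in>eigs X. poly (SOME p. \<forall>\<mu>\<in>eigs X. poly p \<mu> = g \<mu>) \<mu> = g \<mu>"
    using poly_interpolation_exists[OF finite_eigs[OF carr], of g] by (rule someI_ex)
  then show ?thesis unfolding hfun_def using assms by (intro poly_cong) auto
qed

lemma hfun_rep:
  obtains p where "\<And>\<mu>. \<mu> \<in> eigs X \<Longrightarrow> poly p \<mu> = g \<mu>" "hfun g = mat_poly p X"
  using poly_interpolation_exists[OF finite_eigs[OF carr], of g] hfun_eq by metis

lemma hfun_carrier [simp]: "hfun g \<in> carrier_mat n n"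
  unfolding hfun_def by simp

lemma hfun_vec_carrier [simp]: "x \<in> carrier_vec n \<Longrightarrow> hfun g *\<^sub>v x \<in> carrier_vec n"
  using mult_mat_vec_carrier[OF hfun_carrier] .

lemma hfun_cong: "(\<And>\<mu>. \<mu> \<in> eigs X \<Longrightarrow> g \<mu> = h \<mu>) \<Longrightarrow> hfun g = hfun h"
  using hfun_rep[of h] hfun_eq[of _ g] by metis

lemma hfun_mult_vec:
  assumes x: "x \<in> carrier_vec n"
  shows "hfun g *\<^sub>v (hfun h *\<^sub>v x) = hfun (\<lambda>z. g z * h z) *\<^sub>v x"
proof -
  obtain p where p: "\<And>\<mu>. \<mu> \<in> eigs X \<Longrightarrow> poly p \<mu> = g \<mu>" "hfun g = mat_poly p X" using hfun_rep by metis
  obtain q where q: "\<And>\<mu>. \<mu> \<in> eigs X \<Longrightarrow> poly q \<mu> = h \<mu>" "hfun h = mat_poly q X" using hfun_rep by metis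
  have "hfun (\<lambda>z. g z * h z) = mat_poly (p * q) X" using p q by (intro hfun_eq) simp
  then show ?thesis using p q by (simp add: mat_poly_vec_mult[OF carr x])
qed

lemma hfun_add_vec:
  assumes x: "x \<in> carrier_vec n"
  shows "hfun (\<lambda>z. g z + h z) *\<^sub>v x = hfun g *\<^sub>v x + hfun h *\<^sub>v x"
proof -
  obtain p where p: "\<And>\<mu>. \<mu> \<in> eigs X \<Longrightarrow> poly p \<mu> = g \<mu>" "hfun g = mat_poly p X" using hfun_rep by metis
  obtain q where q: "\<And>\<mu>. \<mu> \<in> eigs X \<Longrightarrow> poly q \<mu> = h \<mu>" "hfun h = mat_poly q X" using hfun_rep by metis
  have "hfun (\<lambda>z. g z + h z) = mat_poly (p + q) X" using p q by (intro hfun_eq) simp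
  then show ?thesis using p q by (simp add: mat_poly_vec_add[OF carr x])
qed

lemma hfun_const_vec:
  assumes x: "x \<in> carrier_vec n"
  shows "hfun (\<lambda>_. c) *\<^sub>v x = c \<cdot>\<^sub>v x"
proof -
  have "hfun (\<lambda>_. c) = mat_poly [:c:] X" by (rule hfun_eq) simp
  then show ?thesis using mat_poly_const_vec[OF carr x] by simp
qed

lemma hfun_smult_vec:
  assumes x: "x \<in> carrier_vec n"
  shows "hfun (\<lambda>z. c * g z) *\<^sub>v x = c \<cdot>\<^sub>v (hfun g *\<^sub>v x)"
  using hfun_mult_vec[OF x, of "\<lambda>_. c" g] hfun_const_vec[of "hfun g *\<^sub>v x"] x by simp

lemma hfun_id: "hfun (\<lambda>z. z) = X"
proof (rule mat_eqI_vec[where n=n])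
  fix x :: "complex vec" assume x: "x \<in> carrier_vec n"
  have "hfun (\<lambda>z. z) = mat_poly [:0, 1:] X" by (rule hfun_eq) simp
  then show "hfun (\<lambda>z. z) *\<^sub>v x = X *\<^sub>v x" using mat_poly_X_vec[OF carr x] by simp
qed auto

lemma hfun_sum_cip:
  assumes "finite I" and x: "x \<in> carrier_vec n" and y: "y \<in> carrier_vec n"
  shows "(hfun (\<lambda>z. \<Sum>i\<in>I. c i * g i z) *\<^sub>v x) \<bullet>c y = (\<Sum>i\<in>I. c i * ((hfun (g i) *\<^sub>v x) \<bullet>c y))"
  using \<open>finite I\<close>
proof (induction I rule: finite_induct)
  case empty
  show ?case using hfun_const_vec[OF x, of 0] x y by (simp add: cip_smult_left[where n=n])
next
  case (insert i I)
  have "hfun (\<lambda>z. \<Sum>i\<in>insert i I. c i * g i z) *\<^sub>v x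
      = hfun (\<lambda>z. c i * g i z + (\<Sum>i\<in>I. c i * g i z)) *\<^sub>v x"
    using insert.hyps by simp
  also have "\<dots> = c i \<cdot>\<^sub>v (hfun (g i) *\<^sub>v x) + hfun (\<lambda>z. \<Sum>i\<in>I. c i * g i z) *\<^sub>v x"
    by (simp add: hfun_add_vec[OF x] hfun_smult_vec[OF x])
  finally show ?case using insert y x by (simp add: cip_simps[where n=n])
qed

lemma mat_poly_adjoint:
  assumes x: "x \<in> carrier_vec n" and y: "y \<in> carrier_vec n"
  shows "(mat_poly p X *\<^sub>v x) \<bullet>c y = x \<bullet>c (mat_poly (map_poly cnj p) X *\<^sub>v y)"
  using x y
proof (induction p arbitrary: x y)
  case 0
  then show ?case by (simp add: mat_poly_vec_0[OF carr] del: mat_poly_0)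
next
  case (pCons a p)
  have c: "mat_poly p X *\<^sub>v u \<in> carrier_vec n" "X *\<^sub>v u \<in> carrier_vec n" if "u \<in> carrier_vec n" for u p
    using mat_poly_vec_carrier[OF carr that] mult_mat_vec_carrier[OF carr that] .
  have comm: "mat_poly q X *\<^sub>v (X *\<^sub>v y) = X *\<^sub>v (mat_poly q X *\<^sub>v y)" for q
  proof -
    have "mat_poly q X *\<^sub>v (mat_poly [:0, 1:] X *\<^sub>v y) = mat_poly [:0, 1:] X *\<^sub>v (mat_poly q X *\<^sub>v y)"
      using mat_poly_vec_mult[OF carr pCons.prems(2)] by (metis mult.commute)
    then show ?thesis using mat_poly_X_vec[OF carr] pCons.prems c by metis
  qed
  have mp: "map_poly cnj (pCons a p) = pCons (cnj a) (map_poly cnj p)"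
    using pCons.hyps by (intro map_poly_pCons) auto
  have "(mat_poly (pCons a p) X *\<^sub>v x) \<bullet>c y = a * (x \<bullet>c y) + (mat_poly p X *\<^sub>v x) \<bullet>c (X *\<^sub>v y)"
    using pCons.prems c by (simp add: mat_poly_vec_pCons[OF carr] cip_simps[where n=n] hermitian_cip[OF herm carr])
  also have "(mat_poly p X *\<^sub>v x) \<bullet>c (X *\<^sub>v y) = x \<bullet>c (X *\<^sub>v (mat_poly (map_poly cnj p) X *\<^sub>v y))"
    using pCons.IH[of x "X *\<^sub>v y"] pCons.prems c comm by simp
  also have "a * (x \<bullet>c y) + \<dots> = x \<bullet>c (mat_poly (map_poly cnj (pCons a p)) X *\<^sub>v y)"
    unfolding mp using pCons.prems c by (simp add: mat_poly_vec_pCons[OF carr] cip_simps[where n=n])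
  finally show ?case .
qed

lemma hfun_adjoint:
  assumes x: "x \<in> carrier_vec n" and y: "y \<in> carrier_vec n"
  shows "(hfun g *\<^sub>v x) \<bullet>c y = x \<bullet>c (hfun (\<lambda>z. cnj (g z)) *\<^sub>v y)"
proof -
  obtain p where p: "\<And>\<mu>. \<mu> \<in> eigs X \<Longrightarrow> poly p \<mu> = g \<mu>" "hfun g = mat_poly p X" using hfun_rep by metis
  have "hfun (\<lambda>z. cnj (g z)) = mat_poly (map_poly cnj p) X"
  proof (rule hfun_eq)
    fix \<mu> assume \<mu>: "\<mu> \<in> eigs X"
    have "poly (map_poly cnj p) (cnj \<mu>) = cnj (poly p \<mu>)" by (rule poly_cnj[symmetric])
    then show "poly (map_poly cnj p) \<mu> = cnj (g \<mu>)"
      using p(1)[OF \<mu>] eigs_real[OF \<mu>] by (metis complex_cnj_complex_of_real)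
  qed
  then show ?thesis using p mat_poly_adjoint[OF x y] by simp
qed

section \<open>Spectral weights and functions of a real variable\<close>

text \<open>The mass at \<mu> of the spectral measure of X belonging to the vector x.\<close>

definition sweight :: "complex vec \<Rightarrow> complex \<Rightarrow> real" where
  "sweight x \<mu> = Re (qform (hfun (\<lambda>z. if z = \<mu> then 1 else 0)) x)"

text \<open>An indicator is idempotent and real, so its \<open>hfun\<close> is an orthogonal
  projection and the form is a squared norm.\<close>

lemma sweight_norm:
  assumes x: "x \<in> carrier_vec n"
  shows "qform (hfun (\<lambda>z. if z = \<mu> then 1 else 0)) x = complex_of_real (sweight x \<mu>)" "sweight x \<mu> \<ge> 0"
proof -
  let ?i = "\<lambda>z. if z = \<mu> then 1 else 0 :: complex"
  have "hfun ?i *\<^sub>v (hfun ?i *\<^sub>v x) = hfun ?i *\<^sub>v x"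
    unfolding hfun_mult_vec[OF x] by (intro arg_cong2[where f=mult_mat_vec] hfun_cong) auto
  moreover have "(hfun ?i *\<^sub>v (hfun ?i *\<^sub>v x)) \<bullet>c x = (hfun ?i *\<^sub>v x) \<bullet>c (hfun (\<lambda>z. cnj (?i z)) *\<^sub>v x)"
    using x by (intro hfun_adjoint) auto
  moreover have "hfun (\<lambda>z. cnj (?i z)) = hfun ?i" by (rule hfun_cong) auto
  ultimately have e: "qform (hfun ?i) x = (hfun ?i *\<^sub>v x) \<bullet>c (hfun ?i *\<^sub>v x)" by (simp add: qform_def)
  show "qform (hfun ?i) x = complex_of_real (sweight x \<mu>)" "sweight x \<mu> \<ge> 0"
    unfolding sweight_def e using cip_self[of "hfun ?i *\<^sub>v x" n] x by (auto simp: complex_eq_iff)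
qed

lemma hfun_qform:
  assumes x: "x \<in> carrier_vec n"
  shows "qform (hfun g) x = (\<Sum>\<mu>\<in>eigs X. g \<mu> * complex_of_real (sweight x \<mu>))"
proof -
  have "hfun g = hfun (\<lambda>z. \<Sum>\<mu>\<in>eigs X. g \<mu> * (if z = \<mu> then 1 else 0))"
    using finite_eigs[OF carr] by (intro hfun_cong) (simp add: if_distrib cong: if_cong)
  then show ?thesis
    using hfun_sum_cip[OF finite_eigs[OF carr] x x] sweight_norm(1)[OF x] by (simp add: qform_def)
qed

text \<open>At an eigenvalue the characteristic polynomial vanishes, so the Hermite interpolant
  agrees with f there; for Hermitian X these values decide.\<close>

lemma matfun_eq_hfun:
  assumes "spec_in n X S" "f holomorphic_on S"
  shows "matfun f X = hfun f"
proof -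
  obtain p r where "\<And>z. z \<in> S \<Longrightarrow> f z = poly p z + poly (char_poly X) z * r z" "matfun f X = mat_poly p X"
    using matfun_rep[OF assms] by metis
  then show ?thesis
    using assms(1) by (intro hfun_eq[symmetric, THEN trans[rotated]] ) (auto simp: eigs_def spec_in_def hfun_eq)
qed

definition rfun :: "(real \<Rightarrow> real) \<Rightarrow> complex mat" where
  "rfun g = hfun (\<lambda>z. complex_of_real (g (Re z)))"

lemma rfun_carrier [simp]: "rfun g \<in> carrier_mat n n"
  unfolding rfun_def by simp

lemma rfun_vec_carrier [simp]: "x \<in> carrier_vec n \<Longrightarrow> rfun g *\<^sub>v x \<in> carrier_vec n"
  unfolding rfun_def by simp

lemma rfun_cong: "(\<And>\<mu>. \<mu> \<in> eigs X \<Longrightarrow> g (Re \<mu>) = h (Re \<mu>)) \<Longrightarrow> rfun g = rfun h"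
  unfolding rfun_def by (rule hfun_cong) simp

lemma rfun_mult_vec:
  "x \<in> carrier_vec n \<Longrightarrow> rfun g *\<^sub>v (rfun h *\<^sub>v x) = rfun (\<lambda>t. g t * h t) *\<^sub>v x"
  unfolding rfun_def by (simp add: hfun_mult_vec)

lemma rfun_id: "rfun (\<lambda>t. t) = X"
  unfolding rfun_def using hfun_id hfun_cong[of "\<lambda>z. complex_of_real (Re z)" "\<lambda>z. z"] eigs_real by metis

lemma rfun_one_vec: "x \<in> carrier_vec n \<Longrightarrow> rfun (\<lambda>_. 1) *\<^sub>v x = x"
  unfolding rfun_def by (simp add: hfun_const_vec)

lemma rfun_adjoint:
  "x \<in> carrier_vec n \<Longrightarrow> y \<in> carrier_vec n \<Longrightarrow> (rfun g *\<^sub>v x) \<bullet>c y = x \<bullet>c (rfun g *\<^sub>v y)"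
  unfolding rfun_def by (simp add: hfun_adjoint)

lemma rfun_qform:
  "x \<in> carrier_vec n \<Longrightarrow> qform (rfun g) x = complex_of_real (\<Sum>\<mu>\<in>eigs X. g (Re \<mu>) * sweight x \<mu>)"
  unfolding rfun_def by (simp add: hfun_qform)

lemma rfun_hermitian [simp]: "hermitian_mat (rfun g)"
  by (subst hermitian_iff[OF rfun_carrier]) (simp add: rfun_qform)

lemma rfun_norm:
  assumes x: "x \<in> carrier_vec n"
  shows "(rfun g *\<^sub>v x) \<bullet>c (rfun g *\<^sub>v x) = qform (rfun (\<lambda>t. (g t)\<^sup>2)) x"
  using x rfun_adjoint[of "rfun g *\<^sub>v x" x g] rfun_mult_vec[OF x, of g g]
  by (simp add: qform_def power2_eq_square)

lemma rfun_mono: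
  assumes "x \<in> carrier_vec n" "\<And>\<mu>. \<mu> \<in> eigs X \<Longrightarrow> g (Re \<mu>) \<le> h (Re \<mu>)"
  shows "Re (qform (rfun g) x) \<le> Re (qform (rfun h) x)"
  using assms sweight_norm(2) by (auto simp: rfun_qform intro!: sum_mono mult_right_mono)

lemma norm_sweight: "x \<in> carrier_vec n \<Longrightarrow> Re (x \<bullet>c x) = (\<Sum>\<mu>\<in>eigs X. sweight x \<mu>)"
  using rfun_qform[of x "\<lambda>_. 1"] rfun_one_vec[of x] by (simp add: qform_def)

lemma rfun_linear_qform:
  assumes x: "x \<in> carrier_vec n"
  shows "Re (qform (rfun (\<lambda>t. a * g t + b * h t)) x) = a * Re (qform (rfun g) x) + b * Re (qform (rfun h) x)"
  using x by (simp add: rfun_qform sum.distrib sum_distrib_left algebra_simps)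

lemma matfun_eq_rfun:
  assumes "spec_in n X S" "f holomorphic_on S" "\<And>\<mu>. \<mu> \<in> eigs X \<Longrightarrow> f (complex_of_real (Re \<mu>)) = complex_of_real (g (Re \<mu>))"
  shows "matfun f X = rfun g"
  unfolding matfun_eq_hfun[OF assms(1,2)] rfun_def using assms(3) eigs_real by (intro hfun_cong) metis

lemma eigs_bounds:
  assumes "\<mu> \<in> eigs X"
  shows "(\<And>x. x \<in> carrier_vec n \<Longrightarrow> Re (qform X x) \<le> b * Re (x \<bullet>c x)) \<Longrightarrow> Re \<mu> \<le> b"
    "(\<And>x. x \<in> carrier_vec n \<Longrightarrow> a * Re (x \<bullet>c x) \<le> Re (qform X x)) \<Longrightarrow> a \<le> Re \<mu>"
    "(\<And>x. x \<in> carrier_vec n \<Longrightarrow> x \<noteq> 0\<^sub>v n \<Longrightarrow> Re (qform X x) > 0) \<Longrightarrow> 0 < Re \<mu>"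
proof -
  from assms obtain v where v: "v \<in> carrier_vec n" "v \<noteq> 0\<^sub>v n" "X *\<^sub>v v = \<mu> \<cdot>\<^sub>v v" by (rule eigs_eigenvector[OF carr])
  have "qform X v = \<mu> * (v \<bullet>c v)" using v by (simp add: qform_def cip_smult_left[where n=n])
  moreover have "Im (v \<bullet>c v) = 0" and pos: "Re (v \<bullet>c v) > 0"
    using cip_self[OF v(1)] v(2) by (auto simp: order.order_iff_strict)
  ultimately have q: "Re (qform X v) = Re \<mu> * Re (v \<bullet>c v)" by simp
  show "Re \<mu> \<le> b" if "\<And>x. x \<in> carrier_vec n \<Longrightarrow> Re (qform X x) \<le> b * Re (x \<bullet>c x)"
    using that[OF v(1)] pos unfolding q by simp
  show "a \<le> Re \<mu>" if "\<And>x. x \<in> carrier_vec n \<Longrightarrow> a * Re (x \<bullet>c x) \<le> Re (qform X x)"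
    using that[OF v(1)] pos unfolding q by simp
  show "0 < Re \<mu>" if "\<And>x. x \<in> carrier_vec n \<Longrightarrow> x \<noteq> 0\<^sub>v n \<Longrightarrow> Re (qform X x) > 0"
    using that[OF v(1,2)] pos unfolding q by (simp add: zero_less_mult_iff)
qed

end

lemma mat_poly_pcompose:
  assumes X: "X \<in> carrier_mat n n"
  shows "mat_poly p (mat_poly q X) = mat_poly (pcompose p q) X"
proof (rule mat_eqI_vec[where n=n])
  fix x :: "complex vec" assume x: "x \<in> carrier_vec n"
  show "mat_poly p (mat_poly q X) *\<^sub>v x = mat_poly (pcompose p q) X *\<^sub>v x"
  proof (induction p)
    case 0
    show ?case by (simp only: pcompose_0 mat_poly_vec_0[OF X x] mat_poly_vec_0[OF mat_poly_carrier[OF X] x])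
  next
    case (pCons a p)
    then show ?case
      by (simp only: pcompose_pCons mat_poly_vec_add[OF X x] mat_poly_vec_mult[OF X x] mat_poly_const_vec[OF X x]
          mat_poly_vec_pCons[OF mat_poly_carrier[OF X] x])
  qed
qed (use X in auto)

text \<open>Composition of functional calculi; it allows the p-th power to be written as the power
  p/2 of the square in the Loewner-Heinz step.\<close>

lemma rfun_rfun:
  assumes "herm n X"
  shows "herm n (herm.rfun X g)" "herm.rfun (herm.rfun X g) h = herm.rfun X (\<lambda>t. h (g t))"
proof -
  interpret X: herm n X by fact
  show "herm n (X.rfun g)" by unfold_locales auto
  then interpret Y: herm n "X.rfun g" .
  \<comment> \<open>Interpolating h on the union of the spectrum of g(X) and the g-image of the
    spectrum of X yields a single polynomial that is valid on both sides.\<close>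
  define A where "A = eigs (X.rfun g) \<union> (\<lambda>\<mu>. complex_of_real (g (Re \<mu>))) ` eigs X"
  have "finite A" unfolding A_def using finite_eigs[OF X.carr] finite_eigs[OF Y.carr] by auto
  then obtain p where p: "\<forall>a\<in>A. poly p a = complex_of_real (h (Re a))"
    using poly_interpolation_exists[of A "\<lambda>a. complex_of_real (h (Re a))"] by auto
  obtain q where q: "\<And>\<mu>. \<mu> \<in> eigs X \<Longrightarrow> poly q \<mu> = complex_of_real (g (Re \<mu>))" "X.rfun g = mat_poly q X"
    unfolding X.rfun_def using X.hfun_rep by metis
  have "Y.rfun h = mat_poly p (X.rfun g)"
    unfolding Y.rfun_def using p by (intro Y.hfun_eq) (auto simp: A_def)
  also have "\<dots> = mat_poly (pcompose p q) X" unfolding q(2) by (rule mat_poly_pcompose[OF X.carr])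
  also have "\<dots> = X.rfun (\<lambda>t. h (g t))"
    unfolding X.rfun_def using p q(1) by (intro X.hfun_eq[symmetric]) (auto simp: A_def poly_pcompose)
  finally show "Y.rfun h = X.rfun (\<lambda>t. h (g t))" .
qed

section \<open>Mixtures of weighted harmonic means\<close>

abbreviation slit :: "complex set" where "slit \<equiv> - \<real>\<^sub>\<le>\<^sub>0"

lemma open_slit: "open slit"
  by (simp add: closed_nonpos_Reals_complex open_Compl)

lemma connected_slit: "connected slit"
proof -
  have "\<real>\<^sub>\<le>\<^sub>0 = complex_of_real ` {..0}" by (auto simp: nonpos_Reals_def)
  then show ?thesis
    using starlike_imp_connected[OF starlike_slotted_complex_plane_left[of 0]] by simp
qed

lemma ball_subset_slit: "ball 1 1 \<subseteq> slit"
proof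
  fix z :: complex assume "z \<in> ball 1 1"
  then have "cmod (1 - z) < 1" by (simp add: dist_norm)
  then have "\<bar>Re (1 - z)\<bar> < 1" using abs_Re_le_cmod[of "1 - z"] by linarith
  then show "z \<in> slit" by (auto simp: complex_nonpos_Reals_iff)
qed

lemma half_plane_subset_slit: "Re z > 0 \<Longrightarrow> z \<in> slit"
  by (auto simp: complex_nonpos_Reals_iff)

text \<open>The representing function of the weighted harmonic mean with weight v on the first
  argument. Divided by z it equals 1 / (1 - v (1 - z)), the generating function of the powers of v
  in the variable 1 - z; this ties means to moments.\<close>

definition hkern :: "real \<Rightarrow> complex \<Rightarrow> complex" where
  "hkern v z = z / (of_real v * z + of_real (1 - v))"

lemma hkern_denominator:
  assumes "z \<in> slit" "0 \<le> v" "v \<le> 1"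
  shows "complex_of_real v * z + complex_of_real (1 - v) \<noteq> 0"
proof
  assume *: "complex_of_real v * z + complex_of_real (1 - v) = 0"
  then have "v \<noteq> 0" by auto
  then have "z = complex_of_real (- (1 - v) / v)"
    using * by (simp add: field_simps add_eq_0_iff2)
  moreover have "- (1 - v) / v \<le> 0" using assms by (simp add: divide_nonpos_nonneg)
  ultimately have "z \<in> \<real>\<^sub>\<le>\<^sub>0" by (simp only: nonpos_Reals_of_real_iff)
  then show False using assms by simp
qed

lemma hkern_holomorphic: "0 \<le> v \<Longrightarrow> v \<le> 1 \<Longrightarrow> hkern v holomorphic_on slit"
  unfolding hkern_def by (intro holomorphic_intros hkern_denominator)

definition hkern_comb :: "(complex \<Rightarrow> complex) \<Rightarrow> bool" where
  "hkern_comb g \<longleftrightarrow> (\<exists>(N::nat) w v. (\<forall>j\<le>N. 0 \<le> w j \<and> 0 \<le> v j \<and> v j \<le> 1) \<and> (\<Sum>j\<le>N. w j) = 1 \<and>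
     g = (\<lambda>z. \<Sum>j\<le>N. complex_of_real (w j) * hkern (v j) z))"

text \<open>Stands in for an integral of \<open>hkern\<close> against a probability measure on
  [0,1]. The measure never appears: inequalities linear in f are checked on the finite combinations
  and passed to the limit.\<close>

definition hkern_limit :: "(complex \<Rightarrow> complex) \<Rightarrow> bool" where
  "hkern_limit f \<longleftrightarrow> (\<exists>g. (\<forall>N. hkern_comb (g N)) \<and>
     (\<forall>K. compact K \<longrightarrow> K \<subseteq> slit \<longrightarrow> uniform_limit K g f sequentially))"

lemma hkern_comb_holomorphic: "hkern_comb g \<Longrightarrow> g holomorphic_on slit"
  unfolding hkern_comb_def by (auto intro!: holomorphic_intros hkern_holomorphic)

text \<open>The denominators are continuous and nonzero on the compact set K times [0,1], hence
  bounded away from 0, and convex combinations keep the bound. This is the normality hypothesis of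
  Montel's theorem.\<close>

lemma hkern_comb_bounded:
  assumes K: "compact K" "K \<subseteq> slit"
  shows "\<exists>B. \<forall>h\<in>{g. hkern_comb g}. \<forall>z\<in>K. cmod (h z) \<le> B"
proof (cases "K = {}")
  case False
  define F where "F = (\<lambda>(z, v). cmod (complex_of_real v * z + complex_of_real (1 - v)))"
  have "compact (K \<times> {0..1::real})" using K by (intro compact_Times) auto
  moreover have "K \<times> {0..1::real} \<noteq> {}" using False by auto
  moreover have "continuous_on (K \<times> {0..1::real}) F"
    unfolding F_def case_prod_unfold by (intro continuous_intros)
  ultimately obtain p where p: "p \<in> K \<times> {0..1}" "\<And>q. q \<in> K \<times> {0..1} \<Longrightarrow> F p \<le> F q"
    using continuous_attains_inf by metis
  have Fp: "F p > 0" using p(1) K(2) hkern_denominator unfolding F_def by auto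
  obtain M where M: "\<And>z. z \<in> K \<Longrightarrow> cmod z \<le> M" using compact_imp_bounded[OF K(1)] unfolding bounded_iff by auto
  have M0: "M \<ge> 0" using M False by (meson all_not_in_conv norm_ge_zero order_trans)
  have kb: "cmod (hkern v z) \<le> M / F p" if "z \<in> K" "0 \<le> v" "v \<le> 1" for z v
    unfolding hkern_def norm_divide
    using M[OF that(1)] M0 Fp p(2)[of "(z,v)"] that by (intro frac_le) (auto simp: F_def)
  have "cmod (h z) \<le> M / F p" if "hkern_comb h" "z \<in> K" for h z
  proof -
    from that(1) obtain N and w v :: "nat \<Rightarrow> real" where h: "\<forall>j\<le>N. 0 \<le> w j \<and> 0 \<le> v j \<and> v j \<le> 1" "(\<Sum>j\<le>N. w j) = 1"
      "h = (\<lambda>z. \<Sum>j\<le>N. complex_of_real (w j) * hkern (v j) z)" unfolding hkern_comb_def by auto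
    have "cmod (h z) \<le> (\<Sum>j\<le>N. w j * (M / F p))"
      unfolding h(3)
    proof (rule sum_norm_le)
      fix j assume "j \<in> {..N}"
      then have "0 \<le> w j" "cmod (hkern (v j) z) \<le> M / F p" using h(1) kb[OF that(2)] by auto
      then show "cmod (complex_of_real (w j) * hkern (v j) z) \<le> w j * (M / F p)"
        by (simp only: norm_mult norm_of_real abs_of_nonneg mult_left_mono)
    qed
    also have "\<dots> = M / F p" using h(2) by (simp only: sum_distrib_right[symmetric] mult_1)
    finally show ?thesis .
  qed
  then show ?thesis by auto
qed auto

section \<open>The Hausdorff moment problem and Bernstein approximants\<close>

text \<open>\<open>D i j\<close> plays the integral of v^i (1-v)^j; \<open>rec\<close> is the
  identity obtained from 1 - v by linearity.\<close>

locale hausdorff =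
  fixes D :: "nat \<Rightarrow> nat \<Rightarrow> real"
  assumes nonneg: "0 \<le> D i j" and rec: "D i (Suc j) = D i j - D (Suc i) j" and unit: "D 0 0 = 1"
begin

lemma sum_choose_Suc:
  fixes F :: "nat \<Rightarrow> real"
  shows "(\<Sum>i\<le>Suc m. real (Suc m choose i) * F i) =
    (\<Sum>i\<le>m. real (m choose i) * F i) + (\<Sum>i\<le>m. real (m choose i) * F (Suc i))"
proof -
  have "(\<Sum>i\<le>Suc m. real (Suc m choose i) * F i)
    = F 0 + (\<Sum>i\<le>m. real (m choose i) * F (Suc i) + real (m choose Suc i) * F (Suc i))"
    by (subst sum.atMost_Suc_shift) (simp add: algebra_simps)
  also have "F 0 + (\<Sum>i\<le>m. real (m choose i) * F (Suc i) + real (m choose Suc i) * F (Suc i))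
     = (F 0 + (\<Sum>i\<le>m. real (m choose Suc i) * F (Suc i))) + (\<Sum>i\<le>m. real (m choose i) * F (Suc i))"
    by (simp add: sum.distrib)
  also have "F 0 + (\<Sum>i\<le>m. real (m choose Suc i) * F (Suc i)) = (\<Sum>i\<le>Suc m. real (m choose i) * F i)"
    by (subst sum.atMost_Suc_shift) simp
  finally show ?thesis by simp
qed

lemma binomial_sum: "(\<Sum>i\<le>m. real (m choose i) * D (a + i) (b + (m - i))) = D a b"
proof (induction m arbitrary: a b)
  case (Suc m)
  have "(\<Sum>i\<le>Suc m. real (Suc m choose i) * D (a + i) (b + (Suc m - i)))
    = (\<Sum>i\<le>m. real (m choose i) * D (a + i) (Suc b + (m - i)))
    + (\<Sum>i\<le>m. real (m choose i) * D (Suc a + i) (b + (m - i)))"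
    unfolding sum_choose_Suc by (intro arg_cong2[where f="(+)"] sum.cong) (auto simp: Suc_diff_le)
  then show ?case unfolding Suc.IH using rec[of a b] by simp
qed simp

text \<open>The ratio of binomials is the sampling-without-replacement version of the power (j/N)^n.
  With it in place of the power the Bernstein weights reproduce the n-th moment exactly.\<close>

lemma bernstein_moment:
  assumes "n \<le> N"
  shows "(\<Sum>j\<le>N. real (N choose j) * D j (N - j) * (real (j choose n) / real (N choose n))) = D n 0"
proof -
  have pos: "real (N choose n) > 0" using assms by simp
  have "(\<Sum>j\<le>N. real (N choose j) * D j (N - j) * (real (j choose n) / real (N choose n)))
    = (\<Sum>j\<in>{n..N}. real (N choose j) * D j (N - j) * (real (j choose n) / real (N choose n)))"
    by (rule sum.mono_neutral_right) auto
  also have "\<dots> = (\<Sum>j\<in>{n..N}. real (N - n choose (j - n)) * D j (N - j))"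
  proof (rule sum.cong)
    fix j assume j: "j \<in> {n..N}"
    have "(N choose j) * (j choose n) = (N choose n) * (N - n choose (j - n))"
      using j by (intro choose_mult) auto
    then have "real (N choose j) * real (j choose n) = real (N choose n) * real (N - n choose (j - n))"
      by (metis of_nat_mult)
    then show "real (N choose j) * D j (N - j) * (real (j choose n) / real (N choose n)) = real (N - n choose (j - n)) * D j (N - j)"
      using pos by (simp add: field_simps)
  qed simp
  also have "\<dots> = (\<Sum>i\<le>N - n. real (N - n choose i) * D (n + i) (0 + (N - n - i)))"
    using assms by (intro sum.reindex_bij_witness[of _ "\<lambda>i. n + i" "\<lambda>j. j - n"]) auto
  also have "\<dots> = D n 0" by (rule binomial_sum)
  finally show ?thesis .
qed

text \<open>Sampling with and without replacement differ by O(n^2 / N): each of the n factors j/N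
  and (j-i)/(N-i) differs by at most i/(N-i) unless the ratio has already become 0.\<close>

lemma choose_ratio_close:
  assumes "n < N" "j \<le> N"
  shows "\<bar>(real j / real N) ^ n - real (j choose n) / real (N choose n)\<bar> \<le> real (n * n) / real (N - n)"
  using assms
proof (induction n)
  case (Suc n)
  let ?q = "\<lambda>n. real (j choose n) / real (N choose n)" and ?t = "real j / real N"
  have t: "0 \<le> ?t" "?t \<le> 1" using Suc.prems by auto
  have q: "0 \<le> ?q n" "?q n \<le> 1"
    using Suc.prems by (auto simp: binomial_right_mono)
  have N: "real (N - n) > 0" "real (N - Suc n) > 0" "real (N - n) = real N - real n" using Suc.prems by auto
  have ch: "real (Suc n) * real (k choose Suc n) = real (k choose n) * (real k - real n)" for k
  proof (cases "n \<le> k")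
    case True
    have "Suc n * (k choose Suc n) = (k - n) * (k choose n)"
      by (metis binomial_absorb_comp binomial_absorption)
    then have "real (Suc n) * real (k choose Suc n) = real (k - n) * real (k choose n)"
      by (metis of_nat_mult)
    then show ?thesis using True by (simp add: of_nat_diff)
  qed (simp add: binomial_eq_0)
  have eqq: "?q (Suc n) = ?q n * ((real j - real n) / (real N - real n))"
  proof -
    have "?q (Suc n) = (real (Suc n) * real (j choose Suc n)) / (real (Suc n) * real (N choose Suc n))"
      by simp
    then show ?thesis unfolding ch by simp
  qed
  have cl: "?q n * \<bar>?t - (real j - real n) / (real N - real n)\<bar> \<le> real n / real (N - n)"
  proof (cases "j < n")
    case False
    have "?t - (real j - real n) / (real N - real n) = (real n / (real N - real n)) * ((real N - real j) / real N)"
      using N Suc.prems by (simp add: field_simps)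
    moreover have "0 \<le> (real N - real j) / real N" "(real N - real j) / real N \<le> 1" using Suc.prems by auto
    moreover have "0 \<le> real n / (real N - real n)" using N by simp
    ultimately have "\<bar>?t - (real j - real n) / (real N - real n)\<bar> \<le> real n / (real N - real n)"
      by (simp only: abs_mult abs_of_nonneg mult_left_le)
    then have "?q n * \<bar>?t - (real j - real n) / (real N - real n)\<bar> \<le> 1 * (real n / (real N - real n))"
      using q by (intro mult_mono) auto
    then show ?thesis using N by simp
  next
    case True
    then show ?thesis using N by (simp add: binomial_eq_0)
  qed
  have "?t ^ Suc n - ?q (Suc n) = (?t ^ n - ?q n) * ?t + ?q n * (?t - (real j - real n) / (real N - real n))"
    unfolding eqq by (simp add: algebra_simps)
  then have "\<bar>?t ^ Suc n - ?q (Suc n)\<bar> \<le> \<bar>(?t ^ n - ?q n) * ?t\<bar> + \<bar>?q n * (?t - (real j - real n) / (real N - real n))\<bar>"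
    by (metis abs_triangle_ineq)
  also have "\<bar>(?t ^ n - ?q n) * ?t\<bar> \<le> \<bar>?t ^ n - ?q n\<bar>" using t by (simp only: abs_mult abs_of_nonneg mult_left_le abs_ge_zero)
  also have "\<dots> \<le> real (n * n) / real (N - n)" using Suc by auto
  also have "\<bar>?q n * (?t - (real j - real n) / (real N - real n))\<bar> \<le> real n / real (N - n)"
    using cl q by (simp only: abs_mult abs_of_nonneg)
  finally have "\<bar>?t ^ Suc n - ?q (Suc n)\<bar> \<le> real (n * n + n) / real (N - n)" by (simp add: add_divide_distrib)
  also have "\<dots> \<le> real (Suc n * Suc n) / real (N - Suc n)" using N by (intro frac_le) auto
  finally show ?case .
qed simp

definition bw :: "nat \<Rightarrow> nat \<Rightarrow> real" where "bw N j = real (N choose j) * D j (N - j)"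

lemma bw_nonneg: "bw N j \<ge> 0" unfolding bw_def using nonneg by simp

lemma bw_sum: "(\<Sum>j\<le>N. bw N j) = 1"
  using binomial_sum[of N 0 0] unit by (simp add: bw_def)

lemma moment_tendsto: "(\<lambda>N. \<Sum>j\<le>N. bw N j * (real j / real N) ^ n) \<longlonglongrightarrow> D n 0"
proof -
  have "(\<lambda>N. (\<Sum>j\<le>N. bw N j * (real j / real N) ^ n) - D n 0) \<longlonglongrightarrow> 0"
  proof (rule Lim_null_comparison)
    show "\<forall>\<^sub>F N in sequentially. norm ((\<Sum>j\<le>N. bw N j * (real j / real N) ^ n) - D n 0) \<le> real (n * n) / real (N - n)"
      using eventually_gt_at_top[of n]
    proof eventually_elim
      case (elim N)
      have "(\<Sum>j\<le>N. bw N j * (real j / real N) ^ n) - D n 0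
        = (\<Sum>j\<le>N. bw N j * ((real j / real N) ^ n - real (j choose n) / real (N choose n)))"
        using bernstein_moment[of n N] elim by (simp add: bw_def right_diff_distrib sum_subtractf)
      also have "norm \<dots> \<le> (\<Sum>j\<le>N. bw N j * (real (n * n) / real (N - n)))"
      proof (rule sum_norm_le)
        fix j assume "j \<in> {..N}"
        then show "norm (bw N j * ((real j / real N) ^ n - real (j choose n) / real (N choose n)))
            \<le> bw N j * (real (n * n) / real (N - n))"
          using choose_ratio_close[OF elim, of j] bw_nonneg[of N j]
          by (simp only: real_norm_def abs_mult abs_of_nonneg mult_left_mono atMost_iff)
      qed
      also have "\<dots> = real (n * n) / real (N - n)" using bw_sum by (simp only: sum_distrib_right[symmetric] mult_1)
      finally show ?case .
    qed
    \<comment> \<open>Shifting the index by n removes the truncated subtraction N - n.\<close>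
    have "(\<lambda>N. real (n * n) / real (N + n - n)) \<longlonglongrightarrow> 0" by (simp add: lim_const_over_n del: of_nat_mult)
    then show "(\<lambda>N. real (n * n) / real (N - n)) \<longlonglongrightarrow> 0" by (rule LIMSEQ_offset)
  qed
  then show ?thesis by (rule LIM_zero_cancel)
qed

definition bg :: "nat \<Rightarrow> complex \<Rightarrow> complex" where
  "bg N z = (\<Sum>j\<le>N. complex_of_real (bw N j) * hkern (real j / real N) z)"

lemma bg_comb: "hkern_comb (bg N)"
  unfolding hkern_comb_def
proof (intro exI conjI)
  show "\<forall>j\<le>N. 0 \<le> bw N j \<and> 0 \<le> real j / real N \<and> real j / real N \<le> 1"
    using bw_nonneg by (auto simp: divide_le_eq)
qed (auto simp: bw_sum bg_def)

text \<open>Each kernel is expanded as a geometric series in 1 - z. The coefficients of the combined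
  series are approximate moments of modulus at most 1, so Tannery's theorem with majorant |1-z|^n
  interchanges limit and sum.\<close>

lemma bg_tendsto:
  assumes z: "z \<in> ball 1 1" and s: "(\<lambda>n. complex_of_real (D n 0) * (1 - z) ^ n) sums (f z / z)"
  shows "(\<lambda>N. bg N z) \<longlonglongrightarrow> f z"
proof -
  have nz: "cmod (1 - z) < 1" using z by (simp add: dist_norm)
  have z0: "z \<noteq> 0" using ball_subset_slit z by auto
  have hk: "1 / (1 - complex_of_real v * (1 - z)) = hkern v z / z" for v
  proof -
    have "1 - complex_of_real v * (1 - z) = complex_of_real v * z + complex_of_real (1 - v)"
      by (simp add: algebra_simps)
    then show ?thesis using z0 by (simp add: hkern_def)
  qed
  define a where "a = (\<lambda>n N. complex_of_real (\<Sum>j\<le>N. bw N j * (real j / real N) ^ n) * (1 - z) ^ n)"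
  have sums: "(\<lambda>n. a n N) sums (bg N z / z)" for N
  proof -
    have "(\<lambda>n. complex_of_real (bw N j) * (complex_of_real (real j / real N) * (1 - z)) ^ n) sums
        (complex_of_real (bw N j) * (hkern (real j / real N) z / z))" if j: "j \<le> N" for j
    proof (rule sums_mult)
      let ?v = "real j / real N"
      have v: "0 \<le> ?v" "?v \<le> 1" using j by (auto simp: divide_le_eq)
      have "cmod (complex_of_real ?v * (1 - z)) \<le> cmod (1 - z)"
        unfolding norm_mult norm_of_real using v by (intro mult_left_le_one_le) auto
      then have "cmod (complex_of_real ?v * (1 - z)) < 1" using nz by linarith
      then have "(\<lambda>n. (complex_of_real ?v * (1 - z)) ^ n) sums (1 / (1 - complex_of_real ?v * (1 - z)))"
        by (rule geometric_sums)
      moreover have "1 / (1 - complex_of_real ?v * (1 - z)) = hkern ?v z / z"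
        by (rule hk)
      ultimately show "(\<lambda>n. (complex_of_real ?v * (1 - z)) ^ n) sums (hkern ?v z / z)" by simp
    qed
    then have "(\<lambda>n. \<Sum>j\<le>N. complex_of_real (bw N j) * (complex_of_real (real j / real N) * (1 - z)) ^ n) sums
        (\<Sum>j\<le>N. complex_of_real (bw N j) * (hkern (real j / real N) z / z))"
      by (intro sums_sum) auto
    moreover have "(\<Sum>j\<le>N. complex_of_real (bw N j) * (complex_of_real (real j / real N) * (1 - z)) ^ n) = a n N" for n
      unfolding a_def
      by (simp only: power_mult_distrib of_real_sum of_real_mult of_real_power sum_distrib_right mult.assoc)
    ultimately show ?thesis by (simp add: bg_def sum_divide_distrib)
  qed
  have bound: "cmod (a n N) \<le> cmod (1 - z) ^ n" for n N
  proof -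
    have "\<bar>\<Sum>j\<le>N. bw N j * (real j / real N) ^ n\<bar> \<le> (\<Sum>j\<le>N. bw N j * 1)"
    proof (rule order_trans[OF sum_abs], rule sum_mono)
      fix j assume "j \<in> {..N}"
      then have "0 \<le> real j / real N" "real j / real N \<le> 1" by (auto simp: divide_le_eq)
      then show "\<bar>bw N j * (real j / real N) ^ n\<bar> \<le> bw N j * 1"
        using bw_nonneg by (simp only: abs_mult abs_of_nonneg zero_le_power mult_left_mono power_le_one)
    qed
    also have "\<dots> = 1" using bw_sum by simp
    finally show ?thesis unfolding a_def norm_mult norm_power norm_of_real
      by (intro mult_left_le_one_le) auto
  qed
  have "(\<lambda>N. \<Sum>n. a n N) \<longlonglongrightarrow> (\<Sum>n. complex_of_real (D n 0) * (1 - z) ^ n)"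
  proof (rule tannerys_theorem[THEN conjunct2, THEN conjunct2])
    show "(\<lambda>N. a n N) \<longlonglongrightarrow> complex_of_real (D n 0) * (1 - z) ^ n" for n
      unfolding a_def by (intro tendsto_mult tendsto_const tendsto_of_real moment_tendsto)
    show "summable (\<lambda>n. cmod (1 - z) ^ n)" using nz by (intro summable_geometric) simp
    show "\<forall>\<^sub>F (n, N) in sequentially \<times>\<^sub>F sequentially. cmod (a n N) \<le> cmod (1 - z) ^ n"
      by (rule always_eventually) (use bound in auto)
  qed auto
  then have "(\<lambda>N. bg N z / z) \<longlonglongrightarrow> f z / z"
    using sums s by (simp add: sums_iff)
  then have "(\<lambda>N. bg N z / z * z) \<longlonglongrightarrow> f z / z * z" by (rule tendsto_mult_right)
  then show ?thesis using z0 by simp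
qed

text \<open>The power series is available only on the disc. Normality produces a limit on the whole
  slit plane along a subsequence, and the identity theorem identifies it with f;
  \<open>hkern_limit\<close> asks for some sequence, so the subsequence qualifies.\<close>

theorem hkern_limit_hausdorff:
  assumes f: "f holomorphic_on slit"
    and s: "\<And>z. z \<in> ball 1 1 \<Longrightarrow> (\<lambda>n. complex_of_real (D n 0) * (1 - z) ^ n) sums (f z / z)"
  shows "hkern_limit f"
proof -
  obtain h r where h: "h holomorphic_on slit" and r: "strict_mono r"
    and pw: "\<And>x. x \<in> slit \<Longrightarrow> (\<lambda>n. bg (r n) x) \<longlonglongrightarrow> h x"
    and ul: "\<And>K. compact K \<Longrightarrow> K \<subseteq> slit \<Longrightarrow> uniform_limit K (bg \<circ> r) h sequentially"
  proof (rule Montel[OF open_slit, of "{g. hkern_comb g}" bg])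
    show "\<exists>B. \<forall>h\<in>{g. hkern_comb g}. \<forall>z\<in>K. cmod (h z) \<le> B" if "compact K" "K \<subseteq> slit" for K
      using hkern_comb_bounded[OF that] .
  qed (use hkern_comb_holomorphic bg_comb in auto)
  have ball: "h z = f z" if z: "z \<in> ball 1 1" for z
  proof -
    have "(\<lambda>n. bg (r n) z) \<longlonglongrightarrow> f z"
      using LIMSEQ_subseq_LIMSEQ[OF bg_tendsto[of z f, OF z s[OF z]] r] by (simp add: o_def)
    then show ?thesis using pw[of z] z ball_subset_slit LIMSEQ_unique by blast
  qed
  have eq: "h w = f w" if "w \<in> slit" for w
  proof -
    have "h w - f w = 0"
    proof (rule analytic_continuation[of "\<lambda>z. h z - f z" slit "ball 1 1" 1 w])
      show "(\<lambda>z. h z - f z) holomorphic_on slit" using h f by (intro holomorphic_intros)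
      show "(1::complex) islimpt ball 1 1" by (intro interior_limit_point) auto
    qed (use open_slit connected_slit ball_subset_slit ball that in auto)
    then show ?thesis by simp
  qed
  show ?thesis unfolding hkern_limit_def
  proof (intro exI conjI allI impI)
    show "hkern_comb ((bg \<circ> r) N)" for N using bg_comb by simp
    show "uniform_limit K (bg \<circ> r) f sequentially" if "compact K" "K \<subseteq> slit" for K
      using ul[OF that] by (rule uniform_limit_cong'[THEN iffD1, rotated 2]) (use eq that in auto)
  qed
qed

end

section \<open>Functionals on polynomials that are nonnegative on squares\<close>

locale moment_functional =
  fixes L :: "real poly \<Rightarrow> real"
  assumes add: "L (p + q) = L p + L q" and smult: "L (Polynomial.smult c p) = c * L p"
    and psd: "0 \<le> L (q * q)"
begin

lemma zero: "L 0 = 0" using smult[of 0 0] by simp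

lemma diff: "L (p - q) = L p - L q"
  using add[of p "Polynomial.smult (-1) q"] smult[of "-1" q] by simp

lemma sum: "L (\<Sum>i\<in>I. g i) = (\<Sum>i\<in>I. L (g i))"
  by (induction I rule: infinite_finite_induct) (simp_all add: zero add)

lemma monom_mult: "L (monom 1 m * r) = (\<Sum>i\<le>degree r. coeff r i * L (monom 1 (m + i)))"
proof -
  have "monom 1 m * r = monom 1 m * (\<Sum>i\<le>degree r. monom (coeff r i) i)"
    by (simp only: poly_as_sum_of_monoms)
  also have "\<dots> = (\<Sum>i\<le>degree r. Polynomial.smult (coeff r i) (monom 1 (m + i)))"
    by (simp add: sum_distrib_left mult_monom smult_monom)
  finally show ?thesis by (simp add: sum smult)
qed

lemma cauchy_schwarz: "(L (p * q))\<^sup>2 \<le> L (p * p) * L (q * q)"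
proof -
  have q: "0 \<le> L (p * p) + 2 * t * L (p * q) + t\<^sup>2 * L (q * q)" for t
  proof -
    have "(p + Polynomial.smult t q) * (p + Polynomial.smult t q)
      = p * p + (Polynomial.smult t (p * q) + Polynomial.smult t (q * p)) + Polynomial.smult (t * t) (q * q)"
      by (simp add: distrib_left distrib_right smult_add_right)
    then have "0 \<le> L (p * p) + (t * L (p * q) + t * L (q * p)) + t * t * L (q * q)"
      using psd[of "p + Polynomial.smult t q"] by (simp only: add smult)
    then show ?thesis unfolding mult.commute[of q p] power2_eq_square by linarith
  qed
  show ?thesis
  proof (cases "L (q * q) = 0")
    case True
    have "L (p * q) = 0"
    proof (rule ccontr)
      assume n: "L (p * q) \<noteq> 0"
      \<comment> \<open>For this value of the parameter the expression, which is affine when L (q q)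
        = 0, takes the value -1.\<close>
      show False using q[of "- (L (p * p) + 1) / (2 * L (p * q))"] n True by (simp add: field_simps)
    qed
    then show ?thesis using True by simp
  next
    case False
    then have pos: "L (q * q) > 0" using psd[of q] by simp
    have "0 \<le> L (p * p) - (L (p * q))\<^sup>2 / L (q * q)"
      using q[of "- L (p * q) / L (q * q)"] pos by (simp add: power2_eq_square field_simps)
    then show ?thesis using pos by (simp add: field_simps)
  qed
qed

text \<open>Put s_j = L (v^(2j) q^2). Cauchy-Schwarz gives s_j^2 \<le> s_0 s_(2j), so t = s_1 / s_0
  satisfies t^(2^k) \<le> s_(2^k) / s_0. If t > 1, this outgrows the permitted bound C R^n with R
  close to 1. Hence s_1 \<le> s_0, which is the claim.\<close>

lemma growth_bound:
  assumes growth: "\<And>R. R > 1 \<Longrightarrow> \<exists>C. \<forall>n. \<bar>L (monom 1 n)\<bar> \<le> C * R ^ n"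
  shows "0 \<le> L ((1 - [:0, 1:] * [:0, 1:]) * (q * q))"
proof -
  define s where "s = (\<lambda>j. L (monom 1 (2 * j) * (q * q)))"
  have nn: "0 \<le> s j" for j
  proof -
    have "monom 1 (2 * j) * (q * q) = (monom 1 j * q) * (monom 1 j * q)"
      by (simp add: mult_monom ac_simps flip: mult_2 mult.assoc)
    then show ?thesis unfolding s_def using psd by metis
  qed
  have cs: "(s j)\<^sup>2 \<le> s 0 * s (2 * j)" for j
  proof -
    have "s j = L (q * (monom 1 (2 * j) * q))" unfolding s_def by (simp add: ac_simps)
    moreover have "s (2 * j) = L ((monom 1 (2 * j) * q) * (monom 1 (2 * j) * q))"
      unfolding s_def by (simp add: mult_monom ac_simps flip: mult.assoc mult_2)
    moreover have "s 0 = L (q * q)" unfolding s_def by (simp add: monom_0 flip: one_pCons)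
    ultimately show ?thesis using cauchy_schwarz by simp
  qed
  have "s 1 \<le> s 0"
  proof (cases "s 0 = 0")
    case True
    then show ?thesis using cs[of 1] by simp
  next
    case False
    then have s0: "s 0 > 0" using nn[of 0] by simp
    define t where "t = s 1 / s 0"
    have t0: "t \<ge> 0" unfolding t_def using nn s0 by simp
    have tk: "t ^ (2 ^ k) \<le> s (2 ^ k) / s 0" for k
    proof (induction k)
      case (Suc k)
      have "t ^ (2 ^ Suc k) = (t ^ 2 ^ k)\<^sup>2" by (simp add: power_mult[symmetric] mult.commute)
      also have "\<dots> \<le> (s (2 ^ k) / s 0)\<^sup>2" using Suc t0 by (intro power_mono) auto
      also have "\<dots> \<le> (s 0 * s (2 * 2 ^ k)) / (s 0)\<^sup>2"
        unfolding power_divide using cs s0 by (intro divide_right_mono) auto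
      also have "\<dots> = s (2 ^ Suc k) / s 0" using s0 by (simp add: power2_eq_square)
      finally show ?case .
    qed (simp add: t_def)
    have "t \<le> 1"
    proof (rule ccontr)
      assume "\<not> t \<le> 1"
      \<comment> \<open>The square of R is the midpoint of 1 and t, so t / R^2 still exceeds
        1.\<close>
      define R where "R = sqrt ((1 + t) / 2)"
      have R: "R > 1" "R\<^sup>2 = (1 + t) / 2" unfolding R_def using \<open>\<not> t \<le> 1\<close> by auto
      obtain C where C: "\<And>n. \<bar>L (monom 1 n)\<bar> \<le> C * R ^ n" using growth[OF R(1)] by auto
      define C' where "C' = (\<Sum>i\<le>degree (q * q). \<bar>coeff (q * q) i\<bar> * (C * R ^ i))"
      have sb: "s j \<le> C' * (R\<^sup>2) ^ j" for j
      proof -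
        have "s j \<le> (\<Sum>i\<le>degree (q * q). \<bar>coeff (q * q) i\<bar> * (C * R ^ (2 * j + i)))"
          unfolding s_def monom_mult
        proof (rule sum_mono)
          fix i
          have "coeff (q * q) i * L (monom 1 (2 * j + i)) \<le> \<bar>coeff (q * q) i\<bar> * \<bar>L (monom 1 (2 * j + i))\<bar>"
            unfolding abs_mult[symmetric] by (rule abs_ge_self)
          also have "\<dots> \<le> \<bar>coeff (q * q) i\<bar> * (C * R ^ (2 * j + i))"
            using C by (intro mult_left_mono) auto
          finally show "coeff (q * q) i * L (monom 1 (2 * j + i)) \<le> \<bar>coeff (q * q) i\<bar> * (C * R ^ (2 * j + i))" .
        qed
        also have "\<dots> = C' * (R\<^sup>2) ^ j"
        proof -
          have "R ^ (2 * j + i) = R ^ i * (R\<^sup>2) ^ j" for i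
            by (subst power_add, subst power_mult, rule mult.commute)
          then show ?thesis unfolding C'_def sum_distrib_right by (simp only: ac_simps)
        qed
        finally show ?thesis .
      qed
      have rho: "1 < t / R\<^sup>2" unfolding R(2) using \<open>\<not> t \<le> 1\<close> by simp
      obtain N where N: "C' / s 0 < (t / R\<^sup>2) ^ N" using real_arch_pow[OF rho] by blast
      also have "(t / R\<^sup>2) ^ N \<le> (t / R\<^sup>2) ^ (2 ^ N)" using rho by (intro power_increasing) auto
      also have "\<dots> \<le> (s (2 ^ N) / s 0) / (R\<^sup>2) ^ (2 ^ N)"
        unfolding power_divide using tk by (intro divide_right_mono) auto
      also have "\<dots> \<le> (C' * (R\<^sup>2) ^ (2 ^ N) / s 0) / (R\<^sup>2) ^ (2 ^ N)"
        using sb s0 by (intro divide_right_mono) auto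
      also have "\<dots> = C' / s 0" using R(1) by simp
      finally show False by simp
    qed
    then show ?thesis unfolding t_def using s0 by simp
  qed
  moreover have "s 1 = L (([:0, 1:] * [:0, 1:]) * (q * q))"
    unfolding s_def by (simp add: monom_altdef numeral_2_eq_2)
  moreover have "s 0 = L (q * q)" unfolding s_def by (simp add: monom_0 flip: one_pCons)
  ultimately have "0 \<le> L (q * q) - L (([:0, 1:] * [:0, 1:]) * (q * q))" by simp
  moreover have "L ((1 - [:0, 1:] * [:0, 1:]) * (q * q)) = L (q * q) - L (([:0, 1:] * [:0, 1:]) * (q * q))"
    by (simp only: left_diff_distrib mult_1 diff)
  ultimately show ?thesis by simp
qed

end

text \<open>Subexponential moments of v place the support in [-1,1], those of 1 - v in [0,2];
  together they leave [0,1].\<close>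

locale hausdorff_functional = moment_functional +
  assumes growth1: "\<And>R. R > 1 \<Longrightarrow> \<exists>C. \<forall>n. \<bar>L ([:0, 1:] ^ n)\<bar> \<le> C * R ^ n"
    and growth2: "\<And>R. R > 1 \<Longrightarrow> \<exists>C. \<forall>n. \<bar>L ([:1, -1:] ^ n)\<bar> \<le> C * R ^ n"
begin

abbreviation "V \<equiv> [:0, 1:] :: real poly"
abbreviation "U \<equiv> [:1, -1:] :: real poly"

text \<open>The substitution of 1 - v for v exchanges \<open>V\<close> and \<open>U\<close>; results
  about v transfer to 1 - v through it.\<close>

lemma reflected: "moment_functional (\<lambda>p. L (pcompose p U))"
  by unfold_locales (simp_all add: pcompose_add pcompose_smult pcompose_mult add smult psd)

lemma square_V: "0 \<le> L ((1 - V * V) * (q * q))"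
  by (rule growth_bound) (use growth1 in \<open>simp add: monom_altdef\<close>)

lemma square_U: "0 \<le> L ((1 - U * U) * (q * q))"
proof -
  interpret R: moment_functional "\<lambda>p. L (pcompose p U)" by (rule reflected)
  have VU: "pcompose V U = U" by (simp add: pcompose_pCons)
  have UU: "pcompose U U = V" by (simp add: pcompose_pCons)
  have mono: "pcompose (monom 1 n) U = U ^ n" for n
  proof -
    have "pcompose (V ^ n) U = U ^ n" by (induction n) (simp_all only: power_0 power_Suc pcompose_1 pcompose_mult VU)
    then show ?thesis by (simp add: monom_altdef)
  qed
  have "0 \<le> L (pcompose ((1 - V * V) * (pcompose q U * pcompose q U)) U)"
    by (rule R.growth_bound) (use growth2 in \<open>simp only: mono\<close>)
  moreover have "pcompose (pcompose q U) U = q"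
    by (simp only: pcompose_assoc[symmetric] UU) (simp add: pcompose_idR)
  ultimately show ?thesis by (simp only: pcompose_mult pcompose_diff pcompose_1 VU)
qed

text \<open>From 2 (1-v) = (1-v)^2 + (1 - v^2): the first term is a square, the second is covered by
  \<open>square_V\<close>. The companion for v swaps the roles.\<close>

lemma pos_U: "0 \<le> L (U * (q * q))"
proof -
  have "Polynomial.smult 2 U = U * U + (1 - V * V)" by (simp add: one_pCons)
  then have "Polynomial.smult 2 (U * (q * q)) = (U * U + (1 - V * V)) * (q * q)"
    by (simp only: mult_smult_left[symmetric])
  also have "\<dots> = (U * q) * (U * q) + (1 - V * V) * (q * q)"
    by (simp only: distrib_right[of "U * U"]) (simp only: ac_simps)
  finally have "2 * L (U * (q * q)) = L ((U * q) * (U * q)) + L ((1 - V * V) * (q * q))"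
    by (metis add smult)
  then show ?thesis using psd[of "U * q"] square_V[of q] by linarith
qed

lemma pos_V: "0 \<le> L (V * (q * q))"
proof -
  have "Polynomial.smult 2 V = V * V + (1 - U * U)" by (simp add: one_pCons)
  then have "Polynomial.smult 2 (V * (q * q)) = (V * V + (1 - U * U)) * (q * q)"
    by (simp only: mult_smult_left[symmetric])
  also have "\<dots> = (V * q) * (V * q) + (1 - U * U) * (q * q)"
    by (simp only: distrib_right[of "V * V"]) (simp only: ac_simps)
  finally have "2 * L (V * (q * q)) = L ((V * q) * (V * q)) + L ((1 - U * U) * (q * q))"
    by (metis add smult)
  then show ?thesis using psd[of "V * q"] square_U[of q] by linarith
qed

text \<open>With u = 1 - v one has u v = v u^2 + u v^2, because u + v = 1; so positivity with weight
  u v follows from the weights v and u.\<close>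

lemma pos_UV: "0 \<le> L (U * V * (q * q))"
proof -
  have "v * ((u * q) * (u * q)) + u * ((v * q) * (v * q)) = (u + v) * (u * v * (q * q))" for v u :: "real poly"
    by (simp add: algebra_simps)
  from this[of V U] have "V * ((U * q) * (U * q)) + U * ((V * q) * (V * q)) = (U + V) * (U * V * (q * q))" .
  moreover have "U + V = 1" by (simp add: one_pCons)
  ultimately have "U * V * (q * q) = V * ((U * q) * (U * q)) + U * ((V * q) * (V * q))"
    by (simp only: mult_1)
  then have "L (U * V * (q * q)) = L (V * ((U * q) * (U * q))) + L (U * ((V * q) * (V * q)))"
    by (metis add)
  then show ?thesis using pos_V[of "U * q"] pos_U[of "V * q"] by simp
qed

text \<open>Even powers are absorbed into a square, leaving one of the four weights 1, v, 1-v,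
  v(1-v) according to the parities of the exponents.\<close>

lemma bernstein_nonneg: "0 \<le> L (V ^ i * U ^ j)"
proof -
  define q where "q = V ^ (i div 2) * U ^ (j div 2)"
  have pw: "w ^ k = w ^ (k mod 2) * (w ^ (k div 2) * w ^ (k div 2))" for w :: "real poly" and k
    by (metis mod_div_mult_eq mult_2_right power_add mult.commute mult_2)
  have eq: "V ^ i * U ^ j = V ^ (i mod 2) * U ^ (j mod 2) * (q * q)"
    unfolding q_def by (subst pw[of V i], subst pw[of U j]) (simp only: ac_simps)
  consider "i mod 2 = 0" "j mod 2 = 0" | "i mod 2 = 1" "j mod 2 = 0" | "i mod 2 = 0" "j mod 2 = 1" | "i mod 2 = 1" "j mod 2 = 1"
    by linarith
  then show ?thesis
  proof cases
    case 1 then show ?thesis unfolding eq using psd[of q] by simp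
  next
    case 2 then show ?thesis unfolding eq using pos_V[of q] by simp
  next
    case 3 then show ?thesis unfolding eq using pos_U[of q] by simp
  next
    case 4 then show ?thesis unfolding eq using pos_UV[of q] by (simp only: power_one_right mult.commute[of V U])
  qed
qed

text \<open>If f(z)/z has moments c_n in powers of y = 1 - z, then 1 - f = sum (c_n - c_(n+1))
  y^(n+1). So the given L is the measure sought multiplied by 1 - v, and its moments c_n are
  recovered by telescoping from c_0 = 1.\<close>

theorem hkern_limit_functional:
  assumes f: "f holomorphic_on slit" and f1: "f 1 = 1"
    and pos: "\<And>t. 0 < t \<Longrightarrow> t < 1 \<Longrightarrow> 0 < Re (f (complex_of_real t))"
    and s: "\<And>z. z \<in> ball 1 1 \<Longrightarrow> (\<lambda>n. complex_of_real (L (V ^ n)) * (1 - z) ^ Suc n) sums (1 - f z)"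
  shows "hkern_limit f"
proof -
  define b where "b = (\<lambda>n. L (V ^ n))"
  have b0: "0 \<le> b n" for n using bernstein_nonneg[of n 0] by (simp add: b_def)
  define c where "c = (\<lambda>n. 1 - (\<Sum>i<n. b i))"
  \<comment> \<open>For 0 < y < 1 the nonnegative series sums to 1 - f(1-y), which is below 1 since
    f is positive; letting y tend to 1 bounds the partial sums. This makes every c_n
    nonnegative.\<close>
  have part: "(\<Sum>i<n. b i) \<le> 1" for n
  proof (rule tendsto_le[of "at_left 1"])
    show "((\<lambda>y. \<Sum>i<n. b i * y ^ Suc i) \<longlongrightarrow> (\<Sum>i<n. b i)) (at_left 1)"
      by (rule tendsto_eq_intros refl | simp)+
    have "\<forall>\<^sub>F y in at_left (1::real). 0 < y" by (rule eventually_at_left_real[of 0 1, THEN eventually_mono]) auto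
    moreover have "\<forall>\<^sub>F y in at_left (1::real). y < 1" by (rule eventually_at_left_real[of 0 1, THEN eventually_mono]) auto
    ultimately show "\<forall>\<^sub>F y in at_left 1. (\<Sum>i<n. b i * y ^ Suc i) \<le> 1"
    proof eventually_elim
      case (elim y)
      have "(\<lambda>n. complex_of_real (b n) * (1 - complex_of_real (1 - y)) ^ Suc n) sums (1 - f (complex_of_real (1 - y)))"
        unfolding b_def using elim by (intro s) (auto simp: dist_norm)
      then have "(\<lambda>n. Re (complex_of_real (b n) * (1 - complex_of_real (1 - y)) ^ Suc n)) sums Re (1 - f (complex_of_real (1 - y)))"
        by (rule sums_Re)
      moreover have "Re (complex_of_real (b n) * (1 - complex_of_real (1 - y)) ^ Suc n) = b n * y ^ Suc n" for n
        by (simp flip: of_real_power of_real_mult del: power_Suc)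
      ultimately have sm: "(\<lambda>n. b n * y ^ Suc n) sums (1 - Re (f (complex_of_real (1 - y))))" by simp
      have "(\<Sum>i<n. b i * y ^ Suc i) \<le> (\<Sum>i. b i * y ^ Suc i)"
        using sm b0 elim by (intro sum_le_suminf) (auto simp: sums_iff)
      also have "\<dots> \<le> 1" using sm pos[of "1 - y"] elim by (simp add: sums_iff)
      finally show ?case .
    qed
  qed auto
  \<comment> \<open>The index shift reflects the factor 1 - v hidden in L. A point mass at v = 1 is
    invisible to L; it survives in c, which fills the column j = 0.\<close>
  define D where "D = (\<lambda>i j. case j of 0 \<Rightarrow> c i | Suc j \<Rightarrow> L (V ^ i * U ^ j))"
  interpret H: hausdorff D
  proof
    show "0 \<le> D i j" for i j unfolding D_def using part bernstein_nonneg by (auto simp: c_def split: nat.split)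
    show "D i (Suc j) = D i j - D (Suc i) j" for i j
    proof (cases j)
      case 0
      then show ?thesis by (simp add: D_def c_def b_def)
    next
      case (Suc k)
      have "U = 1 - V" by (simp add: one_pCons)
      then have "V ^ i * U ^ Suc k = V ^ i * U ^ k - V ^ Suc i * U ^ k" by (simp only: power_Suc left_diff_distrib right_diff_distrib mult_1 ac_simps)
      then have "L (V ^ i * U ^ Suc k) = L (V ^ i * U ^ k) - L (V ^ Suc i * U ^ k)" by (simp only: diff)
      then show ?thesis unfolding D_def Suc by (simp only: nat.case)
    qed
    show "D 0 0 = 1" by (simp add: D_def c_def)
  qed
  show ?thesis
  proof (rule H.hkern_limit_hausdorff[OF f])
    fix z :: complex assume z: "z \<in> ball 1 1"
    define y where "y = 1 - z"
    have y: "cmod y < 1" using z by (simp add: y_def dist_norm)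
    have z0: "z \<noteq> 0" using z ball_subset_slit by auto
    have D0: "D n 0 = c n" for n by (simp add: D_def)
    have "summable (\<lambda>n. complex_of_real (c n) * y ^ n)"
    proof (rule summable_comparison_test')
      show "summable (\<lambda>n. cmod y ^ n)" using y by (intro summable_geometric) simp
      show "norm (complex_of_real (c n) * y ^ n) \<le> cmod y ^ n" if "n \<ge> 0" for n
      proof -
        have "\<bar>c n\<bar> \<le> 1" unfolding c_def using part[of n] b0 by (simp add: sum_nonneg)
        then show ?thesis by (simp add: norm_mult norm_power mult_left_le_one_le)
      qed
    qed
    then obtain S where S: "(\<lambda>n. complex_of_real (c n) * y ^ n) sums S" by (auto simp: summable_def)
    have 1: "(\<lambda>n. complex_of_real (c (Suc n)) * y ^ Suc n) sums (S - 1)"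
      using S by (subst sums_Suc_iff) (simp add: c_def)
    have 2: "(\<lambda>n. y * (complex_of_real (c n) * y ^ n)) sums (y * S)" using S by (rule sums_mult)
    have "(\<lambda>n. y * (complex_of_real (c n) * y ^ n) - complex_of_real (c (Suc n)) * y ^ Suc n) sums (y * S - (S - 1))"
      using 2 1 by (rule sums_diff)
    moreover have "y * (complex_of_real (c n) * y ^ n) - complex_of_real (c (Suc n)) * y ^ Suc n
       = complex_of_real (L (V ^ n)) * (1 - z) ^ Suc n" for n
      by (simp add: c_def b_def y_def algebra_simps)
    ultimately have "(\<lambda>n. complex_of_real (L (V ^ n)) * (1 - z) ^ Suc n) sums (y * S - (S - 1))" by simp
    then have "1 - f z = y * S - (S - 1)" using s[OF z] sums_unique2 by blast
    then have "f z = z * S" by (simp add: y_def algebra_simps)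
    then show "(\<lambda>n. complex_of_real (D n 0) * (1 - z) ^ n) sums (f z / z)"
      using S z0 by (simp add: D0 y_def)
  qed
qed

end

section \<open>Taylor coefficients at 1 as a functional given by contour integrals\<close>

abbreviation cpoly :: "real poly \<Rightarrow> complex poly" where "cpoly \<equiv> map_poly complex_of_real"

lemma cpoly_eval: "poly (cpoly p) u = (\<Sum>i\<le>degree p. complex_of_real (coeff p i) * u ^ i)"
  by (simp add: poly_altdef coeff_map_poly degree_map_poly)

lemma cpoly_mult: "cpoly (p * q) = cpoly p * cpoly q"
  by (intro poly_eqI) (simp add: coeff_map_poly coeff_mult)

lemma cpoly_power: "cpoly (p ^ n) = cpoly p ^ n"
  by (induction n) (simp_all add: cpoly_mult)

text \<open>The derivative is a limit of real difference quotients along the increments 1/(n+1), and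
  the reals are closed.\<close>

lemma deriv_real_on_positives:
  assumes f: "f holomorphic_on slit" and re: "\<And>t. t > 0 \<Longrightarrow> f (complex_of_real t) \<in> \<real>" and t: "t > 0"
  shows "deriv f (complex_of_real t) \<in> \<real>"
proof -
  have "f field_differentiable at (complex_of_real t)"
    using f open_slit t by (intro holomorphic_on_imp_differentiable_at[of f slit] half_plane_subset_slit) auto
  then have "(f has_field_derivative deriv f (complex_of_real t)) (at (complex_of_real t))"
    by (rule field_differentiable_derivI)
  then have *: "(\<lambda>h. (f (complex_of_real t + h) - f (complex_of_real t)) / h) \<midarrow>0\<rightarrow> deriv f (complex_of_real t)"
    by (simp add: DERIV_def)
  define h where "h = (\<lambda>n. complex_of_real (1 / real (Suc n)))"
  have h0: "h \<longlonglongrightarrow> 0" 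
  proof -
    have "(\<lambda>n. 1 / real (Suc n)) \<longlonglongrightarrow> 0" using LIMSEQ_inverse_real_of_nat by (simp only: inverse_eq_divide)
    from tendsto_of_real[OF this, where 'a=complex] show ?thesis by (simp only: h_def of_real_0)
  qed
  have "h n \<noteq> 0" for n unfolding h_def of_real_eq_0_iff by simp
  then have "filterlim h (at 0) sequentially" using h0 by (simp add: filterlim_at)
  from filterlim_compose[OF * this]
  have "(\<lambda>n. (f (complex_of_real t + h n) - f (complex_of_real t)) / h n) \<longlonglongrightarrow> deriv f (complex_of_real t)" .
  moreover have "(f (complex_of_real t + h n) - f (complex_of_real t)) / h n \<in> \<real>" for n
  proof -
    have "complex_of_real t + h n = complex_of_real (t + 1 / real (Suc n))" by (simp add: h_def)
    moreover have "0 < t + 1 / real (Suc n)" using t by (intro add_pos_pos) auto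
    moreover have "h n \<in> \<real>" unfolding h_def by (rule Reals_of_real)
    ultimately show ?thesis using t by (simp only: Reals_divide Reals_diff re)
  qed
  ultimately show ?thesis
    using closed_complex_Reals by (rule_tac Lim_in_closed_set[of \<real>]) auto
qed

lemma higher_deriv_real_on_positives:
  assumes f: "f holomorphic_on slit" and re: "\<And>t. t > 0 \<Longrightarrow> f (complex_of_real t) \<in> \<real>" and t: "t > 0"
  shows "(deriv ^^ n) f (complex_of_real t) \<in> \<real>"
  using t
proof (induction n arbitrary: t)
  case (Suc n)
  have "(deriv ^^ n) f holomorphic_on slit" using f open_slit by (rule holomorphic_higher_deriv)
  from deriv_real_on_positives[OF this Suc.IH Suc.prems] show ?case by simp
qed (use re in auto)

text \<open>In the variable v = -1/(z-1) the condition \<open>hankel\<close> says that the Taylor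
  functional is nonnegative on q(v)^2; the contour form is the one in which operator monotonicity
  delivers it.\<close>

locale pick_data =
  fixes f :: "complex \<Rightarrow> complex"
  assumes hol: "f holomorphic_on slit" and f1: "f 1 = 1"
    and real: "\<And>t. t > 0 \<Longrightarrow> f (complex_of_real t) \<in> \<real>"
    and pos: "\<And>t. t > 0 \<Longrightarrow> 0 < Re (f (complex_of_real t))"
    and hankel: "\<And>q. 0 \<le> Re (contour_integral (circlepath 1 (1/2))
      (\<lambda>z. f z * (poly (cpoly q) (- 1 / (z - 1)))\<^sup>2 / (z - 1)\<^sup>2) / (2 * pi * \<i>))"
begin

definition b :: "nat \<Rightarrow> real" where
  "b n = (- 1) ^ n * Re ((deriv ^^ Suc n) f 1 / fact (Suc n))"

definition L :: "real poly \<Rightarrow> real" where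
  "L p = (\<Sum>i\<le>degree p. coeff p i * b i)"

lemma b_complex: "complex_of_real (b n) = (- 1) ^ n * ((deriv ^^ Suc n) f 1 / fact (Suc n))"
proof -
  have "(deriv ^^ Suc n) f (complex_of_real 1) \<in> \<real>"
    by (rule higher_deriv_real_on_positives[OF hol real]) auto
  moreover have "(fact (Suc n) :: complex) \<in> \<real>" by (metis Reals_of_real of_real_fact)
  ultimately have "(deriv ^^ Suc n) f 1 / fact (Suc n) \<in> \<real>" by (simp only: of_real_1 Reals_divide)
  then show ?thesis by (simp add: b_def of_real_Re)
qed

lemma L_eq: "degree p \<le> N \<Longrightarrow> L p = (\<Sum>i\<le>N. coeff p i * b i)"
  unfolding L_def by (intro sum.mono_neutral_left) (auto simp: coeff_eq_0)

lemma L_add: "L (p + q) = L p + L q"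
proof -
  define N where "N = max (degree p) (degree q)"
  have "degree (p + q) \<le> N" unfolding N_def by (rule degree_add_le_max)
  then show ?thesis using L_eq[of p N] L_eq[of q N] L_eq[of "p + q" N]
    by (simp add: N_def sum.distrib algebra_simps)
qed

lemma L_smult: "L (Polynomial.smult c p) = c * L p"
  using L_eq[of p "degree p"] L_eq[of "Polynomial.smult c p" "degree p"]
  by (simp add: degree_smult_le sum_distrib_left algebra_simps)

text \<open>The term v^i / (z-1)^2 is (-1)^i / (z-1)^(i+2), from which Cauchy's formula extracts the
  (i+1)-st Taylor coefficient. Any circle around 1 whose disc lies in the slit plane is admissible;
  this freedom yields both growth bounds.\<close>

lemma L_contour:
  assumes r: "0 < r" and sub: "cball c r \<subseteq> slit" and one: "1 \<in> ball c r"
  shows "((\<lambda>z. f z * poly (cpoly p) (- 1 / (z - 1)) / (z - 1)\<^sup>2) has_contour_integral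
     2 * pi * \<i> * complex_of_real (L p)) (circlepath c r)"
proof -
  have aux: "x * (- 1) ^ i * (F / w ^ Suc (Suc i)) = F * (x * (- 1 / w) ^ i) / w\<^sup>2" for x F w :: complex and i
    by (simp only: power_divide power_Suc power2_eq_square times_divide_eq_right times_divide_eq_left divide_divide_eq_left ac_simps)
  have hol': "continuous_on (cball c r) f" "f holomorphic_on ball c r"
    using hol sub holomorphic_on_subset holomorphic_on_imp_continuous_on ball_subset_cball by blast+
  have "((\<lambda>z. \<Sum>i\<le>degree p. complex_of_real (coeff p i) * (- 1) ^ i * (f z / (z - 1) ^ Suc (Suc i)))
     has_contour_integral (\<Sum>i\<le>degree p. complex_of_real (coeff p i) * (- 1) ^ i *
       (complex_of_real (2 * pi) * \<i> / fact (Suc i) * (deriv ^^ Suc i) f 1))) (circlepath c r)"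
    by (intro has_contour_integral_sum has_contour_integral_lmul
        Cauchy_has_contour_integral_higher_derivative_circlepath hol' one) auto
  also have "(\<Sum>i\<le>degree p. complex_of_real (coeff p i) * (- 1) ^ i *
       (complex_of_real (2 * pi) * \<i> / fact (Suc i) * (deriv ^^ Suc i) f 1))
     = 2 * pi * \<i> * complex_of_real (L p)"
    unfolding L_def of_real_sum of_real_mult b_complex sum_distrib_left
    by (intro sum.cong) (simp_all add: field_simps del: funpow.simps fact_Suc)
  also have "(\<lambda>z. \<Sum>i\<le>degree p. complex_of_real (coeff p i) * (- 1) ^ i * (f z / (z - 1) ^ Suc (Suc i)))
    = (\<lambda>z. f z * poly (cpoly p) (- 1 / (z - 1)) / (z - 1)\<^sup>2)"
    unfolding cpoly_eval sum_distrib_left sum_divide_distrib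
    by (intro ext sum.cong) (simp_all only: aux)
  finally show ?thesis .
qed

lemma L_bound:
  assumes r: "0 < r" and sub: "cball c r \<subseteq> slit" and one: "1 \<in> ball c r"
  shows "\<exists>C\<ge>0. \<forall>p B. (\<forall>z. cmod (z - c) = r \<longrightarrow> cmod (poly (cpoly p) (- 1 / (z - 1))) \<le> B) \<longrightarrow> \<bar>L p\<bar> \<le> C * B"
proof -
  have ne: "z \<noteq> 1" if "z \<in> sphere c r" for z using that one by auto
  have "continuous_on (sphere c r) (\<lambda>z. f z / (z - 1)\<^sup>2)"
  proof (intro continuous_intros)
    show "continuous_on (sphere c r) f"
      using hol sub sphere_cball[of c r] holomorphic_on_imp_continuous_on continuous_on_subset by blast
  qed (use ne in auto)
  then have "compact ((\<lambda>z. f z / (z - 1)\<^sup>2) ` sphere c r)" by (rule compact_continuous_image) auto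
  then have "bounded ((\<lambda>z. f z / (z - 1)\<^sup>2) ` sphere c r)" by (rule compact_imp_bounded)
  then obtain M where M: "\<And>z. z \<in> sphere c r \<Longrightarrow> cmod (f z / (z - 1)\<^sup>2) \<le> M"
    unfolding bounded_iff by (metis imageI)
  have w: "c + complex_of_real r \<in> sphere c r" using r by (simp add: dist_norm)
  have M0: "M \<ge> 0" using M[OF w] norm_ge_zero order_trans by blast
  have "\<bar>L p\<bar> \<le> (M * r) * B" if B: "\<And>z. cmod (z - c) = r \<Longrightarrow> cmod (poly (cpoly p) (- 1 / (z - 1))) \<le> B" for p B
  proof -
    have B0: "B \<ge> 0" using B[of "c + complex_of_real r"] r norm_ge_zero order_trans by (metis add_diff_cancel_left' abs_of_pos norm_of_real)
    have "cmod (2 * pi * \<i> * complex_of_real (L p)) \<le> (M * B) * (2 * pi * r)"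
    proof (rule has_contour_integral_bound_circlepath[OF L_contour[OF r sub one]])
      fix z assume z: "cmod (z - c) = r"
      have "cmod (f z / (z - 1)\<^sup>2) * cmod (poly (cpoly p) (- 1 / (z - 1))) \<le> M * B"
        using M[of z] B[OF z] z M0 by (intro mult_mono) (auto simp: dist_norm norm_minus_commute)
      then show "cmod (f z * poly (cpoly p) (- 1 / (z - 1)) / (z - 1)\<^sup>2) \<le> M * B"
        by (simp add: norm_mult norm_divide)
    qed (use M0 B0 r in auto)
    then have "(2 * pi) * \<bar>L p\<bar> \<le> (2 * pi) * (M * r * B)" by (simp add: norm_mult algebra_simps)
    then show ?thesis by (rule mult_left_le_imp_le) simp
  qed
  then show ?thesis using M0 r by (intro exI[of _ "M * r"]) auto
qed

lemma half_ball: "0 < (1/2 :: real)" "cball (1::complex) (1/2) \<subseteq> slit" "(1::complex) \<in> ball 1 (1/2)"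
proof -
  have "cball (1::complex) (1/2) \<subseteq> ball 1 1" by (auto simp: dist_norm)
  then show "cball (1::complex) (1/2) \<subseteq> slit" using ball_subset_slit by blast
qed auto

sublocale hausdorff_functional L
proof
  show "L (p + q) = L p + L q" for p q by (rule L_add)
  show "L (Polynomial.smult c p) = c * L p" for c p by (rule L_smult)
  show "0 \<le> L (q * q)" for q
  proof -
    have "contour_integral (circlepath 1 (1/2)) (\<lambda>z. f z * poly (cpoly (q * q)) (- 1 / (z - 1)) / (z - 1)\<^sup>2)
      = 2 * pi * \<i> * complex_of_real (L (q * q))"
      by (rule contour_integral_unique[OF L_contour[OF half_ball]])
    then show ?thesis using hankel[of q] by (simp add: cpoly_mult power2_eq_square)
  qed
  show "\<exists>C. \<forall>n. \<bar>L ([:0, 1:] ^ n)\<bar> \<le> C * R ^ n" if R: "R > 1" for R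
  proof -
    \<comment> \<open>On the circle of radius 1/R around 1 the variable v has modulus R, and R > 1
      keeps the closed disc inside the slit plane.\<close>
    have sub: "cball (1::complex) (1 / R) \<subseteq> slit"
    proof -
      have "cball (1::complex) (1 / R) \<subseteq> ball 1 1"
      proof
        fix z :: complex assume "z \<in> cball 1 (1 / R)"
        then have "dist 1 z \<le> 1 / R" by simp
        also have "1 / R < 1" using R by simp
        finally show "z \<in> ball 1 1" by simp
      qed
      then show ?thesis using ball_subset_slit by blast
    qed
    obtain C where C: "\<And>p B. (\<forall>z. cmod (z - 1) = 1 / R \<longrightarrow> cmod (poly (cpoly p) (- 1 / (z - 1))) \<le> B) \<Longrightarrow> \<bar>L p\<bar> \<le> C * B"
      using L_bound[of "1 / R" 1, OF _ sub] R by auto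
    have "\<bar>L ([:0, 1:] ^ n)\<bar> \<le> C * R ^ n" for n
    proof (rule C, intro allI impI)
      fix z assume z: "cmod (z - 1) = 1 / R"
      have "poly (cpoly ([:0, 1:] ^ n)) (- 1 / (z - 1)) = (- 1 / (z - 1)) ^ n"
        by (simp add: cpoly_power poly_power map_poly_pCons)
      then show "cmod (poly (cpoly ([:0, 1:] ^ n)) (- 1 / (z - 1))) \<le> R ^ n"
        using z R by (simp add: norm_power norm_divide)
    qed
    then show ?thesis by auto
  qed
  show "\<exists>C. \<forall>n. \<bar>L ([:1, -1:] ^ n)\<bar> \<le> C * R ^ n" if R: "R > 1" for R
  proof -
    \<comment> \<open>the Apollonius circle \<open>|z| = R |z - 1|\<close>, on which \<open>1 - v = z / (z - 1)\<close> has modulus \<open>R\<close>\<close>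
    define c where "c = R\<^sup>2 / (R\<^sup>2 - 1)"
    define r where "r = R / (R\<^sup>2 - 1)"
    have R2: "R\<^sup>2 > 1" using R by (simp add: power2_eq_square less_1_mult)
    have r: "r > 0" unfolding r_def using R R2 by simp
    have cr: "c - r > 0" unfolding c_def r_def diff_divide_distrib[symmetric]
      using R R2 by (simp add: power2_eq_square)
    have c1: "c - 1 = 1 / (R\<^sup>2 - 1)" unfolding c_def using R2 by (simp add: field_simps)
    have sub: "cball (complex_of_real c) r \<subseteq> slit"
    proof
      fix z :: complex assume "z \<in> cball (complex_of_real c) r"
      then have "\<bar>Re (complex_of_real c - z)\<bar> \<le> r" using abs_Re_le_cmod[of "complex_of_real c - z"] by (simp add: dist_norm)
      then show "z \<in> slit" using cr by (intro half_plane_subset_slit) simp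
    qed
    have one: "1 \<in> ball (complex_of_real c) r"
    proof -
      have "dist (complex_of_real c) 1 = \<bar>c - 1\<bar>" by (metis dist_norm norm_of_real of_real_1 of_real_diff)
      also have "\<dots> < r" unfolding c1 r_def using R R2 by (simp add: field_simps)
      finally show ?thesis by simp
    qed
    obtain C where C: "\<And>p B. (\<forall>z. cmod (z - complex_of_real c) = r \<longrightarrow> cmod (poly (cpoly p) (- 1 / (z - 1))) \<le> B) \<Longrightarrow> \<bar>L p\<bar> \<le> C * B"
      using L_bound[OF r sub one] by auto
    have "\<bar>L ([:1, -1:] ^ n)\<bar> \<le> C * R ^ n" for n
    proof (rule C, intro allI impI)
      fix z assume z: "cmod (z - complex_of_real c) = r"
      have z1: "z \<noteq> 1" using z one by (auto simp: dist_norm norm_minus_commute)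
      have "(Re z - c)\<^sup>2 + (Im z)\<^sup>2 = r\<^sup>2" unfolding z[symmetric] cmod_power2 by simp
      then have e: "(Re z)\<^sup>2 + (Im z)\<^sup>2 = 2 * c * Re z + (r\<^sup>2 - c\<^sup>2)" by (simp add: power2_eq_square algebra_simps)
      have rc: "(R\<^sup>2 - 1) * (r\<^sup>2 - c\<^sup>2) = - (R\<^sup>2)"
      proof -
        have gen: "(K - 1) * (K / (K - 1)\<^sup>2 - K\<^sup>2 / (K - 1)\<^sup>2) = - K" if "K > 1" for K :: real
        proof -
          have "K / (K - 1)\<^sup>2 - K\<^sup>2 / (K - 1)\<^sup>2 = - (K * (K - 1)) / ((K - 1) * (K - 1))"
            by (simp add: diff_divide_distrib[symmetric] power2_eq_square algebra_simps)
          also have "\<dots> = - K / (K - 1)" using that by simp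
          finally show ?thesis using that by simp
        qed
        show ?thesis using gen[OF R2] by (simp add: r_def c_def power_divide)
      qed
      have cc: "(R\<^sup>2 - 1) * c = R\<^sup>2" unfolding c_def using R2 by simp
      have "(R\<^sup>2 - 1) * ((Re z)\<^sup>2 + (Im z)\<^sup>2) = 2 * ((R\<^sup>2 - 1) * c) * Re z + (R\<^sup>2 - 1) * (r\<^sup>2 - c\<^sup>2)"
        unfolding e by (simp add: algebra_simps)
      then have "(Re z)\<^sup>2 + (Im z)\<^sup>2 = R\<^sup>2 * ((Re z - 1)\<^sup>2 + (Im z)\<^sup>2)"
        unfolding rc cc by (simp add: power2_eq_square algebra_simps)
      then have "(cmod z)\<^sup>2 = (R * cmod (z - 1))\<^sup>2" by (simp add: cmod_power2 power_mult_distrib)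
      then have m: "cmod z = R * cmod (z - 1)" using R by (simp add: power2_eq_iff_nonneg)
      have "poly (cpoly ([:1, -1:] ^ n)) (- 1 / (z - 1)) = (z / (z - 1)) ^ n"
        using z1 by (simp add: cpoly_power poly_power map_poly_pCons field_simps)
      then show "cmod (poly (cpoly ([:1, -1:] ^ n)) (- 1 / (z - 1))) \<le> R ^ n"
        using m z1 by (simp add: norm_power norm_divide)
    qed
    then show ?thesis by auto
  qed
qed

theorem hkern_limit: "hkern_limit f"
proof (rule hkern_limit_functional[OF hol f1])
  show "0 < Re (f (complex_of_real t))" if "0 < t" "t < 1" for t using pos that by simp
  fix z :: complex assume z: "z \<in> ball 1 1"
  have LV: "L (V ^ n) = b n" for n
  proof -
    have "V ^ n = monom 1 n" by (simp add: monom_altdef)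
    then show ?thesis using L_eq[of "monom 1 n" n] by (simp add: degree_monom_le if_distrib[of "\<lambda>x. x * _"] cong: if_cong)
  qed
  have "(\<lambda>n. (deriv ^^ n) f 1 / fact n * (z - 1) ^ n) sums f z"
    using holomorphic_on_subset[OF hol ball_subset_slit] z by (rule holomorphic_power_series)
  then have "(\<lambda>n. (deriv ^^ Suc n) f 1 / fact (Suc n) * (z - 1) ^ Suc n) sums (f z - 1)"
    by (subst sums_Suc_iff) (simp add: f1)
  then have "(\<lambda>n. - ((deriv ^^ Suc n) f 1 / fact (Suc n) * (z - 1) ^ Suc n)) sums (- (f z - 1))"
    by (rule sums_minus)
  moreover have "- ((deriv ^^ Suc n) f 1 / fact (Suc n) * (z - 1) ^ Suc n) = complex_of_real (L (V ^ n)) * (1 - z) ^ Suc n" for n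
  proof -
    have "(1 - z) ^ Suc n = (- 1) ^ Suc n * (z - 1) ^ Suc n"
      using power_minus[of "z - 1" "Suc n"] by (simp only: minus_diff_eq)
    moreover have "(- 1) ^ n * (- 1) ^ Suc n = (- 1 :: complex)" by (simp flip: power_mult_distrib)
    ultimately show ?thesis unfolding LV b_complex
      by (metis (no_types, lifting) mult.assoc mult.commute mult_minus1)
  qed
  ultimately show "(\<lambda>n. complex_of_real (L (V ^ n)) * (1 - z) ^ Suc n) sums (1 - f z)" by simp
qed

end

section \<open>Loewner's theorem for operator means\<close>

lemma partial_fractions_power:
  fixes x :: "nat \<Rightarrow> real"
  assumes "inj_on x {..m}"
  shows "\<exists>w. \<forall>z. z \<notin> complex_of_real ` x ` {..m} \<longrightarrow>
    (\<Prod>i\<le>m. 1 / (z - complex_of_real (x i))) = (\<Sum>i\<le>m. complex_of_real (w i) / (z - complex_of_real (x i)))"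
  using assms
proof (induction m)
  case 0
  then show ?case by (intro exI[of _ "\<lambda>_. 1"]) auto
next
  case (Suc m)
  then obtain w where w: "\<And>z. z \<notin> complex_of_real ` x ` {..m} \<Longrightarrow>
    (\<Prod>i\<le>m. 1 / (z - complex_of_real (x i))) = (\<Sum>i\<le>m. complex_of_real (w i) / (z - complex_of_real (x i)))"
    using inj_on_subset[OF Suc.prems, of "{..m}"] by auto
  define y where "y = x (Suc m)"
  have ne: "x i \<noteq> y" if "i \<le> m" for i using Suc.prems that unfolding y_def inj_on_def by force
  define w' where "w' = (\<lambda>i. if i = Suc m then - (\<Sum>i\<le>m. w i / (x i - y)) else w i / (x i - y))"
  have "(\<Prod>i\<le>Suc m. 1 / (z - complex_of_real (x i))) = (\<Sum>i\<le>Suc m. complex_of_real (w' i) / (z - complex_of_real (x i)))"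
    if z: "z \<notin> complex_of_real ` x ` {..Suc m}" for z
  proof -
    have zx: "z - complex_of_real (x i) \<noteq> 0" if "i \<le> Suc m" for i using z that by auto
    have zy: "z - complex_of_real y \<noteq> 0" using zx[of "Suc m"] by (simp add: y_def)
    have split: "(c / (z - a)) * (1 / (z - b)) = (c / (a - b)) / (z - a) - (c / (a - b)) / (z - b)"
      if "z - a \<noteq> 0" "z - b \<noteq> 0" "a - b \<noteq> 0" for a b c :: complex
    proof -
      have "(c / (a - b)) / (z - a) - (c / (a - b)) / (z - b) = (c / (a - b)) * (1 / (z - a) - 1 / (z - b))"
        by (simp add: right_diff_distrib)
      also have "1 / (z - a) - 1 / (z - b) = (a - b) / ((z - a) * (z - b))"
        using that by (simp add: divide_simps)
      finally show ?thesis using that by simp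
    qed
    have "(\<Prod>i\<le>Suc m. 1 / (z - complex_of_real (x i)))
      = (\<Sum>i\<le>m. complex_of_real (w i) / (z - complex_of_real (x i))) * (1 / (z - complex_of_real y))"
    proof -
      have "z \<notin> complex_of_real ` x ` {..m}" using z by auto
      from w[OF this] show ?thesis by (simp add: y_def)
    qed
    also have "\<dots> = (\<Sum>i\<le>m. complex_of_real (w i / (x i - y)) / (z - complex_of_real (x i)) - complex_of_real (w i / (x i - y)) / (z - complex_of_real y))"
      unfolding sum_distrib_right
    proof (rule sum.cong)
      fix i assume i: "i \<in> {..m}"
      have "complex_of_real (x i) - complex_of_real y \<noteq> 0" using ne i by simp
      from split[OF zx[of i] zy this, of "complex_of_real (w i)"] i
      show "complex_of_real (w i) / (z - complex_of_real (x i)) * (1 / (z - complex_of_real y)) =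
        complex_of_real (w i / (x i - y)) / (z - complex_of_real (x i)) - complex_of_real (w i / (x i - y)) / (z - complex_of_real y)"
        by simp
    qed simp
    also have "\<dots> = (\<Sum>i\<le>m. complex_of_real (w i / (x i - y)) / (z - complex_of_real (x i))) + complex_of_real (- (\<Sum>i\<le>m. w i / (x i - y))) / (z - complex_of_real y)"
      by (simp add: sum_subtractf sum_divide_distrib)
    also have "\<dots> = (\<Sum>i\<le>Suc m. complex_of_real (w' i) / (z - complex_of_real (x i)))"
      by (simp add: w'_def y_def)
    finally show ?thesis .
  qed
  then show ?case by blast
qed

text \<open>The product form on the left survives when the nodes merge and then gives powers of
  1/(z-1). For distinct nodes it equals a sum of simple poles, which is what a test vector for a
  diagonal matrix can produce.\<close>

lemma partial_fractions:
  fixes x c :: "nat \<Rightarrow> real"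
  assumes inj: "inj_on x {..<n}"
  shows "\<exists>w. \<forall>z. z \<notin> complex_of_real ` x ` {..<n} \<longrightarrow>
    (\<Sum>m<n. complex_of_real (c m) * (\<Prod>i\<le>m. 1 / (z - complex_of_real (x i)))) = (\<Sum>i<n. complex_of_real (w i) / (z - complex_of_real (x i)))"
proof -
  have "\<forall>m<n. \<exists>w. \<forall>z. z \<notin> complex_of_real ` x ` {..m} \<longrightarrow>
    (\<Prod>i\<le>m. 1 / (z - complex_of_real (x i))) = (\<Sum>i\<le>m. complex_of_real (w i) / (z - complex_of_real (x i)))"
    using inj by (intro allI impI partial_fractions_power) (auto intro: inj_on_subset)
  then obtain W where W: "\<And>m z. m < n \<Longrightarrow> z \<notin> complex_of_real ` x ` {..m} \<Longrightarrow>
    (\<Prod>i\<le>m. 1 / (z - complex_of_real (x i))) = (\<Sum>i\<le>m. complex_of_real (W m i) / (z - complex_of_real (x i)))"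
    by metis
  define w where "w = (\<lambda>i. \<Sum>m<n. c m * (if i \<le> m then W m i else 0))"
  have "(\<Sum>m<n. complex_of_real (c m) * (\<Prod>i\<le>m. 1 / (z - complex_of_real (x i)))) = (\<Sum>i<n. complex_of_real (w i) / (z - complex_of_real (x i)))"
    if z: "z \<notin> complex_of_real ` x ` {..<n}" for z
  proof -
    have "(\<Sum>m<n. complex_of_real (c m) * (\<Prod>i\<le>m. 1 / (z - complex_of_real (x i))))
      = (\<Sum>m<n. \<Sum>i<n. complex_of_real (c m * (if i \<le> m then W m i else 0)) / (z - complex_of_real (x i)))"
    proof (rule sum.cong)
      fix m assume m: "m \<in> {..<n}"
      have "(\<Prod>i\<le>m. 1 / (z - complex_of_real (x i))) = (\<Sum>i\<le>m. complex_of_real (W m i) / (z - complex_of_real (x i)))"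
        using z m by (intro W) auto
      also have "\<dots> = (\<Sum>i<n. complex_of_real (if i \<le> m then W m i else 0) / (z - complex_of_real (x i)))"
        using m by (intro sum.mono_neutral_cong_left) auto
      finally show "complex_of_real (c m) * (\<Prod>i\<le>m. 1 / (z - complex_of_real (x i)))
        = (\<Sum>i<n. complex_of_real (c m * (if i \<le> m then W m i else 0)) / (z - complex_of_real (x i)))"
        by (simp add: sum_distrib_left)
    qed simp
    also have "\<dots> = (\<Sum>i<n. complex_of_real (w i) / (z - complex_of_real (x i)))"
      by (subst sum.swap) (simp add: w_def sum_divide_distrib)
    finally show ?thesis .
  qed
  then show ?thesis by blast
qed

section \<open>Rank-one perturbations of diagonal matrices and their resolvents\<close>

text \<open>A real diagonal matrix plus d times the all-ones matrix.\<close>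

definition dmat :: "nat \<Rightarrow> (nat \<Rightarrow> real) \<Rightarrow> real \<Rightarrow> complex mat" where
  "dmat n x d = mat n n (\<lambda>(i,j). (if i = j then complex_of_real (x i) else 0) + complex_of_real d)"

lemma dmat_carrier [simp]: "dmat n x d \<in> carrier_mat n n"
  unfolding dmat_def by simp

lemma dmat_vec:
  assumes v: "v \<in> carrier_vec n" and i: "i < n"
  shows "(dmat n x d *\<^sub>v v) $ i = complex_of_real (x i) * v $ i + complex_of_real d * (\<Sum>j<n. v $ j)"
proof -
  have "(dmat n x d *\<^sub>v v) $ i = (\<Sum>j<n. dmat n x d $$ (i,j) * v $ j)"
    using v i by (intro mult_mat_vec_index_sum) auto
  also have "\<dots> = (\<Sum>j<n. (if j = i then complex_of_real (x i) * v $ j else 0) + complex_of_real d * v $ j)"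
    using i by (intro sum.cong) (auto simp: dmat_def algebra_simps)
  also have "\<dots> = complex_of_real (x i) * v $ i + complex_of_real d * (\<Sum>j<n. v $ j)"
    using i by (simp add: sum.distrib sum_distrib_left)
  finally show ?thesis .
qed

lemma dmat_qform:
  assumes v: "v \<in> carrier_vec n"
  shows "qform (dmat n x d) v = complex_of_real ((\<Sum>i<n. x i * (cmod (v $ i))\<^sup>2) + d * (cmod (\<Sum>j<n. v $ j))\<^sup>2)"
proof -
  define s where "s = (\<Sum>j<n. v $ j)"
  have "qform (dmat n x d) v = (\<Sum>i<n. (dmat n x d *\<^sub>v v) $ i * cnj (v $ i))"
    unfolding qform_def using v by (intro cip_sum mult_mat_vec_carrier[OF dmat_carrier])
  also have "\<dots> = (\<Sum>i<n. complex_of_real (x i) * (v $ i * cnj (v $ i)) + complex_of_real d * s * cnj (v $ i))"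
    using v by (intro sum.cong) (simp_all add: dmat_vec s_def[symmetric] algebra_simps del: index_mult_mat_vec)
  also have "\<dots> = (\<Sum>i<n. complex_of_real (x i) * (v $ i * cnj (v $ i))) + complex_of_real d * s * (\<Sum>i<n. cnj (v $ i))"
    by (simp add: sum.distrib sum_distrib_left)
  also have "(\<Sum>i<n. cnj (v $ i)) = cnj s" by (simp add: s_def)
  finally show ?thesis unfolding s_def[symmetric]
    by (simp only: complex_norm_square of_real_add of_real_sum of_real_mult mult.assoc)
qed

lemma dmat_herm: "herm n (dmat n x d)"
  by unfold_locales (simp_all add: hermitian_iff[OF dmat_carrier] dmat_qform)

lemma cip_norm_sum:
  fixes v :: "complex vec"
  assumes "v \<in> carrier_vec n"
  shows "Re (v \<bullet>c v) = (\<Sum>i<n. (cmod (v $ i))\<^sup>2)"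
proof -
  have "v \<bullet>c v = complex_of_real (\<Sum>i<n. (cmod (v $ i))\<^sup>2)"
    using assms by (simp only: cip_sum[where n=n] complex_norm_square of_real_sum)
  then show ?thesis by simp
qed

lemma dmat_qform_bounds:
  assumes v: "v \<in> carrier_vec n" and x: "\<And>i. i < n \<Longrightarrow> a \<le> x i \<and> x i \<le> b" and d: "d \<ge> 0"
  shows "a * Re (v \<bullet>c v) \<le> Re (qform (dmat n x d) v)"
    "Re (qform (dmat n x d) v) \<le> (b + d * n) * Re (v \<bullet>c v)"
proof -
  have q: "Re (qform (dmat n x d) v) = (\<Sum>i<n. x i * (cmod (v $ i))\<^sup>2) + d * (cmod (\<Sum>j<n. v $ j))\<^sup>2"
    unfolding dmat_qform[OF v] by simp
  have "(\<Sum>i<n. a * (cmod (v $ i))\<^sup>2) \<le> (\<Sum>i<n. x i * (cmod (v $ i))\<^sup>2)"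
    using x by (intro sum_mono mult_right_mono) auto
  moreover have "0 \<le> d * (cmod (\<Sum>j<n. v $ j))\<^sup>2" using d by simp
  ultimately show "a * Re (v \<bullet>c v) \<le> Re (qform (dmat n x d) v)"
    unfolding q cip_norm_sum[OF v] sum_distrib_left by linarith
  have 1: "(\<Sum>i<n. x i * (cmod (v $ i))\<^sup>2) \<le> (\<Sum>i<n. b * (cmod (v $ i))\<^sup>2)"
    using x by (intro sum_mono mult_right_mono) auto
  have "(cmod (\<Sum>j<n. v $ j))\<^sup>2 \<le> (\<Sum>j<n. cmod (v $ j))\<^sup>2"
    by (intro power_mono norm_sum) auto
  also have "\<dots> \<le> (\<Sum>j<n. (cmod (v $ j))\<^sup>2) * (\<Sum>j<n. 1\<^sup>2)"
    using Cauchy_Schwarz_ineq_sum[of "\<lambda>j. cmod (v $ j)" "\<lambda>_. 1" "{..<n}"] by simp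
  finally have "(cmod (\<Sum>j<n. v $ j))\<^sup>2 \<le> n * (\<Sum>j<n. (cmod (v $ j))\<^sup>2)" by (simp add: mult.commute)
  then have "d * (cmod (\<Sum>j<n. v $ j))\<^sup>2 \<le> d * (n * (\<Sum>j<n. (cmod (v $ j))\<^sup>2))" using d by (rule mult_left_mono)
  then show "Re (qform (dmat n x d) v) \<le> (b + d * n) * Re (v \<bullet>c v)"
    unfolding q cip_norm_sum[OF v] using 1 by (simp add: distrib_right sum_distrib_left mult.assoc)
qed

context herm
begin

text \<open>The form at w of the inverse of z - X, written by spectral weights so that it is a
  rational function of z with poles at the eigenvalues.\<close>

definition resolvent :: "complex vec \<Rightarrow> complex \<Rightarrow> complex" where
  "resolvent w z = (\<Sum>\<mu>\<in>eigs X. complex_of_real (sweight w \<mu>) / (z - \<mu>))"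

lemma resolvent_vec:
  assumes w: "w \<in> carrier_vec n" and z: "z \<notin> eigs X"
  obtains r where "r \<in> carrier_vec n" "z \<cdot>\<^sub>v r - X *\<^sub>v r = w" "r \<bullet>c w = resolvent w z"
proof
  let ?r = "hfun (\<lambda>t. 1 / (z - t)) *\<^sub>v w"
  show "?r \<in> carrier_vec n" using w by simp
  show "?r \<bullet>c w = resolvent w z"
    using hfun_qform[OF w, of "\<lambda>t. 1 / (z - t)"] by (simp add: resolvent_def qform_def)
  have "X *\<^sub>v ?r = hfun (\<lambda>t. t * (1 / (z - t))) *\<^sub>v w"
    using hfun_mult_vec[OF w, of "\<lambda>t. t" "\<lambda>t. 1 / (z - t)"] by (simp only: hfun_id)
  moreover have "hfun (\<lambda>t. z * (1 / (z - t))) = hfun (\<lambda>t. 1 + t * (1 / (z - t)))"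
  proof (rule hfun_cong)
    fix \<mu> assume "\<mu> \<in> eigs X"
    then have "z - \<mu> \<noteq> 0" using z by auto
    then show "z * (1 / (z - \<mu>)) = 1 + \<mu> * (1 / (z - \<mu>))" by (simp add: field_simps)
  qed
  then have "z \<cdot>\<^sub>v ?r = 1 \<cdot>\<^sub>v w + hfun (\<lambda>t. t * (1 / (z - t))) *\<^sub>v w"
    using hfun_smult_vec[OF w, of z "\<lambda>t. 1 / (z - t)"] hfun_const_vec[OF w, of 1]
      hfun_add_vec[OF w, of "\<lambda>_. 1" "\<lambda>t. t * (1 / (z - t))"] by simp
  moreover have "1 \<cdot>\<^sub>v a + b - b = a" if "a \<in> carrier_vec n" "b \<in> carrier_vec n" for a b :: "complex vec"
    using that by (intro eq_vecI) auto
  ultimately show "z \<cdot>\<^sub>v ?r - X *\<^sub>v ?r = w" using w by simp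
qed

text \<open>The Cauchy integral representation of f(X): each simple pole lies inside the circle and
  contributes f at the eigenvalue times the spectral weight.\<close>

lemma resolvent_integral:
  assumes w: "w \<in> carrier_vec n" and f: "f holomorphic_on slit"
    and eigs: "\<And>\<mu>. \<mu> \<in> eigs X \<Longrightarrow> cmod (\<mu> - 1) < 1/2"
  shows "((\<lambda>z. f z * resolvent w z) has_contour_integral 2 * pi * \<i> * qform (matfun f X) w) (circlepath 1 (1/2))"
proof -
  have sub: "cball (1::complex) (1/2) \<subseteq> ball 1 1" by (auto simp: dist_norm)
  then have f': "f holomorphic_on cball 1 (1/2)" using f ball_subset_slit holomorphic_on_subset by blast
  have spec: "spec_in n X slit" unfolding spec_in_def
  proof (intro conjI allI impI)
    fix \<mu> assume "poly (char_poly X) \<mu> = 0"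
    then have "\<mu> \<in> ball 1 1" using eigs[of \<mu>] by (simp add: eigs_def dist_norm norm_minus_commute)
    then show "\<mu> \<in> slit" using ball_subset_slit by blast
  qed (use open_slit in auto)
  have "((\<lambda>z. \<Sum>\<mu>\<in>eigs X. complex_of_real (sweight w \<mu>) * (f z / (z - \<mu>))) has_contour_integral
    (\<Sum>\<mu>\<in>eigs X. complex_of_real (sweight w \<mu>) * (2 * complex_of_real pi * \<i> * f \<mu>))) (circlepath 1 (1/2))"
    by (intro has_contour_integral_sum has_contour_integral_lmul Cauchy_integral_circlepath_simple f' eigs finite_eigs[OF carr])
  moreover have "(\<Sum>\<mu>\<in>eigs X. complex_of_real (sweight w \<mu>) * (2 * complex_of_real pi * \<i> * f \<mu>)) = 2 * pi * \<i> * qform (matfun f X) w"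
    unfolding matfun_eq_hfun[OF spec f] hfun_qform[OF w] sum_distrib_left by (intro sum.cong) simp_all
  moreover have "(\<Sum>\<mu>\<in>eigs X. complex_of_real (sweight w \<mu>) * (f z / (z - \<mu>))) = f z * resolvent w z" for z
    unfolding resolvent_def sum_distrib_left by (intro sum.cong) simp_all
  ultimately show ?thesis by simp
qed

end

text \<open>The Sherman-Morrison formula. The perturbation sees the solution r only through the sum
  \<kappa> of its entries, and summing the coordinate equations gives a scalar equation for
  \<kappa>. The value d = 0 yields the unperturbed resolvent.\<close>

lemma dmat_resolvent:
  fixes x w :: "nat \<Rightarrow> real" and n :: nat and d :: real
  defines "\<phi> \<equiv> \<lambda>z. \<Sum>i<n. complex_of_real (w i) / (z - complex_of_real (x i))"
    and "\<psi> \<equiv> \<lambda>z. \<Sum>i<n. 1 / (z - complex_of_real (x i))"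
  assumes z: "z \<notin> eigs (dmat n x d)" "\<And>i. i < n \<Longrightarrow> z \<noteq> complex_of_real (x i)" and d: "1 - complex_of_real d * \<psi> z \<noteq> 0"
  shows "herm.resolvent (dmat n x d) (vec n (\<lambda>i. complex_of_real (w i))) z
    = (\<Sum>i<n. complex_of_real ((w i)\<^sup>2) / (z - complex_of_real (x i))) + complex_of_real d * ((\<phi> z)\<^sup>2 / (1 - complex_of_real d * \<psi> z))"
proof -
  interpret herm n "dmat n x d" by (rule dmat_herm)
  let ?w = "vec n (\<lambda>i. complex_of_real (w i))"
  have wc: "?w \<in> carrier_vec n" by simp
  obtain r where r: "r \<in> carrier_vec n" and eq: "z \<cdot>\<^sub>v r - dmat n x d *\<^sub>v r = ?w" and res: "r \<bullet>c ?w = resolvent ?w z"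
    by (rule resolvent_vec[OF wc z(1)])
  define \<kappa> where "\<kappa> = (\<Sum>j<n. r $ j)"
  have ri: "r $ i = (complex_of_real (w i) + complex_of_real d * \<kappa>) / (z - complex_of_real (x i))" if i: "i < n" for i
  proof -
    have Yr: "dmat n x d *\<^sub>v r \<in> carrier_vec n" using mult_mat_vec_carrier[OF dmat_carrier r] .
    have "complex_of_real (w i) = (z \<cdot>\<^sub>v r - dmat n x d *\<^sub>v r) $ i" unfolding eq using i by simp
    also have "\<dots> = (z \<cdot>\<^sub>v r) $ i - (dmat n x d *\<^sub>v r) $ i"
      by (rule index_minus_vec(1)) (use carrier_vecD[OF Yr] i in metis)
    also have "(z \<cdot>\<^sub>v r) $ i = z * r $ i" using i r by simp
    also have "(dmat n x d *\<^sub>v r) $ i = complex_of_real (x i) * r $ i + complex_of_real d * \<kappa>"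
      unfolding \<kappa>_def by (rule dmat_vec[OF r i])
    finally have "complex_of_real (w i) + complex_of_real d * \<kappa> = r $ i * (z - complex_of_real (x i))" by (simp add: algebra_simps)
    then show ?thesis using z(2)[OF i] by (simp add: eq_divide_eq)
  qed
  have "\<kappa> = (\<Sum>i<n. (complex_of_real (w i) + complex_of_real d * \<kappa>) / (z - complex_of_real (x i)))"
    by (subst \<kappa>_def) (intro sum.cong, simp_all add: ri)
  also have "\<dots> = \<phi> z + complex_of_real d * \<kappa> * \<psi> z"
    by (simp add: \<phi>_def \<psi>_def add_divide_distrib sum.distrib sum_distrib_left)
  finally have "\<kappa> = \<phi> z + complex_of_real d * \<kappa> * \<psi> z" .
  then have \<kappa>: "\<kappa> = \<phi> z / (1 - complex_of_real d * \<psi> z)" using d by (simp add: eq_divide_eq algebra_simps)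
  have "r \<bullet>c ?w = (\<Sum>i<n. r $ i * cnj (?w $ i))" using r wc by (rule cip_sum)
  also have "\<dots> = (\<Sum>i<n. complex_of_real ((w i)\<^sup>2) / (z - complex_of_real (x i)) + complex_of_real d * \<kappa> * (complex_of_real (w i) / (z - complex_of_real (x i))))"
    by (intro sum.cong) (simp_all add: ri add_divide_distrib power2_eq_square algebra_simps)
  also have "\<dots> = (\<Sum>i<n. complex_of_real ((w i)\<^sup>2) / (z - complex_of_real (x i))) + complex_of_real d * \<kappa> * \<phi> z"
    by (simp add: sum.distrib \<phi>_def sum_distrib_left)
  finally show ?thesis unfolding res[symmetric] \<kappa> by (simp add: power2_eq_square)
qed

text \<open>Operator monotonicity makes the form of f(D_\<epsilon>) - f(D_0) at w nonnegative. By
  the two preceding lemmas this difference, divided by \<epsilon>, is up to the factor 2 \<pi> i the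
  integral of f \<phi>^2 / (1 - \<epsilon> \<psi>). Merging the nodes at 1 turns \<phi> into
  q(v)/(z-1), and the limit is the Hankel condition.\<close>

theorem op_mean_fun_hkern_limit:
  assumes f: "op_mean_fun f"
  shows "hkern_limit f"
proof -
  have hol: "f holomorphic_on slit" and om: "operator_monotone f" using f by (auto simp: op_mean_fun_def)
  have hankel: "0 \<le> Re (contour_integral (circlepath 1 (1/2))
      (\<lambda>z. f z * (poly (cpoly q) (- 1 / (z - 1)))\<^sup>2 / (z - 1)\<^sup>2) / (2 * pi * \<i>))" for q
  proof -
    define n where "n = Suc (degree q)"
    \<comment> \<open>The sign matches powers of -1/(z-1). With all nodes at 1,
      \<open>\<phi>\<close> becomes q(-1/(z-1)) / (z-1), and the extra factor squares to the
      denominator (z-1)^2.\<close>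
    define c where "c = (\<lambda>m. (- 1) ^ m * coeff q m)"
    define x where "x = (\<lambda>\<epsilon> i. 1 + \<epsilon> * real i)"
    define \<phi> where "\<phi> = (\<lambda>\<epsilon> z. \<Sum>m<n. complex_of_real (c m) * (\<Prod>i\<le>m. 1 / (z - complex_of_real (x \<epsilon> i))))"
    define \<psi> where "\<psi> = (\<lambda>\<epsilon> z. \<Sum>i<n. 1 / (z - complex_of_real (x \<epsilon> i)))"
    define G where "G = (\<lambda>\<epsilon> z. f z * ((\<phi> \<epsilon> z)\<^sup>2 / (1 - complex_of_real \<epsilon> * \<psi> \<epsilon> z)))"
    \<comment> \<open>For \<epsilon> \<le> e0 the nodes stay within 1/8 of 1, the spectra of both
      matrices lie in [1, 5/4] and hence inside the circle of radius 1/2, and \<epsilon> \<psi> has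
      modulus at most 1/2 on that circle.\<close>
    define e0 :: real where "e0 = 1 / (8 * n)"
    have n0: "n > 0" by (simp add: n_def)
    have e0: "e0 > 0" using n0 by (simp add: e0_def)
    have en: "\<epsilon> * real n \<le> 1/8" if "\<epsilon> \<le> e0" for \<epsilon>
      using mult_right_mono[OF that, of "real n"] n0 by (simp add: e0_def)
    have xb: "1 \<le> x \<epsilon> i \<and> x \<epsilon> i \<le> 1 + \<epsilon> * n" if "0 \<le> \<epsilon>" "i < n" for \<epsilon> i
      using that by (auto simp: x_def intro!: mult_left_mono)
    have far: "1/4 \<le> cmod (z - complex_of_real (x \<epsilon> i))" if "cmod (z - 1) = 1/2" "0 \<le> \<epsilon>" "\<epsilon> \<le> e0" "i < n" for z \<epsilon> i
    proof -
      have "cmod (z - 1) \<le> cmod (z - complex_of_real (x \<epsilon> i)) + cmod (complex_of_real (x \<epsilon> i - 1))"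
        using norm_triangle_ineq[of "z - complex_of_real (x \<epsilon> i)" "complex_of_real (x \<epsilon> i - 1)"] by simp
      moreover have "cmod (complex_of_real (x \<epsilon> i - 1)) \<le> 1/8"
        unfolding norm_of_real using xb[OF that(2,4)] en[OF that(3)] by simp
      ultimately show ?thesis using that(1) by simp
    qed
    have zne: "z - complex_of_real (x \<epsilon> i) \<noteq> 0" if "cmod (z - 1) = 1/2" "0 \<le> \<epsilon>" "\<epsilon> \<le> e0" "i < n" for z \<epsilon> i
      using far[OF that] by auto
    have den: "1 - complex_of_real \<epsilon> * \<psi> \<epsilon> z \<noteq> 0" if "cmod (z - 1) = 1/2" "0 \<le> \<epsilon>" "\<epsilon> \<le> e0" for z \<epsilon>
    proof
      assume "1 - complex_of_real \<epsilon> * \<psi> \<epsilon> z = 0"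
      then have "cmod (complex_of_real \<epsilon> * \<psi> \<epsilon> z) = 1" by (metis eq_iff_diff_eq_0 norm_one)
      moreover have "cmod (\<psi> \<epsilon> z) \<le> (\<Sum>i<n. 4)" unfolding \<psi>_def
      proof (rule sum_norm_le)
        fix i assume "i \<in> {..<n}"
        then have "1/4 \<le> cmod (z - complex_of_real (x \<epsilon> i))" using far[OF that] by simp
        then have "1 / cmod (z - complex_of_real (x \<epsilon> i)) \<le> 1 / (1/4)" by (intro divide_left_mono) (auto intro!: mult_pos_pos)
        then show "cmod (1 / (z - complex_of_real (x \<epsilon> i))) \<le> 4" by (simp add: norm_divide)
      qed
      then have "\<epsilon> * cmod (\<psi> \<epsilon> z) \<le> \<epsilon> * (4 * real n)" using that by (intro mult_left_mono) auto
      then have "cmod (complex_of_real \<epsilon> * \<psi> \<epsilon> z) \<le> 1/2" using en[OF that(3)] that(2) by (simp add: norm_mult)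
      ultimately show False by simp
    qed
    have key: "0 \<le> Re (contour_integral (circlepath 1 (1/2)) (G \<epsilon>) / (2 * pi * \<i>))" if eps: "0 < \<epsilon>" "\<epsilon> \<le> e0" for \<epsilon>
    proof -
      have "inj_on (x \<epsilon>) {..<n}" using eps by (auto simp: inj_on_def x_def)
      from partial_fractions[OF this, of c] obtain w where w: "\<And>z. z \<notin> complex_of_real ` x \<epsilon> ` {..<n} \<Longrightarrow>
        \<phi> \<epsilon> z = (\<Sum>i<n. complex_of_real (w i) / (z - complex_of_real (x \<epsilon> i)))" unfolding \<phi>_def by auto
      let ?w = "vec n (\<lambda>i. complex_of_real (w i))"
      have wc: "?w \<in> carrier_vec n" by simp
      let ?D = "dmat n (x \<epsilon>)"
      have bnd: "1 * Re (v \<bullet>c v) \<le> Re (qform (?D d) v)" "Re (qform (?D d) v) \<le> (5/4) * Re (v \<bullet>c v)"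
        if d: "0 \<le> d" "d \<le> \<epsilon>" and v: "v \<in> carrier_vec n" for d v
      proof -
        show "1 * Re (v \<bullet>c v) \<le> Re (qform (?D d) v)"
          using xb eps d by (intro dmat_qform_bounds(1)[OF v, where b="1 + \<epsilon> * n"]) auto
        have "Re (qform (?D d) v) \<le> ((1 + \<epsilon> * n) + d * n) * Re (v \<bullet>c v)"
          using xb eps d by (intro dmat_qform_bounds(2)[OF v, where a=1]) auto
        also have "\<dots> \<le> (5/4) * Re (v \<bullet>c v)"
          using en[OF eps(2)] en[of d] d eps cip_self(2)[OF v] by (intro mult_right_mono) auto
        finally show "Re (qform (?D d) v) \<le> (5/4) * Re (v \<bullet>c v)" .
      qed
      have ev: "cmod (\<mu> - 1) < 1/2" if d: "0 \<le> d" "d \<le> \<epsilon>" and \<mu>: "\<mu> \<in> eigs (?D d)" for d \<mu>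
      proof -
        interpret H: herm n "?D d" by (rule dmat_herm)
        have "1 \<le> Re \<mu>" by (rule H.eigs_bounds(2)[OF \<mu> bnd(1)[OF d]])
        moreover have "Re \<mu> \<le> 5/4" by (rule H.eigs_bounds(1)[OF \<mu> bnd(2)[OF d]])
        moreover have "\<mu> - 1 = complex_of_real (Re \<mu> - 1)" using H.eigs_real[OF \<mu>] by simp
        then have "cmod (\<mu> - 1) = \<bar>Re \<mu> - 1\<bar>" by (metis norm_of_real)
        ultimately show ?thesis by simp
      qed
      have pd: "pd_mat (?D 0)"
        unfolding pd_mat_def
      proof (intro conjI ballI impI)
        show "hermitian_mat (?D 0)" using dmat_herm herm.herm by blast
        fix v :: "complex vec" assume "v \<in> carrier_vec (dim_row (?D 0))" "v \<noteq> 0\<^sub>v (dim_row (?D 0))"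
        then have v: "v \<in> carrier_vec n" "v \<noteq> 0\<^sub>v n" by (auto simp: dmat_def)
        show "Im (qform (?D 0) v) = 0" by (simp add: dmat_qform[OF v(1)])
        have "Re (v \<bullet>c v) > 0" using cip_self[OF v(1)] v(2) by (auto simp: order.order_iff_strict)
        then show "Re (qform (?D 0) v) > 0" using bnd(1)[of 0 v] eps v by simp
      qed
      have "loewner_le (?D 0) (?D \<epsilon>)"
        unfolding loewner_le_iff[OF dmat_carrier dmat_carrier]
        using herm.herm[OF dmat_herm] eps by (simp add: dmat_qform)
      then have "loewner_le (matfun f (?D 0)) (matfun f (?D \<epsilon>))"
        using om pd unfolding operator_monotone_def by (meson dmat_carrier)
      then have le: "Re (qform (matfun f (?D 0)) ?w) \<le> Re (qform (matfun f (?D \<epsilon>)) ?w)"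
        using wc by (simp add: loewner_le_iff[OF matfun_carrier[OF dmat_carrier] matfun_carrier[OF dmat_carrier]])
      let ?q = "\<lambda>d. qform (matfun f (?D d)) ?w"
      have ci: "((\<lambda>z. f z * herm.resolvent (?D d) ?w z) has_contour_integral 2 * pi * \<i> * ?q d) (circlepath 1 (1/2))"
        if "0 \<le> d" "d \<le> \<epsilon>" for d
        using ev that by (intro herm.resolvent_integral[OF dmat_herm wc hol]) auto
      have "((\<lambda>z. complex_of_real (1 / \<epsilon>) * (f z * herm.resolvent (?D \<epsilon>) ?w z - f z * herm.resolvent (?D 0) ?w z))
        has_contour_integral complex_of_real (1 / \<epsilon>) * (2 * pi * \<i> * ?q \<epsilon> - 2 * pi * \<i> * ?q 0)) (circlepath 1 (1/2))"
        using eps by (intro has_contour_integral_lmul has_contour_integral_diff ci) auto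
      then have "(G \<epsilon> has_contour_integral complex_of_real (1 / \<epsilon>) * (2 * pi * \<i> * ?q \<epsilon> - 2 * pi * \<i> * ?q 0)) (circlepath 1 (1/2))"
      proof (rule has_contour_integral_eq)
        fix z :: complex assume "z \<in> path_image (circlepath 1 (1/2))"
        then have z: "cmod (z - 1) = 1/2" by (simp add: dist_norm norm_minus_commute)
        have ze: "z \<notin> eigs (?D d)" if "0 \<le> d" "d \<le> \<epsilon>" for d using ev[OF that] z by force
        have zx: "z \<noteq> complex_of_real (x \<epsilon> i)" if "i < n" for i using zne[OF z _ eps(2) that] eps by auto
        have ph: "\<phi> \<epsilon> z = (\<Sum>i<n. complex_of_real (w i) / (z - complex_of_real (x \<epsilon> i)))"
          using zx by (intro w) auto
        have d1: "1 - complex_of_real \<epsilon> * (\<Sum>i<n. 1 / (z - complex_of_real (x \<epsilon> i))) \<noteq> 0"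
          using den[OF z _ eps(2)] eps by (simp add: \<psi>_def)
        have "herm.resolvent (?D \<epsilon>) ?w z = (\<Sum>i<n. complex_of_real ((w i)\<^sup>2) / (z - complex_of_real (x \<epsilon> i)))
            + complex_of_real \<epsilon> * ((\<phi> \<epsilon> z)\<^sup>2 / (1 - complex_of_real \<epsilon> * \<psi> \<epsilon> z))"
          unfolding ph \<psi>_def using eps by (intro dmat_resolvent ze zx d1) auto
        moreover have "herm.resolvent (?D 0) ?w z = (\<Sum>i<n. complex_of_real ((w i)\<^sup>2) / (z - complex_of_real (x \<epsilon> i)))"
          using dmat_resolvent[where n=n and x="x \<epsilon>" and w=w and d=0 and z=z] ze[of 0] zx eps by simp
        ultimately show "complex_of_real (1 / \<epsilon>) * (f z * herm.resolvent (?D \<epsilon>) ?w z - f z * herm.resolvent (?D 0) ?w z) = G \<epsilon> z"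
          using eps by (simp add: G_def algebra_simps)
      qed
      then have "contour_integral (circlepath 1 (1/2)) (G \<epsilon>) = complex_of_real (1 / \<epsilon>) * (2 * pi * \<i> * ?q \<epsilon> - 2 * pi * \<i> * ?q 0)"
        by (rule contour_integral_unique)
      also have "\<dots> = (2 * pi * \<i>) * (complex_of_real (1 / \<epsilon>) * (?q \<epsilon> - ?q 0))" by (simp add: algebra_simps)
      finally have "contour_integral (circlepath 1 (1/2)) (G \<epsilon>) / (2 * pi * \<i>) = complex_of_real (1 / \<epsilon>) * (?q \<epsilon> - ?q 0)"
        by simp
      then have "Re (contour_integral (circlepath 1 (1/2)) (G \<epsilon>) / (2 * pi * \<i>)) = (1 / \<epsilon>) * Re (?q \<epsilon> - ?q 0)"
        by (simp only: times_complex.sel Re_complex_of_real Im_complex_of_real mult_zero_left diff_zero)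
      then show ?thesis using le eps by simp
    qed
    \<comment> \<open>At \<epsilon> = 0 the nodes coincide and no partial fractions exist, but the
      product form of \<open>\<phi>\<close> stays continuous up to 0. The inequality is therefore
      proved for \<epsilon> > 0 and passed to the limit.\<close>
    define I where "I = (\<lambda>\<epsilon>. contour_integral (circlepath 1 (1/2)) (G \<epsilon>))"
    have cont: "continuous_on {0..e0} I"
    proof -
      let ?g = "circlepath 1 (1/2)"
      have cg: "continuous_on ({0..e0} \<times> cbox 0 1) (\<lambda>p. ?g (snd p))"
        unfolding circlepath_def part_circlepath_def linepath_def by (intro continuous_intros)
      have circ: "cmod (?g t - 1) = 1/2" if "t \<in> cbox 0 1" for t
      proof -
        have "?g t \<in> path_image ?g" using that by (auto simp: path_image_def)
        then show ?thesis by (simp add: dist_norm norm_minus_commute)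
      qed
      have fc: "continuous_on (sphere 1 (1/2)) f"
      proof -
        have "sphere (1::complex) (1/2) \<subseteq> ball 1 1" by (auto simp: dist_norm)
        then show ?thesis using hol ball_subset_slit holomorphic_on_imp_continuous_on continuous_on_subset by (metis order_trans)
      qed
      have "continuous_on ({0..e0} \<times> cbox 0 1) (\<lambda>p. f (?g (snd p)))"
        by (rule continuous_on_compose2[OF fc cg]) (use circ in \<open>auto simp: dist_norm norm_minus_commute\<close>)
      moreover have "continuous_on ({0..e0} \<times> cbox 0 1) (\<lambda>p. \<phi> (fst p) (?g (snd p)))"
        unfolding \<phi>_def x_def by (intro continuous_intros cg) (use zne circ in \<open>auto simp: x_def\<close>)
      moreover have "continuous_on ({0..e0} \<times> cbox 0 1) (\<lambda>p. \<psi> (fst p) (?g (snd p)))"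
        unfolding \<psi>_def x_def by (intro continuous_intros cg) (use zne circ in \<open>auto simp: x_def\<close>)
      ultimately have "continuous_on ({0..e0} \<times> cbox 0 1) (\<lambda>p. G (fst p) (?g (snd p)))"
        unfolding G_def by (intro continuous_intros) (use den circ in auto)
      moreover have "continuous_on ({0..e0} \<times> cbox 0 1) (\<lambda>p. vector_derivative ?g (at (snd p)))"
        unfolding vector_derivative_circlepath by (intro continuous_intros)
      ultimately have "continuous_on ({0..e0} \<times> cbox 0 1) (\<lambda>(\<epsilon>, t). G \<epsilon> (?g t) * vector_derivative ?g (at t))"
        unfolding case_prod_unfold by (intro continuous_intros)
      then have "continuous_on {0..e0} (\<lambda>\<epsilon>. integral (cbox 0 1) (\<lambda>t. G \<epsilon> (?g t) * vector_derivative ?g (at t)))"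
        by (rule integral_continuous_on_param)
      then show ?thesis unfolding I_def contour_integral_integral by simp
    qed
    have "(\<lambda>k. e0 * (1 / real (Suc k))) \<longlonglongrightarrow> e0 * 0"
      using LIMSEQ_inverse_real_of_nat by (intro tendsto_intros) (simp only: inverse_eq_divide)
    then have seq: "(\<lambda>k. e0 / real (Suc k)) \<longlonglongrightarrow> 0" by simp
    have rng: "e0 / real (Suc k) \<in> {0..e0}" "0 < e0 / real (Suc k)" for k
      using e0 by (auto simp: divide_le_eq)
    have "(\<lambda>k. I (e0 / real (Suc k))) \<longlonglongrightarrow> I 0"
      using e0 rng by (intro continuous_on_tendsto_compose[OF cont seq]) auto
    then have "(\<lambda>k. Re (I (e0 / real (Suc k)) / (2 * pi * \<i>))) \<longlonglongrightarrow> Re (I 0 / (2 * pi * \<i>))"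
      by (intro tendsto_intros) auto
    then have "0 \<le> Re (I 0 / (2 * pi * \<i>))"
      by (rule LIMSEQ_le_const) (use key rng in \<open>auto simp: I_def\<close>)
    moreover have "G 0 = (\<lambda>z. f z * (poly (cpoly q) (- 1 / (z - 1)))\<^sup>2 / (z - 1)\<^sup>2)"
    proof
      fix z :: complex
      have neg: "(- 1 / (z - 1)) ^ m = (- 1) ^ m * (1 / (z - 1)) ^ m" for m
        by (simp flip: power_mult_distrib)
      have "\<phi> 0 z = poly (cpoly q) (- 1 / (z - 1)) * (1 / (z - 1))"
        unfolding \<phi>_def x_def cpoly_eval n_def lessThan_Suc_atMost c_def sum_distrib_right neg
        by (intro sum.cong) (simp_all add: power_divide ac_simps)
      then show "G 0 z = f z * (poly (cpoly q) (- 1 / (z - 1)))\<^sup>2 / (z - 1)\<^sup>2"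
        by (simp add: G_def power_divide)
    qed
    ultimately show ?thesis by (simp add: I_def)
  qed
  interpret pick_data f
    by unfold_locales (use f hankel in \<open>auto simp: op_mean_fun_def\<close>)
  show ?thesis by (rule hkern_limit)
qed

section \<open>Means of accretive matrices\<close>

text \<open>One notion serves both kinds of pairs: combined with hermiticity it is positive
  definiteness.\<close>

definition accretive :: "nat \<Rightarrow> complex mat \<Rightarrow> bool" where
  "accretive n A \<longleftrightarrow> A \<in> carrier_mat n n \<and> (\<forall>x\<in>carrier_vec n. x \<noteq> 0\<^sub>v n \<longrightarrow> 0 < Re (qform A x))"

lemma accretive_nonneg:
  assumes "accretive n A" "x \<in> carrier_vec n"
  shows "0 \<le> Re (qform A x)"
proof (cases "x = 0\<^sub>v n")
  case True
  have "A *\<^sub>v 0\<^sub>v n = 0\<^sub>v n" using assms by (intro mv_zero) (simp add: accretive_def)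
  then show ?thesis using True by (simp add: qform_def)
qed (use assms in \<open>auto simp: accretive_def less_imp_le\<close>)

lemma accretive_spec:
  assumes A: "accretive n A"
  shows "spec_in n A slit"
  unfolding spec_in_def
proof (intro conjI allI impI open_slit)
  show Ac: "A \<in> carrier_mat n n" using A by (simp add: accretive_def)
  fix \<mu> assume "poly (char_poly A) \<mu> = 0"
  then obtain v where v: "v \<in> carrier_vec n" "v \<noteq> 0\<^sub>v n" "A *\<^sub>v v = \<mu> \<cdot>\<^sub>v v"
    using eigs_eigenvector[OF Ac, of \<mu>] by (auto simp: eigs_def)
  have "qform A v = \<mu> * (v \<bullet>c v)" using v by (simp add: qform_def cip_smult_left[where n=n])
  moreover have "Im (v \<bullet>c v) = 0" "Re (v \<bullet>c v) > 0"
    using cip_self[OF v(1)] v(2) by (auto simp: order.order_iff_strict)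
  moreover have "0 < Re (qform A v)" using A v by (simp add: accretive_def)
  ultimately have "0 < Re \<mu>" by (simp add: zero_less_mult_iff)
  then show "\<mu> \<in> slit" by (rule half_plane_subset_slit)
qed

lemma csqrt_slit:
  "csqrt holomorphic_on slit" "(\<lambda>z. inverse (csqrt z)) holomorphic_on slit"
proof -
  show "csqrt holomorphic_on slit" by (rule holomorphic_on_csqrt)
  then show "(\<lambda>z. inverse (csqrt z)) holomorphic_on slit"
    by (rule holomorphic_on_inverse) auto
qed

locale accretive_pair =
  fixes n :: nat and A B :: "complex mat"
  assumes accA: "accretive n A" and accB: "accretive n B"
begin

lemma carrA [simp]: "A \<in> carrier_mat n n" and carrB [simp]: "B \<in> carrier_mat n n"
  using accA accB by (auto simp: accretive_def)

definition "R = matfun csqrt A"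
definition "R' = matfun (\<lambda>z. inverse (csqrt z)) A"
definition "T = R' * B * R'"

lemma R_carrier [simp]: "R \<in> carrier_mat n n" "R' \<in> carrier_mat n n" "T \<in> carrier_mat n n"
proof -
  show "R \<in> carrier_mat n n" and R': "R' \<in> carrier_mat n n" unfolding R_def R'_def by auto
  show "T \<in> carrier_mat n n" unfolding T_def
    by (rule mult_carrier_mat[OF mult_carrier_mat[OF R' carrB] R'])
qed

lemma mv_carrier [simp]:
  assumes "x \<in> carrier_vec n"
  shows "A *\<^sub>v x \<in> carrier_vec n" "B *\<^sub>v x \<in> carrier_vec n" "R *\<^sub>v x \<in> carrier_vec n"
    "R' *\<^sub>v x \<in> carrier_vec n" "T *\<^sub>v x \<in> carrier_vec n" "matfun f T *\<^sub>v x \<in> carrier_vec n"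
  using assms mult_mat_vec_carrier carrA carrB R_carrier matfun_carrier by metis+

lemma R_vec:
  assumes x: "x \<in> carrier_vec n"
  shows "R *\<^sub>v (R *\<^sub>v x) = A *\<^sub>v x" "R *\<^sub>v (R' *\<^sub>v x) = x" "R' *\<^sub>v (R *\<^sub>v x) = x"
proof -
  note S = accretive_spec[OF accA]
  have nz: "csqrt z \<noteq> 0" if "z \<in> slit" for z using that by auto
  have "matfun (\<lambda>z. csqrt z * csqrt z) A = matfun (\<lambda>z. z) A"
    by (rule matfun_cong[OF S]) (auto simp: power2_eq_square[symmetric])
  then show "R *\<^sub>v (R *\<^sub>v x) = A *\<^sub>v x"
    unfolding R_def matfun_mult_vec[OF S csqrt_slit(1) csqrt_slit(1) x] matfun_id[OF S] by simp
  have "matfun (\<lambda>z. csqrt z * inverse (csqrt z)) A = matfun (\<lambda>_. 1) A"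
    by (rule matfun_cong[OF S]) (use nz in auto)
  then show "R *\<^sub>v (R' *\<^sub>v x) = x"
    unfolding R_def R'_def matfun_mult_vec[OF S csqrt_slit(1) csqrt_slit(2) x]
    using matfun_const_vec[OF S x, of 1] by simp
  have "matfun (\<lambda>z. inverse (csqrt z) * csqrt z) A = matfun (\<lambda>_. 1) A"
    by (rule matfun_cong[OF S]) (use nz in auto)
  then show "R' *\<^sub>v (R *\<^sub>v x) = x"
    unfolding R_def R'_def matfun_mult_vec[OF S csqrt_slit(2) csqrt_slit(1) x]
    using matfun_const_vec[OF S x, of 1] by simp
qed

lemma T_vec: "x \<in> carrier_vec n \<Longrightarrow> T *\<^sub>v x = R' *\<^sub>v (B *\<^sub>v (R' *\<^sub>v x))"
  unfolding T_def by (simp add: mat_mult_vec[where n=n] mult_carrier_mat[of _ n n])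

lemma R_T_vec: "x \<in> carrier_vec n \<Longrightarrow> R *\<^sub>v (T *\<^sub>v x) = B *\<^sub>v (R' *\<^sub>v x)"
  by (simp add: T_vec R_vec)

text \<open>T itself need not be accretive. An eigenvalue \<mu> of T satisfies B y = \<mu> A y for
  some nonzero y, so it is a quotient of two numbers in the open right half-plane and cannot be a
  nonpositive real.\<close>

lemma T_spec: "spec_in n T slit"
  unfolding spec_in_def
proof (intro conjI allI impI open_slit R_carrier)
  fix \<mu> assume "poly (char_poly T) \<mu> = 0"
  then obtain x where x: "x \<in> carrier_vec n" "x \<noteq> 0\<^sub>v n" "T *\<^sub>v x = \<mu> \<cdot>\<^sub>v x"
    using eigs_eigenvector[OF R_carrier(3), of \<mu>] by (auto simp: eigs_def)
  define y where "y = R' *\<^sub>v x"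
  have y: "y \<in> carrier_vec n" using x by (simp add: y_def)
  have Ry: "R *\<^sub>v y = x" using x by (simp add: y_def R_vec)
  have y0: "y \<noteq> 0\<^sub>v n" using Ry x(2) mv_zero[OF R_carrier(1)] by auto
  have "B *\<^sub>v y = R *\<^sub>v (\<mu> \<cdot>\<^sub>v x)" using R_T_vec[OF x(1)] x(3) by (simp add: y_def)
  also have "\<dots> = \<mu> \<cdot>\<^sub>v (A *\<^sub>v y)" using x R_vec(1)[OF y] by (simp add: mv_smult[where n=n] Ry)
  finally have q: "qform B y = \<mu> * qform A y" using y by (simp add: qform_def cip_smult_left[where n=n])
  show "\<mu> \<in> slit"
  proof
    assume "\<mu> \<in> \<real>\<^sub>\<le>\<^sub>0"
    then obtain t where t: "\<mu> = complex_of_real t" "t \<le> 0" by (auto elim: nonpos_Reals_cases)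
    have "Re (qform B y) = t * Re (qform A y)" unfolding q t by simp
    moreover have "0 < Re (qform B y)" "0 < Re (qform A y)" using accA accB y y0 by (auto simp: accretive_def)
    moreover from this have "t * Re (qform A y) \<le> 0" using t(2) by (intro mult_nonpos_nonneg) auto
    ultimately show False by linarith
  qed
qed

lemma mean_op_eq: "mean_op f A B = R * matfun f T * R"
  unfolding mean_op_def R_def R'_def T_def ..

lemma mean_op_carrier [simp]: "mean_op f A B \<in> carrier_mat n n"
  unfolding mean_op_eq
  by (rule mult_carrier_mat[OF mult_carrier_mat[OF R_carrier(1) matfun_carrier[OF R_carrier(3)]] R_carrier(1)])

lemma mean_op_vec: "x \<in> carrier_vec n \<Longrightarrow> mean_op f A B *\<^sub>v x = R *\<^sub>v (matfun f T *\<^sub>v (R *\<^sub>v x))"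
  unfolding mean_op_eq
  by (simp add: mat_mult_vec[where n=n] mult_carrier_mat[of _ n n])

text \<open>Moving the outer root to the other side exhibits the mean as a fixed linear functional
  of \<open>matfun f T\<close>; limits and sums in f then pass to means. For non-Hermitian A the
  adjoint of the root has to appear.\<close>

lemma mean_op_cip:
  assumes x: "x \<in> carrier_vec n" and y: "y \<in> carrier_vec n"
  shows "(mean_op f A B *\<^sub>v x) \<bullet>c y = (matfun f T *\<^sub>v (R *\<^sub>v x)) \<bullet>c (mat_adjoint R *\<^sub>v y)"
  using x y cip_adjoint[OF R_carrier(1), of "matfun f T *\<^sub>v (R *\<^sub>v x)" y] by (simp add: mean_op_vec)

text \<open>The harmonic mean as a parallel sum, stated without inverses. If w is the image of u
  under the mean, then a and b are the preimages of w under A and B, and u is their weighted sum.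
  All comparisons of means rest on this splitting.\<close>

lemma mean_hkern:
  assumes v: "0 \<le> v" "v \<le> 1" and u: "u \<in> carrier_vec n"
  obtains a b where "a \<in> carrier_vec n" "b \<in> carrier_vec n"
    "complex_of_real v \<cdot>\<^sub>v a + complex_of_real (1 - v) \<cdot>\<^sub>v b = u"
    "A *\<^sub>v a = mean_op (hkern v) A B *\<^sub>v u" "B *\<^sub>v b = mean_op (hkern v) A B *\<^sub>v u"
proof
  let ?l = "\<lambda>z. 1 / (complex_of_real v * z + complex_of_real (1 - v))"
  have l: "?l holomorphic_on slit" using v by (intro holomorphic_intros hkern_denominator)
  have k: "hkern v holomorphic_on slit" using v by (rule hkern_holomorphic)
  let ?a = "R' *\<^sub>v (matfun (hkern v) T *\<^sub>v (R *\<^sub>v u))" and ?b = "R' *\<^sub>v (matfun ?l T *\<^sub>v (R *\<^sub>v u))"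
  have h1: "(\<lambda>z. complex_of_real v * hkern v z) holomorphic_on slit"
    using k by (intro holomorphic_on_mult holomorphic_on_const)
  have h2: "(\<lambda>z. complex_of_real (1 - v) * ?l z) holomorphic_on slit"
    using l by (intro holomorphic_on_mult holomorphic_on_const)
  have Ru: "R *\<^sub>v u \<in> carrier_vec n" using u by simp
  show "?a \<in> carrier_vec n" "?b \<in> carrier_vec n" using u by auto
  have "A *\<^sub>v ?a = R *\<^sub>v (R *\<^sub>v ?a)" by (rule R_vec(1)[symmetric]) (use u in simp)
  then show "A *\<^sub>v ?a = mean_op (hkern v) A B *\<^sub>v u" using u by (simp add: R_vec mean_op_vec)
  have "matfun (hkern v) T *\<^sub>v (R *\<^sub>v u) = matfun (\<lambda>z. z * ?l z) T *\<^sub>v (R *\<^sub>v u)"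
  proof -
    have "hkern v = (\<lambda>z. z * ?l z)" by (simp add: hkern_def fun_eq_iff)
    then show ?thesis by (simp only:)
  qed
  also have "\<dots> = T *\<^sub>v (matfun ?l T *\<^sub>v (R *\<^sub>v u))"
    using matfun_mult_vec[OF T_spec _ l Ru, of "\<lambda>z. z"] matfun_id[OF T_spec] by simp
  finally show "B *\<^sub>v ?b = mean_op (hkern v) A B *\<^sub>v u" using u by (simp add: mean_op_vec R_T_vec)
  have "complex_of_real v \<cdot>\<^sub>v ?a + complex_of_real (1 - v) \<cdot>\<^sub>v ?b
    = R' *\<^sub>v (complex_of_real v \<cdot>\<^sub>v (matfun (hkern v) T *\<^sub>v (R *\<^sub>v u)) + complex_of_real (1 - v) \<cdot>\<^sub>v (matfun ?l T *\<^sub>v (R *\<^sub>v u)))"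
    using u by (simp add: mv_add[where n=n] mv_smult[where n=n])
  also have "complex_of_real v \<cdot>\<^sub>v (matfun (hkern v) T *\<^sub>v (R *\<^sub>v u)) + complex_of_real (1 - v) \<cdot>\<^sub>v (matfun ?l T *\<^sub>v (R *\<^sub>v u))
    = matfun (\<lambda>z. complex_of_real v * hkern v z + complex_of_real (1 - v) * ?l z) T *\<^sub>v (R *\<^sub>v u)"
    by (simp only: matfun_add_vec[OF T_spec h1 h2 Ru] matfun_smult_vec[OF T_spec k Ru] matfun_smult_vec[OF T_spec l Ru])
  also have "matfun (\<lambda>z. complex_of_real v * hkern v z + complex_of_real (1 - v) * ?l z) T = matfun (\<lambda>_. 1) T"
  proof (rule matfun_cong[OF T_spec])
    fix z :: complex assume "z \<in> slit"
    then have "complex_of_real v * z + complex_of_real (1 - v) \<noteq> 0" using v by (rule hkern_denominator)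
    then show "complex_of_real v * hkern v z + complex_of_real (1 - v) * ?l z = 1"
      unfolding hkern_def by (simp add: add_divide_distrib[symmetric] del: of_real_diff)
  qed auto
  also have "R' *\<^sub>v (matfun (\<lambda>_. 1) T *\<^sub>v (R *\<^sub>v u)) = u"
    using u by (simp add: matfun_const_vec[OF T_spec Ru] R_vec)
  finally show "complex_of_real v \<cdot>\<^sub>v ?a + complex_of_real (1 - v) \<cdot>\<^sub>v ?b = u" .
qed

lemma mean_op_tendsto:
  assumes g: "\<And>N. g N holomorphic_on slit" and f: "f holomorphic_on slit"
    and lim: "\<And>K. compact K \<Longrightarrow> K \<subseteq> slit \<Longrightarrow> uniform_limit K g f sequentially"
    and x: "x \<in> carrier_vec n"
  shows "(\<lambda>N. Re (qform (mean_op (g N) A B) x)) \<longlonglongrightarrow> Re (qform (mean_op f A B) x)"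
  unfolding qform_def mean_op_cip[OF x x]
  using x by (intro tendsto_Re matfun_tendsto[OF T_spec g f lim] mult_mat_vec_carrier[OF mat_adjoint_carrier[OF R_carrier(1)]]) auto

lemma mean_op_sum:
  fixes N :: nat
  assumes v: "\<forall>j\<le>N. 0 \<le> v j \<and> v j \<le> 1" and x: "x \<in> carrier_vec n"
  shows "Re (qform (mean_op (\<lambda>z. \<Sum>j\<le>N. complex_of_real (w j) * hkern (v j) z) A B) x)
    = (\<Sum>j\<le>N. w j * Re (qform (mean_op (hkern (v j)) A B) x))"
proof -
  have "mat_adjoint R *\<^sub>v x \<in> carrier_vec n" using x by (intro mult_mat_vec_carrier[OF mat_adjoint_carrier[OF R_carrier(1)]])
  then show ?thesis
    unfolding qform_def mean_op_cip[OF x x]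
    using v x by (subst matfun_sum_cip[OF T_spec hkern_holomorphic]) auto
qed

end

section \<open>Variational comparison of harmonic means in a sector\<close>

lemma Re_qform_diff:
  assumes P: "hermitian_mat P" "P \<in> carrier_mat n n" and a: "a \<in> carrier_vec n" and c: "c \<in> carrier_vec n"
  shows "Re (qform P (a - c)) = Re (qform P a) - 2 * Re ((P *\<^sub>v c) \<bullet>c a) + Re (qform P c)"
proof -
  have v: "P *\<^sub>v a \<in> carrier_vec n" "P *\<^sub>v c \<in> carrier_vec n" using mult_mat_vec_carrier[OF P(2)] a c by auto
  have "(P *\<^sub>v a) \<bullet>c c = cnj ((P *\<^sub>v c) \<bullet>c a)"
    using hermitian_cip[OF P a c] cip_commute[OF a v(2)] by simp
  then show ?thesis using P a c v by (simp add: qform_def cip_simps[where n=n])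
qed

text \<open>For positive definite matrices the form of the harmonic mean at u is the minimum of the
  weighted energies over all splittings of u. Expanding the energy of the deviation from the optimal
  splitting, the cross terms combine to the pairing of w with u because P a0 = Q b0 = w.\<close>

lemma parallel_min:
  assumes P: "hermitian_mat P" "accretive n P" and Q: "hermitian_mat Q" "accretive n Q" and v: "0 \<le> v" "v \<le> 1"
    and car: "a0 \<in> carrier_vec n" "b0 \<in> carrier_vec n" "a \<in> carrier_vec n" "b \<in> carrier_vec n" "w \<in> carrier_vec n"
    and u: "complex_of_real v \<cdot>\<^sub>v a0 + complex_of_real (1 - v) \<cdot>\<^sub>v b0 = u" "P *\<^sub>v a0 = w" "Q *\<^sub>v b0 = w"
    and u': "complex_of_real v \<cdot>\<^sub>v a + complex_of_real (1 - v) \<cdot>\<^sub>v b = u"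
  shows "Re (w \<bullet>c u) \<le> v * Re (qform P a) + (1 - v) * Re (qform Q b)"
proof -
  have Pc: "P \<in> carrier_mat n n" "Q \<in> carrier_mat n n" using P Q by (auto simp: accretive_def)
  have wu: "Re (w \<bullet>c u) = v * Re (w \<bullet>c x) + (1 - v) * Re (w \<bullet>c y)"
    if "complex_of_real v \<cdot>\<^sub>v x + complex_of_real (1 - v) \<cdot>\<^sub>v y = u" "x \<in> carrier_vec n" "y \<in> carrier_vec n" for x y
    unfolding that(1)[symmetric] using that(2,3) car by (simp add: cip_simps[where n=n])
  have "0 \<le> v * Re (qform P (a - a0)) + (1 - v) * Re (qform Q (b - b0))"
    using v accretive_nonneg[OF P(2)] accretive_nonneg[OF Q(2)] car by simp
  also have "\<dots> = v * Re (qform P a) + (1 - v) * Re (qform Q b)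
      - 2 * (v * Re (w \<bullet>c a) + (1 - v) * Re (w \<bullet>c b)) + (v * Re (w \<bullet>c a0) + (1 - v) * Re (w \<bullet>c b0))"
  proof -
    have e1: "Re (qform P (a - a0)) = Re (qform P a) - 2 * Re (w \<bullet>c a) + Re (w \<bullet>c a0)"
      using Re_qform_diff[OF P(1) Pc(1) car(3,1)] u by (simp add: qform_def[of P a0])
    have e2: "Re (qform Q (b - b0)) = Re (qform Q b) - 2 * Re (w \<bullet>c b) + Re (w \<bullet>c b0)"
      using Re_qform_diff[OF Q(1) Pc(2) car(4,2)] u by (simp add: qform_def[of Q b0])
    show ?thesis unfolding e1 e2 by (simp add: algebra_simps)
  qed
  also have "\<dots> = v * Re (qform P a) + (1 - v) * Re (qform Q b) - Re (w \<bullet>c u)"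
    using wu[OF u' car(3,4)] wu[OF u(1) car(1,2)] by simp
  finally show ?thesis by simp
qed

lemma mat_re_cip:
  assumes A: "A \<in> carrier_mat n n" and x: "x \<in> carrier_vec n" and y: "y \<in> carrier_vec n"
  shows "(mat_re A *\<^sub>v x) \<bullet>c y = ((A *\<^sub>v x) \<bullet>c y + cnj ((A *\<^sub>v y) \<bullet>c x)) / 2"
proof -
  have Aa: "mat_adjoint A \<in> carrier_mat n n" using A by simp
  have v: "A *\<^sub>v x \<in> carrier_vec n" "A *\<^sub>v y \<in> carrier_vec n" "mat_adjoint A *\<^sub>v x \<in> carrier_vec n"
    using mult_mat_vec_carrier[OF A] mult_mat_vec_carrier[OF Aa] x y by auto
  have "(mat_adjoint A *\<^sub>v x) \<bullet>c y = cnj (y \<bullet>c (mat_adjoint A *\<^sub>v x))" by (rule cip_commute[OF v(3) y])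
  also have "\<dots> = cnj ((A *\<^sub>v y) \<bullet>c x)" using cip_adjoint[OF A y x] by simp
  finally have adj: "(mat_adjoint A *\<^sub>v x) \<bullet>c y = cnj ((A *\<^sub>v y) \<bullet>c x)" .
  have "mat_re A *\<^sub>v x = (1/2) \<cdot>\<^sub>v (A *\<^sub>v x + mat_adjoint A *\<^sub>v x)"
    unfolding mat_re_def using A Aa x by (simp add: mat_smult_vec[where n=n] mat_add_vec[where n=n])
  then show ?thesis using v y adj by (simp add: cip_simps[where n=n])
qed

lemma qform_mat_re_Re: "A \<in> carrier_mat n n \<Longrightarrow> x \<in> carrier_vec n \<Longrightarrow> Re (qform (mat_re A) x) = Re (qform A x)"
  by (simp add: qform_mat_re)

lemma accretive_mat_re: "accretive n A \<Longrightarrow> accretive n (mat_re A)"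
  unfolding accretive_def by (auto simp: qform_mat_re_Re[where n=n])

text \<open>With P the Hermitian part of A, this says that the inverse of P is at most 1 + t^2 times
  the Hermitian part of the inverse of A, tested at w = A a = P p. For t = tan \<theta> the factor
  is sec^2 \<theta>.\<close>

lemma sector_dual_bound:
  assumes A: "accretive n A" and t: "0 \<le> t"
    and sec: "\<And>x. x \<in> carrier_vec n \<Longrightarrow> \<bar>Im (qform A x)\<bar> \<le> Re (qform A x) * t"
    and a: "a \<in> carrier_vec n" and p: "p \<in> carrier_vec n" and eq: "mat_re A *\<^sub>v p = A *\<^sub>v a"
  shows "Re (qform (mat_re A) p) \<le> (1 + t\<^sup>2) * Re (qform A a)"
proof -
  have Ac: "A \<in> carrier_mat n n" using A by (simp add: accretive_def)
  let ?P = "mat_re A"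
  have Pc: "?P \<in> carrier_mat n n" and Ph: "hermitian_mat ?P" using Ac hermitian_mat_re by auto
  define d where "d = p - a"
  have d: "d \<in> carrier_vec n" using a p by (simp add: d_def)
  have v: "A *\<^sub>v x \<in> carrier_vec n" "?P *\<^sub>v x \<in> carrier_vec n" if "x \<in> carrier_vec n" for x
    using mult_mat_vec_carrier[OF Ac that] mult_mat_vec_carrier[OF Pc that] .
  have Pd: "?P *\<^sub>v d = A *\<^sub>v a - ?P *\<^sub>v a" using p a eq by (simp add: d_def mv_minus[OF Pc])
  define qa where "qa = Re (qform A a)"
  define qd where "qd = Re (qform A d)"
  have Ad: "(A *\<^sub>v a) \<bullet>c d = (?P *\<^sub>v a) \<bullet>c d + complex_of_real qd"
  proof -
    have "(?P *\<^sub>v d) \<bullet>c d = complex_of_real qd" using qform_mat_re[OF Ac d] by (simp add: qform_def qd_def)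
    then show ?thesis unfolding Pd using v[OF a] d by (simp add: cip_simps[where n=n] algebra_simps)
  qed
  have Da: "(A *\<^sub>v d) \<bullet>c a = cnj ((?P *\<^sub>v a) \<bullet>c d) - complex_of_real qd"
  proof -
    have 1: "(?P *\<^sub>v a) \<bullet>c d = ((A *\<^sub>v a) \<bullet>c d + cnj ((A *\<^sub>v d) \<bullet>c a)) / 2" by (rule mat_re_cip[OF Ac a d])
    then have "cnj ((A *\<^sub>v d) \<bullet>c a) = (?P *\<^sub>v a) \<bullet>c d - complex_of_real qd"
      unfolding Ad by (simp add: complex_eq_iff field_simps)
    then have "cnj (cnj ((A *\<^sub>v d) \<bullet>c a)) = cnj ((?P *\<^sub>v a) \<bullet>c d - complex_of_real qd)" by (rule arg_cong)
    then show ?thesis by simp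
  qed
  \<comment> \<open>The cross term between a and d vanishes: P d = A a - P a, and its pairing with a
    is purely imaginary.\<close>
  have qp: "Re (qform ?P p) = qa + qd"
  proof -
    have e: "p - d = a" unfolding d_def using p a by (intro eq_vecI) auto
    have "Re (qform ?P (p - d)) = Re (qform ?P p) - 2 * Re ((?P *\<^sub>v d) \<bullet>c p) + Re (qform ?P d)"
      by (rule Re_qform_diff[OF Ph Pc p d])
    moreover have "p = a + d" unfolding d_def using p a by (intro eq_vecI) auto
    then have "(?P *\<^sub>v d) \<bullet>c p = (A *\<^sub>v a) \<bullet>c a - (?P *\<^sub>v a) \<bullet>c a + (?P *\<^sub>v d) \<bullet>c d"
      using Pd v a d by (simp add: cip_simps[where n=n])
    then have "Re ((?P *\<^sub>v d) \<bullet>c p) = Re (qform A a) - Re (qform ?P a) + Re (qform ?P d)" by (simp add: qform_def)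
    ultimately show ?thesis unfolding e using qform_mat_re_Re[OF Ac a] qform_mat_re_Re[OF Ac d]
      by (simp add: qa_def qd_def)
  qed
  \<comment> \<open>The sector condition is applied to a + i l d and a - i l d. Adding the two
    estimates cancels the mixed term with the imaginary part of the pairing of P a with d.\<close>
  have main: "2 * l * qd \<le> t * (qa + l\<^sup>2 * qd)" for l :: real
  proof -
    have ex: "qform A (a + (\<i> * complex_of_real m) \<cdot>\<^sub>v d) = qform A a + complex_of_real (m\<^sup>2) * qform A d
        - \<i> * complex_of_real m * ((A *\<^sub>v a) \<bullet>c d) + \<i> * complex_of_real m * ((A *\<^sub>v d) \<bullet>c a)" for m
      using a d v Ac by (simp add: qform_def cip_simps[where n=n] mv_add[where n=n] mv_smult[where n=n] algebra_simps power2_eq_square)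
    have ex': "qform A (a + (\<i> * complex_of_real m) \<cdot>\<^sub>v d) = qform A a + complex_of_real (m\<^sup>2) * qform A d
        + complex_of_real (2 * m * Im ((?P *\<^sub>v a) \<bullet>c d)) - \<i> * complex_of_real (2 * m * qd)" for m
      unfolding ex Ad Da by (simp add: complex_eq_iff algebra_simps)
    have c: "a + (\<i> * complex_of_real m) \<cdot>\<^sub>v d \<in> carrier_vec n" for m using a d by simp
    have 1: "\<bar>Im (qform A a) + l\<^sup>2 * Im (qform A d) - 2 * l * qd\<bar> \<le> (qa + l\<^sup>2 * qd + 2 * l * Im ((?P *\<^sub>v a) \<bullet>c d)) * t"
      using sec[OF c[of l]] unfolding ex' by (simp add: qa_def qd_def)
    have 2: "\<bar>Im (qform A a) + l\<^sup>2 * Im (qform A d) + 2 * l * qd\<bar> \<le> (qa + l\<^sup>2 * qd - 2 * l * Im ((?P *\<^sub>v a) \<bullet>c d)) * t"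
      using sec[OF c[of "- l"]] unfolding ex' by (simp add: qa_def qd_def)
    have "2 * (2 * l * qd) \<le> (qa + l\<^sup>2 * qd + 2 * l * Im ((?P *\<^sub>v a) \<bullet>c d)) * t + (qa + l\<^sup>2 * qd - 2 * l * Im ((?P *\<^sub>v a) \<bullet>c d)) * t"
      using abs_le_D1[OF 2] abs_le_D2[OF 1] by linarith
    then show ?thesis by (simp add: algebra_simps)
  qed
  have "qd \<le> t\<^sup>2 * qa"
  proof (cases "t = 0")
    case True
    then show ?thesis using main[of 1] by simp
  next
    case False
    \<comment> \<open>The choice l = 1/t gives the strongest of these inequalities and reads qd
      \<le> t^2 qa.\<close>
    then have "2 * (1 / t) * qd \<le> t * (qa + (1 / t)\<^sup>2 * qd)" using main by blast
    then have "2 * (1 / t) * qd * t \<le> t * (qa + (1 / t)\<^sup>2 * qd) * t" using t by (intro mult_right_mono)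
    then show ?thesis using False by (simp add: power2_eq_square algebra_simps)
  qed
  then show ?thesis unfolding qp by (simp add: qa_def algebra_simps)
qed

lemma accretive_solve:
  assumes P: "hermitian_mat P" "accretive n P" and w: "w \<in> carrier_vec n"
  obtains p where "p \<in> carrier_vec n" "P *\<^sub>v p = w"
proof -
  interpret herm n P using P by unfold_locales (auto simp: accretive_def)
  have pos: "Re \<mu> > 0" if "\<mu> \<in> eigs P" for \<mu> using eigs_bounds(3)[OF that] P by (auto simp: accretive_def)
  have "P *\<^sub>v (rfun inverse *\<^sub>v w) = rfun (\<lambda>t. t * inverse t) *\<^sub>v w"
    using rfun_mult_vec[OF w, of "\<lambda>t. t" inverse] by (simp add: rfun_id)
  also have "rfun (\<lambda>t. t * inverse t) = rfun (\<lambda>_. 1)"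
  proof (rule rfun_cong)
    fix \<mu> assume "\<mu> \<in> eigs P"
    then show "Re \<mu> * inverse (Re \<mu>) = 1" using pos[of \<mu>] by simp
  qed
  finally have "P *\<^sub>v (rfun inverse *\<^sub>v w) = w" using rfun_one_vec[OF w] by simp
  then show ?thesis using that[of "rfun inverse *\<^sub>v w"] w by simp
qed

locale sector_pair = accretive_pair +
  fixes t :: real
  assumes t: "0 \<le> t"
    and secA: "\<And>x. x \<in> carrier_vec n \<Longrightarrow> \<bar>Im (qform A x)\<bar> \<le> Re (qform A x) * t"
    and secB: "\<And>x. x \<in> carrier_vec n \<Longrightarrow> \<bar>Im (qform B x)\<bar> \<le> Re (qform B x) * t"
begin

abbreviation "P \<equiv> mat_re A"
abbreviation "Q \<equiv> mat_re B"

lemma herm_PQ: "hermitian_mat P" "hermitian_mat Q" 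
  by (rule hermitian_mat_re[OF carrA], rule hermitian_mat_re[OF carrB])

lemma acc_PQ: "accretive n P" "accretive n Q" using accretive_mat_re accA accB by auto

sublocale re: accretive_pair n P Q by unfold_locales (rule acc_PQ)+

text \<open>For the lower bound, the splitting belonging to A and B competes in the minimum for
  their Hermitian parts. For the upper bound, the optimal vectors a0, b0 are compared with multiples
  of the preimages p, q of w under P and Q, whose energies \<open>sector_dual_bound\<close>
  controls.\<close>

lemma hkern_compare:
  assumes v: "0 \<le> v" "v \<le> 1" and u: "u \<in> carrier_vec n"
  shows "Re (qform (mean_op (hkern v) P Q) u) \<le> Re (qform (mean_op (hkern v) A B) u)"
    "Re (qform (mean_op (hkern v) A B) u) \<le> (1 + t\<^sup>2) * Re (qform (mean_op (hkern v) P Q) u)"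
proof -
  let ?w = "mean_op (hkern v) A B *\<^sub>v u" and ?wr = "mean_op (hkern v) P Q *\<^sub>v u"
  have w: "?w \<in> carrier_vec n" "?wr \<in> carrier_vec n"
    using mult_mat_vec_carrier[OF mean_op_carrier u] mult_mat_vec_carrier[OF re.mean_op_carrier u] by auto
  obtain a b where ab: "a \<in> carrier_vec n" "b \<in> carrier_vec n"
    "complex_of_real v \<cdot>\<^sub>v a + complex_of_real (1 - v) \<cdot>\<^sub>v b = u" "A *\<^sub>v a = ?w" "B *\<^sub>v b = ?w"
    using mean_hkern[OF v u] .
  obtain a0 b0 where ab0: "a0 \<in> carrier_vec n" "b0 \<in> carrier_vec n"
    "complex_of_real v \<cdot>\<^sub>v a0 + complex_of_real (1 - v) \<cdot>\<^sub>v b0 = u" "P *\<^sub>v a0 = ?wr" "Q *\<^sub>v b0 = ?wr"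
    using re.mean_hkern[OF v u] .
  have xu: "Re (x \<bullet>c u) = v * Re (x \<bullet>c y) + (1 - v) * Re (x \<bullet>c z)"
    if "complex_of_real v \<cdot>\<^sub>v y + complex_of_real (1 - v) \<cdot>\<^sub>v z = u" "x \<in> carrier_vec n" "y \<in> carrier_vec n" "z \<in> carrier_vec n" for x y z
    unfolding that(1)[symmetric] using that(2,3,4) by (simp add: cip_simps[where n=n])
  have \<rho>: "Re (qform (mean_op (hkern v) A B) u) = v * Re (qform A a) + (1 - v) * Re (qform B b)"
    unfolding qform_def ab(4,5) using xu[OF ab(3) w(1) ab(1,2)] .
  have \<rho>0: "Re (qform (mean_op (hkern v) P Q) u) = v * Re (qform P a0) + (1 - v) * Re (qform Q b0)"
    unfolding qform_def ab0(4,5) using xu[OF ab0(3) w(2) ab0(1,2)] .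
  have "Re (?wr \<bullet>c u) \<le> v * Re (qform P a) + (1 - v) * Re (qform Q b)"
    by (rule parallel_min[OF herm_PQ(1) acc_PQ(1) herm_PQ(2) acc_PQ(2) v ab0(1,2) ab(1,2) w(2) ab0(3,4,5) ab(3)])
  then show "Re (qform (mean_op (hkern v) P Q) u) \<le> Re (qform (mean_op (hkern v) A B) u)"
    unfolding \<rho> using ab by (simp add: qform_mat_re_Re[OF carrA] qform_mat_re_Re[OF carrB] qform_def[of "mean_op (hkern v) P Q"])
  obtain p where p: "p \<in> carrier_vec n" "P *\<^sub>v p = ?w" using accretive_solve[OF herm_PQ(1) acc_PQ(1) w(1)] .
  obtain q where q: "q \<in> carrier_vec n" "Q *\<^sub>v q = ?w" using accretive_solve[OF herm_PQ(2) acc_PQ(2) w(1)] .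
  have pb: "Re (qform P p) \<le> (1 + t\<^sup>2) * Re (qform A a)"
    using sector_dual_bound[OF accA t secA ab(1) p(1)] p(2) ab(4) by simp
  have qb: "Re (qform Q q) \<le> (1 + t\<^sup>2) * Re (qform B b)"
    using sector_dual_bound[OF accB t secB ab(2) q(1)] q(2) ab(5) by simp
  \<comment> \<open>The value of \<tau> minimising -2 \<tau> + \<tau>^2 (1 + t^2), namely cos^2
    \<theta> when t = tan \<theta>; the minimum is -\<tau>.\<close>
  define \<tau> where "\<tau> = 1 / (1 + t\<^sup>2)"
  have t1: "1 + t\<^sup>2 > 0" by (simp add: add_pos_nonneg)
  have \<tau>: "\<tau> \<ge> 0" "\<tau> * (1 + t\<^sup>2) = 1" using t1 by (auto simp: \<tau>_def)
  let ?p = "complex_of_real \<tau> \<cdot>\<^sub>v p" and ?q = "complex_of_real \<tau> \<cdot>\<^sub>v q"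
  have PQc: "P \<in> carrier_mat n n" "Q \<in> carrier_mat n n" using re.carrA re.carrB .
  have "0 \<le> v * Re (qform P (a0 - ?p)) + (1 - v) * Re (qform Q (b0 - ?q))"
    using v accretive_nonneg[OF acc_PQ(1)] accretive_nonneg[OF acc_PQ(2)] ab0 p q by simp
  also have "\<dots> = v * Re (qform P a0) + (1 - v) * Re (qform Q b0) - 2 * \<tau> * (v * Re (?w \<bullet>c a0) + (1 - v) * Re (?w \<bullet>c b0))
     + \<tau>\<^sup>2 * (v * Re (qform P p) + (1 - v) * Re (qform Q q))"
  proof -
    have gen: "Re (qform S (c - complex_of_real \<tau> \<cdot>\<^sub>v r)) = Re (qform S c) - 2 * \<tau> * Re (?w \<bullet>c c) + \<tau>\<^sup>2 * Re (qform S r)"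
      if S: "hermitian_mat S" "S \<in> carrier_mat n n" and c: "c \<in> carrier_vec n" and r: "r \<in> carrier_vec n" "S *\<^sub>v r = ?w" for S c r
    proof -
      have Sr: "S *\<^sub>v (complex_of_real \<tau> \<cdot>\<^sub>v r) = complex_of_real \<tau> \<cdot>\<^sub>v ?w" using mv_smult[OF S(2) r(1)] r(2) by simp
      have 1: "Re ((S *\<^sub>v (complex_of_real \<tau> \<cdot>\<^sub>v r)) \<bullet>c c) = \<tau> * Re (?w \<bullet>c c)"
        unfolding Sr using cip_smult_left[OF w(1) c] by simp
      have 2: "Re (qform S (complex_of_real \<tau> \<cdot>\<^sub>v r)) = \<tau>\<^sup>2 * Re (qform S r)"
        unfolding qform_def Sr r(2) using w(1) r(1) by (simp add: cip_simps[where n=n] power2_eq_square)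
      show ?thesis using Re_qform_diff[OF S c, of "complex_of_real \<tau> \<cdot>\<^sub>v r"] r(1) unfolding 1 2 by simp
    qed
    show ?thesis unfolding gen[OF herm_PQ(1) PQc(1) ab0(1) p] gen[OF herm_PQ(2) PQc(2) ab0(2) q]
      by (simp add: algebra_simps)
  qed
  also have "v * Re (?w \<bullet>c a0) + (1 - v) * Re (?w \<bullet>c b0) = Re (qform (mean_op (hkern v) A B) u)"
    unfolding qform_def using xu[OF ab0(3) w(1) ab0(1,2)] by simp
  also have "v * Re (qform P a0) + (1 - v) * Re (qform Q b0) - 2 * \<tau> * Re (qform (mean_op (hkern v) A B) u) + \<tau>\<^sup>2 * (v * Re (qform P p) + (1 - v) * Re (qform Q q))
     \<le> v * Re (qform P a0) + (1 - v) * Re (qform Q b0) - 2 * \<tau> * Re (qform (mean_op (hkern v) A B) u) + \<tau>\<^sup>2 * ((1 + t\<^sup>2) * Re (qform (mean_op (hkern v) A B) u))"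
  proof -
    have "v * Re (qform P p) + (1 - v) * Re (qform Q q) \<le> v * ((1 + t\<^sup>2) * Re (qform A a)) + (1 - v) * ((1 + t\<^sup>2) * Re (qform B b))"
      using pb qb v by (intro add_mono mult_left_mono) auto
    also have "\<dots> = (1 + t\<^sup>2) * Re (qform (mean_op (hkern v) A B) u)" unfolding \<rho> by (simp add: algebra_simps)
    finally show ?thesis by (intro add_left_mono mult_left_mono) auto
  qed
  also have "\<tau>\<^sup>2 * ((1 + t\<^sup>2) * Re (qform (mean_op (hkern v) A B) u)) = \<tau> * Re (qform (mean_op (hkern v) A B) u)"
    using \<tau>(2) by (metis mult.assoc mult.left_commute mult_1 power2_eq_square)
  finally have "\<tau> * Re (qform (mean_op (hkern v) A B) u) \<le> Re (qform (mean_op (hkern v) P Q) u)"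
    unfolding \<rho>0 by simp
  then have "(1 + t\<^sup>2) * (\<tau> * Re (qform (mean_op (hkern v) A B) u)) \<le> (1 + t\<^sup>2) * Re (qform (mean_op (hkern v) P Q) u)"
    using t1 by (intro mult_left_mono) auto
  then show "Re (qform (mean_op (hkern v) A B) u) \<le> (1 + t\<^sup>2) * Re (qform (mean_op (hkern v) P Q) u)"
    using \<tau>(2) by (metis mult.assoc mult.commute mult_1)
qed

lemma mean_compare:
  assumes f: "hkern_limit f" "f holomorphic_on slit" and u: "u \<in> carrier_vec n"
  shows "Re (qform (mean_op f P Q) u) \<le> Re (qform (mean_op f A B) u)"
    "Re (qform (mean_op f A B) u) \<le> (1 + t\<^sup>2) * Re (qform (mean_op f P Q) u)"
proof -
  obtain g where g: "\<And>N. hkern_comb (g N)" and lim: "\<And>K. compact K \<Longrightarrow> K \<subseteq> slit \<Longrightarrow> uniform_limit K g f sequentially"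
    using f(1) unfolding hkern_limit_def by auto
  note hol = hkern_comb_holomorphic[OF g]
  have cmp: "Re (qform (mean_op h P Q) u) \<le> Re (qform (mean_op h A B) u) \<and>
    Re (qform (mean_op h A B) u) \<le> (1 + t\<^sup>2) * Re (qform (mean_op h P Q) u)" if "hkern_comb h" for h
  proof -
    from that obtain N :: nat and w v where wv: "\<forall>j\<le>N. 0 \<le> w j \<and> 0 \<le> v j \<and> v j \<le> 1"
      and h: "h = (\<lambda>z. \<Sum>j\<le>N. complex_of_real (w j) * hkern (v j) z)" unfolding hkern_comb_def by auto
    have v: "\<forall>j\<le>N. 0 \<le> v j \<and> v j \<le> 1" using wv by auto
    show ?thesis unfolding h mean_op_sum[OF v u] re.mean_op_sum[OF v u] sum_distrib_left
      using hkern_compare[OF _ _ u] wv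
      by (auto intro!: sum_mono mult_left_mono simp: mult.left_commute[of "1 + t\<^sup>2"])
  qed
  show "Re (qform (mean_op f P Q) u) \<le> Re (qform (mean_op f A B) u)"
    by (rule LIMSEQ_le[OF re.mean_op_tendsto[OF hol f(2) lim u] mean_op_tendsto[OF hol f(2) lim u]]) (use cmp[OF g] in auto)
  show "Re (qform (mean_op f A B) u) \<le> (1 + t\<^sup>2) * Re (qform (mean_op f P Q) u)"
    by (rule LIMSEQ_le[OF mean_op_tendsto[OF hol f(2) lim u] tendsto_mult_left[OF re.mean_op_tendsto[OF hol f(2) lim u]]]) (use cmp[OF g] in auto)
qed

end

section \<open>Means of positive definite matrices\<close>

text \<open>The weighted harmonic mean of 1 and t is below the arithmetic one; after clearing
  denominators the gap is v (1-v) (t-1)^2.\<close>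

lemma Re_hkern_of_real:
  assumes "t > 0" "0 \<le> v" "v \<le> 1"
  shows "Re (hkern v (complex_of_real t)) \<le> v + (1 - v) * t"
proof -
  have den: "v * t + (1 - v) > 0"
  proof (cases "v = 1")
    case False
    then show ?thesis using assms by (intro add_nonneg_pos) auto
  qed (use assms in auto)
  have "hkern v (complex_of_real t) = complex_of_real (t / (v * t + (1 - v)))"
    by (simp add: hkern_def)
  then have "Re (hkern v (complex_of_real t)) = t / (v * t + (1 - v))" by simp
  also have "\<dots> \<le> v + (1 - v) * t"
  proof -
    have "(v + (1 - v) * t) * (v * t + (1 - v)) - t = v * (1 - v) * (t - 1)\<^sup>2"
      by (simp add: power2_eq_square algebra_simps)
    moreover have "0 \<le> v * (1 - v) * (t - 1)\<^sup>2" using assms by simp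
    ultimately have "t \<le> (v + (1 - v) * t) * (v * t + (1 - v))" by linarith
    then show ?thesis using den by (simp only: pos_divide_le_eq)
  qed
  finally show ?thesis .
qed

text \<open>Each approximant lies below its own tangent at 1, with slope the average of 1 - v in
  [0,1]. A subsequence of the slopes converges by compactness, and its limit is s.\<close>

lemma hkern_limit_tangent:
  assumes "hkern_limit f"
  obtains s where "0 \<le> s" "s \<le> 1" "\<And>t. t > 0 \<Longrightarrow> Re (f (complex_of_real t)) \<le> (1 - s) + s * t"
proof -
  obtain g where g: "\<And>N. hkern_comb (g N)" and lim: "\<And>K. compact K \<Longrightarrow> K \<subseteq> slit \<Longrightarrow> uniform_limit K g f sequentially"
    using assms unfolding hkern_limit_def by auto
  have "\<exists>s\<in>{0..1}. \<forall>t>0. Re (g N (complex_of_real t)) \<le> (1 - s) + s * t" for N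
  proof -
    from g[of N] obtain k :: nat and w v where wv: "\<forall>j\<le>k. 0 \<le> w j \<and> 0 \<le> v j \<and> v j \<le> 1" and sum1: "(\<Sum>j\<le>k. w j) = 1"
      and h: "g N = (\<lambda>z. \<Sum>j\<le>k. complex_of_real (w j) * hkern (v j) z)" unfolding hkern_comb_def by auto
    define s where "s = (\<Sum>j\<le>k. w j * (1 - v j))"
    have "0 \<le> s" unfolding s_def using wv by (intro sum_nonneg) auto
    moreover have "s \<le> (\<Sum>j\<le>k. w j)" unfolding s_def using wv by (intro sum_mono mult_left_le) auto
    moreover have "Re (g N (complex_of_real t)) \<le> (1 - s) + s * t" if t: "t > 0" for t
    proof -
      have "Re (g N (complex_of_real t)) = (\<Sum>j\<le>k. w j * Re (hkern (v j) (complex_of_real t)))" unfolding h by simp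
      also have "\<dots> \<le> (\<Sum>j\<le>k. w j * (v j + (1 - v j) * t))"
        using wv t Re_hkern_of_real by (intro sum_mono mult_left_mono) auto
      also have "\<dots> = (\<Sum>j\<le>k. w j - w j * (1 - v j) + (w j * (1 - v j)) * t)" by (intro sum.cong) (auto simp: algebra_simps)
      also have "\<dots> = (1 - s) + s * t" by (simp only: sum.distrib sum_subtractf sum1 s_def sum_distrib_right)
      finally show ?thesis .
    qed
    ultimately show ?thesis using sum1 by (intro bexI[of _ s]) auto
  qed
  then obtain s where s: "\<And>N. s N \<in> {0..1}" "\<And>N t. t > 0 \<Longrightarrow> Re (g N (complex_of_real t)) \<le> (1 - s N) + s N * t"
    by metis
  obtain l r where l: "l \<in> {0..1::real}" and r: "strict_mono r" and sl: "(s \<circ> r) \<longlonglongrightarrow> l"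
    using compact_imp_seq_compact[OF compact_Icc, of 0 1] s(1) unfolding seq_compact_def by metis
  have "Re (f (complex_of_real t)) \<le> (1 - l) + l * t" if t: "t > 0" for t
  proof (rule LIMSEQ_le)
    have "complex_of_real t \<in> slit" using t by (intro half_plane_subset_slit) simp
    then have "uniform_limit {complex_of_real t} g f sequentially" by (intro lim) auto
    then have "(\<lambda>N. g N (complex_of_real t)) \<longlonglongrightarrow> f (complex_of_real t)" by (rule tendsto_uniform_limitI) simp
    from LIMSEQ_subseq_LIMSEQ[OF this r]
    show "(\<lambda>k. Re (g (r k) (complex_of_real t))) \<longlonglongrightarrow> Re (f (complex_of_real t))"
      by (intro tendsto_Re) (simp add: o_def)
    show "(\<lambda>k. (1 - s (r k)) + s (r k) * t) \<longlonglongrightarrow> (1 - l) + l * t"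
      using sl by (intro tendsto_intros) (auto simp: o_def)
  qed (use s(2)[OF t] in auto)
  then show ?thesis using that l by auto
qed

text \<open>The numbers \<open>D i j\<close> are the moments of the Beta distribution with
  parameters 1 - r and r. The binomial series of z^(r-1) around 1 has exactly the coefficients
  \<open>D n 0\<close> in powers of 1 - z.\<close>

lemma hkern_limit_powr:
  assumes r: "0 < r" "r < 1"
  shows "hkern_limit (\<lambda>z. z powr complex_of_real r)"
proof -
  define D where "D = (\<lambda>i j. pochhammer (1 - r) i * pochhammer r j / fact (i + j) :: real)"
  interpret hausdorff D
  proof
    show "0 \<le> D i j" for i j unfolding D_def using r by (intro divide_nonneg_nonneg mult_nonneg_nonneg pochhammer_nonneg) auto
    show "D 0 0 = 1" by (simp add: D_def)
    show "D i (Suc j) = D i j - D (Suc i) j" for i j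
    proof -
      let ?p = "pochhammer (1 - r) i * pochhammer r j" and ?k = "real (i + j) + 1"
      have k: "?k \<noteq> 0" by simp
      have fs: "fact (Suc (i + j)) = ?k * (fact (i + j) :: real)" by (simp add: algebra_simps)
      have "D i (Suc j) = ?p * (r + real j) / (?k * fact (i + j))"
        unfolding D_def add_Suc_right fs by (simp add: pochhammer_Suc mult.assoc)
      moreover have "D (Suc i) j = ?p * ((1 - r) + real i) / (?k * fact (i + j))"
        unfolding D_def add_Suc fs by (simp add: pochhammer_Suc mult_ac)
      moreover have "D i j = ?p * ?k / (?k * fact (i + j))"
        unfolding D_def using k by simp
      moreover have "?p * ?k - ?p * ((1 - r) + real i) = ?p * (r + real j)" by (simp add: algebra_simps)
      ultimately show ?thesis by (simp only: diff_divide_distrib[symmetric])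
    qed
  qed
  show ?thesis
  proof (rule hkern_limit_hausdorff)
    show "(\<lambda>z. z powr complex_of_real r) holomorphic_on slit" by (intro holomorphic_intros) auto
    fix z :: complex assume z: "z \<in> ball 1 1"
    have z0: "z \<noteq> 0" using z ball_subset_slit by auto
    let ?a = "complex_of_real (r - 1)"
    have "cmod (- (1 - z)) < 1" using z by (simp add: dist_norm norm_minus_commute)
    from gen_binomial_complex[OF this, of ?a]
    have "(\<lambda>n. (?a gchoose n) * (- (1 - z)) ^ n) sums (z powr ?a)" by simp
    moreover have "(?a gchoose n) * (- (1 - z)) ^ n = complex_of_real (D n 0) * (1 - z) ^ n" for n
    proof -
      have "pochhammer (- ?a) n = complex_of_real (pochhammer (1 - r) n)"
        by (simp add: pochhammer_of_real[symmetric])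
      then have "(?a gchoose n) = (- 1) ^ n * complex_of_real (D n 0)"
        unfolding gbinomial_pochhammer by (simp add: D_def)
      moreover have "(- (1 - z)) ^ n = (- 1) ^ n * (1 - z) ^ n" by (rule power_minus)
      moreover have "(- 1) ^ n * (- 1) ^ n = (1 :: complex)" by (simp flip: power_mult_distrib)
      ultimately show ?thesis by (metis (no_types, lifting) mult.assoc mult.commute mult_1)
    qed
    moreover have "z powr ?a = z powr complex_of_real r / z" using z0 by (simp add: powr_diff)
    ultimately show "(\<lambda>n. complex_of_real (D n 0) * (1 - z) ^ n) sums (z powr complex_of_real r / z)" by simp
  qed
qed

locale pd_pair = accretive_pair +
  assumes hermA: "hermitian_mat A" and hermB: "hermitian_mat B"
begin

sublocale hA: herm n A using hermA by unfold_locales auto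
sublocale hB: herm n B using hermB by unfold_locales auto

lemma eigs_pos: "\<mu> \<in> eigs A \<Longrightarrow> 0 < Re \<mu>" "\<mu> \<in> eigs B \<Longrightarrow> 0 < Re \<mu>"
  using hA.eigs_bounds(3)[of \<mu>] hB.eigs_bounds(3)[of \<mu>] accA accB unfolding accretive_def by blast+

lemma R_rfun: "R = hA.rfun sqrt" "R' = hA.rfun (\<lambda>t. inverse (sqrt t))"
  unfolding R_def R'_def using eigs_pos(1) csqrt_slit
  by (auto intro!: hA.matfun_eq_rfun[OF accretive_spec[OF accA]] simp: less_imp_le csqrt_of_real_nonneg)

lemma R_sym:
  assumes "x \<in> carrier_vec n" "y \<in> carrier_vec n"
  shows "(R *\<^sub>v x) \<bullet>c y = x \<bullet>c (R *\<^sub>v y)" "(R' *\<^sub>v x) \<bullet>c y = x \<bullet>c (R' *\<^sub>v y)"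
  unfolding R_rfun using assms by (simp_all add: hA.rfun_adjoint)

lemma T_qform: "x \<in> carrier_vec n \<Longrightarrow> qform T x = qform B (R' *\<^sub>v x)"
  using R_sym(2)[of "B *\<^sub>v (R' *\<^sub>v x)" x] by (simp add: qform_def T_vec)

lemma T_herm: "hermitian_mat T"
  using hermB by (simp add: hermitian_iff[OF R_carrier(3)] T_qform hermitian_iff[OF carrB])

sublocale hT: herm n T using T_herm by unfold_locales auto

lemma T_accretive: "accretive n T"
  unfolding accretive_def
proof (intro conjI ballI impI)
  fix x :: "complex vec" assume x: "x \<in> carrier_vec n" "x \<noteq> 0\<^sub>v n"
  then have "R' *\<^sub>v x \<noteq> 0\<^sub>v n" using R_vec(2)[OF x(1)] mv_zero[OF R_carrier(1)] by auto
  then show "0 < Re (qform T x)" using accB x by (simp add: T_qform accretive_def)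
qed simp

lemma T_eigs_pos: "\<mu> \<in> eigs T \<Longrightarrow> 0 < Re \<mu>"
  using hT.eigs_bounds(3)[of \<mu>] T_accretive unfolding accretive_def by blast

lemma mean_qform:
  assumes f: "f holomorphic_on slit" "\<And>t. t > 0 \<Longrightarrow> f (complex_of_real t) \<in> \<real>" and u: "u \<in> carrier_vec n"
  shows "matfun f T = hT.rfun (\<lambda>t. Re (f (complex_of_real t)))"
    "qform (mean_op f A B) u = qform (hT.rfun (\<lambda>t. Re (f (complex_of_real t)))) (R *\<^sub>v u)"
proof -
  show eq: "matfun f T = hT.rfun (\<lambda>t. Re (f (complex_of_real t)))"
    using f(2) T_eigs_pos by (intro hT.matfun_eq_rfun[OF T_spec f(1)]) (simp add: of_real_Re)
  show "qform (mean_op f A B) u = qform (hT.rfun (\<lambda>t. Re (f (complex_of_real t)))) (R *\<^sub>v u)"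
    unfolding qform_def using u by (simp add: mean_op_vec R_sym eq[symmetric])
qed

lemma mean_hermitian:
  assumes f: "f holomorphic_on slit" "\<And>t. t > 0 \<Longrightarrow> f (complex_of_real t) \<in> \<real>"
  shows "hermitian_mat (mean_op f A B)"
  by (simp add: hermitian_iff[OF mean_op_carrier] mean_qform[OF f] hT.rfun_qform)

lemma norm_R: "u \<in> carrier_vec n \<Longrightarrow> (R *\<^sub>v u) \<bullet>c (R *\<^sub>v u) = qform A u"
  by (simp add: R_sym(1)[of u] cip_commute[of "R *\<^sub>v u" n] qform_def R_sym(1)[symmetric] R_vec)

lemma mean_le_linear:
  assumes f: "f holomorphic_on slit" "\<And>t. t > 0 \<Longrightarrow> f (complex_of_real t) \<in> \<real>" and u: "u \<in> carrier_vec n"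
    and le: "\<And>t. t > 0 \<Longrightarrow> Re (f (complex_of_real t)) \<le> \<alpha> + \<beta> * t"
  shows "Re (qform (mean_op f A B) u) \<le> \<alpha> * Re (qform A u) + \<beta> * Re (qform B u)"
proof -
  have Ru: "R *\<^sub>v u \<in> carrier_vec n" using u by simp
  have eq: "qform (mean_op f A B) u = qform (hT.rfun (\<lambda>t. Re (f (complex_of_real t)))) (R *\<^sub>v u)"
    using f u by (rule mean_qform(2))
  have "Re (qform (mean_op f A B) u) \<le> Re (qform (hT.rfun (\<lambda>t. \<alpha> * 1 + \<beta> * t)) (R *\<^sub>v u))"
    unfolding eq using le T_eigs_pos by (intro hT.rfun_mono[OF Ru]) auto
  also have "\<dots> = \<alpha> * Re (qform (hT.rfun (\<lambda>_. 1)) (R *\<^sub>v u)) + \<beta> * Re (qform (hT.rfun (\<lambda>t. t)) (R *\<^sub>v u))"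
    by (rule hT.rfun_linear_qform[OF Ru])
  also have "qform (hT.rfun (\<lambda>_. 1)) (R *\<^sub>v u) = qform A u"
    unfolding qform_def[of "hT.rfun (\<lambda>_. 1)"] hT.rfun_one_vec[OF Ru] by (rule norm_R[OF u])
  also have "qform (hT.rfun (\<lambda>t. t)) (R *\<^sub>v u) = qform B u"
    unfolding hT.rfun_id T_qform[OF Ru] R_vec(3)[OF u] ..
  finally show ?thesis .
qed

text \<open>The inverse is A^(-1/2) (1/f)(T) A^(-1/2). A scalar bound of 1/f by \<alpha> + \<beta>/t
  turns into one by the inverses of A and B, because the inverse of T is A^(1/2) B^(-1)
  A^(1/2).\<close>

lemma mean_inverse:
  assumes f: "f holomorphic_on slit" "\<And>t. t > 0 \<Longrightarrow> f (complex_of_real t) \<in> \<real>"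
    and pos: "\<And>t. t > 0 \<Longrightarrow> 0 < Re (f (complex_of_real t))"
  obtains Y where "Y \<in> carrier_mat n n" "hermitian_mat Y"
    "\<And>x. x \<in> carrier_vec n \<Longrightarrow> mean_op f A B *\<^sub>v (Y *\<^sub>v x) = x"
    "\<And>\<alpha> \<beta> u. (\<And>t. t > 0 \<Longrightarrow> inverse (Re (f (complex_of_real t))) \<le> \<alpha> + \<beta> * inverse t) \<Longrightarrow> u \<in> carrier_vec n \<Longrightarrow>
      Re (qform Y u) \<le> \<alpha> * Re (qform (hA.rfun inverse) u) + \<beta> * Re (qform (hB.rfun inverse) u)"
proof
  let ?h = "\<lambda>t. Re (f (complex_of_real t))"
  let ?F = "hT.rfun (\<lambda>t. inverse (?h t))"
  let ?Y = "R' * ?F * R'"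
  show Yc: "?Y \<in> carrier_mat n n"
    by (rule mult_carrier_mat[OF mult_carrier_mat[OF R_carrier(2) hT.rfun_carrier] R_carrier(2)])
  have Yv: "?Y *\<^sub>v x = R' *\<^sub>v (?F *\<^sub>v (R' *\<^sub>v x))" if "x \<in> carrier_vec n" for x
    using that mat_mult_vec[OF mult_carrier_mat[OF R_carrier(2) hT.rfun_carrier] R_carrier(2) that]
      mat_mult_vec[OF R_carrier(2) hT.rfun_carrier] by simp
  have Yq: "qform ?Y x = qform ?F (R' *\<^sub>v x)" if x: "x \<in> carrier_vec n" for x
    unfolding qform_def Yv[OF x] using x by (intro R_sym(2)) auto
  show "hermitian_mat ?Y"
    unfolding hermitian_iff[OF Yc] using Yq by (simp add: hT.rfun_qform)
  show "mean_op f A B *\<^sub>v (?Y *\<^sub>v x) = x" if x: "x \<in> carrier_vec n" for x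
  proof -
    have R'x: "R' *\<^sub>v x \<in> carrier_vec n" using x by simp
    have "hT.rfun ?h *\<^sub>v (?F *\<^sub>v (R' *\<^sub>v x)) = hT.rfun (\<lambda>_. 1) *\<^sub>v (R' *\<^sub>v x)"
      unfolding hT.rfun_mult_vec[OF R'x] using pos T_eigs_pos
      by (intro arg_cong2[where f=mult_mat_vec] hT.rfun_cong refl) (simp add: less_imp_neq[THEN not_sym])
    then have "hT.rfun ?h *\<^sub>v (?F *\<^sub>v (R' *\<^sub>v x)) = R' *\<^sub>v x" using hT.rfun_one_vec[OF R'x] by simp
    moreover have "mean_op f A B *\<^sub>v (?Y *\<^sub>v x) = R *\<^sub>v (hT.rfun ?h *\<^sub>v (?F *\<^sub>v (R' *\<^sub>v x)))"
    proof -
      have eq: "matfun f T = hT.rfun ?h" using f x by (rule mean_qform(1))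
      show ?thesis unfolding Yv[OF x] eq[symmetric] using x R'x by (simp add: mean_op_vec R_vec)
    qed
    ultimately show ?thesis using R_vec(2)[OF x] by simp
  qed
  fix \<alpha> \<beta> :: real and u :: "complex vec" assume le: "\<And>t. t > 0 \<Longrightarrow> inverse (?h t) \<le> \<alpha> + \<beta> * inverse t" and u: "u \<in> carrier_vec n"
  have R'u: "R' *\<^sub>v u \<in> carrier_vec n" using u by simp
  have "Re (qform ?Y u) \<le> Re (qform (hT.rfun (\<lambda>t. \<alpha> * 1 + \<beta> * inverse t)) (R' *\<^sub>v u))"
    unfolding Yq[OF u] using le T_eigs_pos by (intro hT.rfun_mono[OF R'u]) auto
  also have "\<dots> = \<alpha> * Re (qform (hT.rfun (\<lambda>_. 1)) (R' *\<^sub>v u)) + \<beta> * Re (qform (hT.rfun inverse) (R' *\<^sub>v u))"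
    by (rule hT.rfun_linear_qform[OF R'u])
  also have "qform (hT.rfun (\<lambda>_. 1)) (R' *\<^sub>v u) = qform (hA.rfun inverse) u"
  proof -
    have "qform (hT.rfun (\<lambda>_. 1)) (R' *\<^sub>v u) = (R' *\<^sub>v u) \<bullet>c (R' *\<^sub>v u)"
      unfolding qform_def hT.rfun_one_vec[OF R'u] ..
    also have "\<dots> = qform (hA.rfun (\<lambda>t. (inverse (sqrt t))\<^sup>2)) u"
      unfolding R_rfun by (rule hA.rfun_norm[OF u])
    also have "hA.rfun (\<lambda>t. (inverse (sqrt t))\<^sup>2) = hA.rfun inverse"
      using eigs_pos(1) by (intro hA.rfun_cong) (simp add: power_inverse less_imp_le)
    finally show ?thesis .
  qed
  also have "qform (hT.rfun inverse) (R' *\<^sub>v u) = qform (hB.rfun inverse) u"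
  proof -
    \<comment> \<open>The preimage of u under B: it solves T (R w) = R' u, so the inverse of T can
      be evaluated at R' u.\<close>
    let ?w = "hB.rfun inverse *\<^sub>v u"
    have w: "?w \<in> carrier_vec n" using u by simp
    have Bw: "B *\<^sub>v ?w = u"
    proof -
      have "B *\<^sub>v ?w = hB.rfun (\<lambda>t. t * inverse t) *\<^sub>v u"
        using hB.rfun_mult_vec[OF u, of "\<lambda>t. t" inverse] by (simp add: hB.rfun_id)
      also have "hB.rfun (\<lambda>t. t * inverse t) = hB.rfun (\<lambda>_. 1)"
        using eigs_pos(2) by (intro hB.rfun_cong) (simp add: less_imp_neq[THEN not_sym])
      finally show ?thesis using hB.rfun_one_vec[OF u] by simp
    qed
    have TRw: "T *\<^sub>v (R *\<^sub>v ?w) = R' *\<^sub>v u" using w by (simp add: T_vec R_vec Bw)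
    have Rw: "R *\<^sub>v ?w \<in> carrier_vec n" using w by simp
    have "hT.rfun inverse *\<^sub>v (R' *\<^sub>v u) = hT.rfun (\<lambda>t. inverse t * t) *\<^sub>v (R *\<^sub>v ?w)"
      unfolding TRw[symmetric] using hT.rfun_mult_vec[OF Rw, of inverse "\<lambda>t. t"] by (simp add: hT.rfun_id)
    also have "hT.rfun (\<lambda>t. inverse t * t) = hT.rfun (\<lambda>_. 1)"
      using T_eigs_pos by (intro hT.rfun_cong) (simp add: less_imp_neq[THEN not_sym])
    also have "hT.rfun (\<lambda>_. 1) *\<^sub>v (R *\<^sub>v ?w) = R *\<^sub>v ?w" by (rule hT.rfun_one_vec[OF Rw])
    finally have "qform (hT.rfun inverse) (R' *\<^sub>v u) = (R *\<^sub>v ?w) \<bullet>c (R' *\<^sub>v u)" by (simp add: qform_def)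
    also have "\<dots> = ?w \<bullet>c (R *\<^sub>v (R' *\<^sub>v u))" using w R'u by (rule R_sym(1))
    finally show ?thesis using R_vec(2)[OF u] by (simp add: qform_def)
  qed
  finally show "Re (qform ?Y u) \<le> \<alpha> * Re (qform (hA.rfun inverse) u) + \<beta> * Re (qform (hB.rfun inverse) u)" .
qed

end

section \<open>Monotonicity of means and the Loewner-Heinz inequality\<close>

lemma accretive_one: "accretive n (1\<^sub>m n)"
  unfolding accretive_def
proof (intro conjI ballI impI)
  fix x :: "complex vec" assume x: "x \<in> carrier_vec n" "x \<noteq> 0\<^sub>v n"
  have "Re (x \<bullet>c x) \<noteq> 0" using cip_self(3)[OF x(1)] x(2) by auto
  then show "0 < Re (qform (1\<^sub>m n) x)" using cip_self(2)[OF x(1)] by (simp add: qform_one[OF x(1)])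
qed simp

lemma hermitian_one: "hermitian_mat (1\<^sub>m n)"
  by (subst hermitian_iff[of _ n]) (auto simp: qform_one cip_self(1))

text \<open>Identifies f(X) as a mean, so that monotonicity of means becomes monotonicity of matrix
  functions.\<close>

lemma mean_op_one:
  assumes X: "accretive n X" "hermitian_mat X" and f: "f holomorphic_on slit"
  shows "mean_op f (1\<^sub>m n) X = matfun f X"
proof -
  interpret pd_pair n "1\<^sub>m n" X using X accretive_one hermitian_one by unfold_locales auto
  have e: "\<mu> = 1" if \<mu>: "\<mu> \<in> eigs (1\<^sub>m n)" for \<mu>
  proof -
    have "Re \<mu> \<le> 1" by (rule hA.eigs_bounds(1)[OF \<mu>]) (simp add: qform_one)
    moreover have "1 \<le> Re \<mu>" by (rule hA.eigs_bounds(2)[OF \<mu>]) (simp add: qform_one)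
    ultimately show ?thesis using hA.eigs_real[OF \<mu>] by simp
  qed
  have "R = hA.rfun (\<lambda>_. 1)" unfolding R_rfun by (rule hA.rfun_cong) (auto dest: e)
  then have Rv: "R *\<^sub>v x = x" if "x \<in> carrier_vec n" for x using hA.rfun_one_vec[OF that] by simp
  have "R' = hA.rfun (\<lambda>_. 1)" unfolding R_rfun by (rule hA.rfun_cong) (auto dest: e)
  then have R'v: "R' *\<^sub>v x = x" if "x \<in> carrier_vec n" for x using hA.rfun_one_vec[OF that] by simp
  have TX: "T = X" by (rule mat_eqI_vec[where n=n]) (auto simp: T_vec R'v)
  have c: "matfun f X *\<^sub>v x \<in> carrier_vec n" if "x \<in> carrier_vec n" for x
    using mv_carrier(6)[OF that] unfolding TX .
  show ?thesis
    by (intro mat_eqI_vec[where n=n]) (auto simp: mean_op_vec Rv TX c)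
qed

text \<open>The splitting of u that is optimal for the larger matrix Y competes in the minimum for
  X.\<close>

lemma mean_mono_right:
  assumes P: "accretive n P" "hermitian_mat P" and X: "accretive n X" "hermitian_mat X" and Y: "accretive n Y" "hermitian_mat Y"
    and le: "\<And>x. x \<in> carrier_vec n \<Longrightarrow> Re (qform X x) \<le> Re (qform Y x)"
    and f: "hkern_limit f" "f holomorphic_on slit" and u: "u \<in> carrier_vec n"
  shows "Re (qform (mean_op f P X) u) \<le> Re (qform (mean_op f P Y) u)"
proof -
  interpret X: accretive_pair n P X using P X by unfold_locales
  interpret Y: accretive_pair n P Y using P Y by unfold_locales
  have kern: "Re (qform (mean_op (hkern v) P X) u) \<le> Re (qform (mean_op (hkern v) P Y) u)" if v: "0 \<le> v" "v \<le> 1" for v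
  proof -
    let ?w = "mean_op (hkern v) P X *\<^sub>v u" and ?z = "mean_op (hkern v) P Y *\<^sub>v u"
    have w: "?w \<in> carrier_vec n" using mult_mat_vec_carrier[OF X.mean_op_carrier u] .
    have z: "?z \<in> carrier_vec n" using mult_mat_vec_carrier[OF Y.mean_op_carrier u] .
    obtain a0 b0 where 0: "a0 \<in> carrier_vec n" "b0 \<in> carrier_vec n"
      "complex_of_real v \<cdot>\<^sub>v a0 + complex_of_real (1 - v) \<cdot>\<^sub>v b0 = u" "P *\<^sub>v a0 = ?w" "X *\<^sub>v b0 = ?w"
      using X.mean_hkern[OF v u] .
    obtain a b where 1: "a \<in> carrier_vec n" "b \<in> carrier_vec n"
      "complex_of_real v \<cdot>\<^sub>v a + complex_of_real (1 - v) \<cdot>\<^sub>v b = u" "P *\<^sub>v a = ?z" "Y *\<^sub>v b = ?z"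
      using Y.mean_hkern[OF v u] .
    have "Re (?w \<bullet>c u) \<le> v * Re (qform P a) + (1 - v) * Re (qform X b)"
      by (rule parallel_min[OF P(2,1) X(2,1) v 0(1,2) 1(1,2) w 0(3,4,5) 1(3)])
    also have "\<dots> \<le> v * Re (qform P a) + (1 - v) * Re (qform Y b)"
      using le[OF 1(2)] v by (intro add_left_mono mult_left_mono) auto
    also have "\<dots> = v * Re (?z \<bullet>c a) + (1 - v) * Re (?z \<bullet>c b)" by (simp add: qform_def 1)
    also have "\<dots> = Re (?z \<bullet>c (complex_of_real v \<cdot>\<^sub>v a + complex_of_real (1 - v) \<cdot>\<^sub>v b))"
      using z 1(1,2) by (simp add: cip_simps[where n=n])
    finally show ?thesis unfolding 1(3) by (simp add: qform_def)
  qed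
  obtain g where g: "\<And>N. hkern_comb (g N)" and lim: "\<And>K. compact K \<Longrightarrow> K \<subseteq> slit \<Longrightarrow> uniform_limit K g f sequentially"
    using f(1) unfolding hkern_limit_def by auto
  note hol = hkern_comb_holomorphic[OF g]
  have cmp: "Re (qform (mean_op h P X) u) \<le> Re (qform (mean_op h P Y) u)" if "hkern_comb h" for h
  proof -
    from that obtain N :: nat and w v where wv: "\<forall>j\<le>N. 0 \<le> w j \<and> 0 \<le> v j \<and> v j \<le> 1"
      and h: "h = (\<lambda>z. \<Sum>j\<le>N. complex_of_real (w j) * hkern (v j) z)" unfolding hkern_comb_def by auto
    have v: "\<forall>j\<le>N. 0 \<le> v j \<and> v j \<le> 1" using wv by auto
    show ?thesis unfolding h X.mean_op_sum[OF v u] Y.mean_op_sum[OF v u]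
      using kern wv by (auto intro!: sum_mono mult_left_mono)
  qed
  show ?thesis
    by (rule LIMSEQ_le[OF X.mean_op_tendsto[OF hol f(2) lim u] Y.mean_op_tendsto[OF hol f(2) lim u]]) (use cmp[OF g] in auto)
qed

lemma matfun_powr_rfun:
  assumes X: "accretive n X" "hermitian_mat X"
  shows "matfun (\<lambda>z. z powr complex_of_real r) X = herm.rfun X (\<lambda>t. t powr r)"
proof -
  interpret herm n X using X by unfold_locales (auto simp: accretive_def)
  have pos: "Re \<mu> > 0" if "\<mu> \<in> eigs X" for \<mu> using eigs_bounds(3)[OF that] X by (auto simp: accretive_def)
  show ?thesis
  proof (rule matfun_eq_rfun[OF accretive_spec[OF X(1)]])
    show "(\<lambda>z. z powr complex_of_real r) holomorphic_on slit" by (intro holomorphic_intros) auto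
  qed (use pos in \<open>auto simp: powr_of_real less_imp_le\<close>)
qed

text \<open>The power is a limit of harmonic kernels for 0 < r < 1, so the claim is monotonicity of
  the corresponding mean with the identity; r = 1 is the hypothesis itself.\<close>

theorem loewner_heinz:
  assumes X: "accretive n X" "hermitian_mat X" and Y: "accretive n Y" "hermitian_mat Y"
    and le: "\<And>x. x \<in> carrier_vec n \<Longrightarrow> Re (qform X x) \<le> Re (qform Y x)"
    and r: "0 < r" "r \<le> 1" and u: "u \<in> carrier_vec n"
  shows "Re (qform (herm.rfun X (\<lambda>t. t powr r)) u) \<le> Re (qform (herm.rfun Y (\<lambda>t. t powr r)) u)"
proof (cases "r = 1")
  case True
  interpret X: herm n X using X by unfold_locales (auto simp: accretive_def)
  interpret Y: herm n Y using Y by unfold_locales (auto simp: accretive_def)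
  have "Re \<mu> > 0" if "\<mu> \<in> eigs X" for \<mu> using X.eigs_bounds(3)[OF that] X by (auto simp: accretive_def)
  then have "X.rfun (\<lambda>t. t powr r) = X.rfun (\<lambda>t. t)" using True by (intro X.rfun_cong) (simp add: less_imp_le)
  moreover have "Re \<mu> > 0" if "\<mu> \<in> eigs Y" for \<mu> using Y.eigs_bounds(3)[OF that] Y by (auto simp: accretive_def)
  then have "Y.rfun (\<lambda>t. t powr r) = Y.rfun (\<lambda>t. t)" using True by (intro Y.rfun_cong) (simp add: less_imp_le)
  ultimately show ?thesis using le[OF u] by (simp add: X.rfun_id Y.rfun_id)
next
  case False
  let ?f = "\<lambda>z. z powr complex_of_real r"
  have f: "hkern_limit ?f" using r False by (intro hkern_limit_powr) auto
  have hol: "?f holomorphic_on slit" by (intro holomorphic_intros) auto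
  have "Re (qform (mean_op ?f (1\<^sub>m n) X) u) \<le> Re (qform (mean_op ?f (1\<^sub>m n) Y) u)"
    by (rule mean_mono_right[OF accretive_one hermitian_one X Y le f hol u])
  then show ?thesis by (simp only: mean_op_one[OF X hol] mean_op_one[OF Y hol] matfun_powr_rfun[OF X] matfun_powr_rfun[OF Y])
qed

section \<open>Positive unital maps and norm inequalities\<close>

context herm
begin

lemma hfun_add: "hfun (\<lambda>z. g z + h z) = hfun g + hfun h"
  by (rule mat_eqI_vec[where n=n]) (auto simp: hfun_add_vec mat_add_vec[OF hfun_carrier hfun_carrier])

lemma hfun_smult: "hfun (\<lambda>z. c * g z) = c \<cdot>\<^sub>m hfun g"
  by (rule mat_eqI_vec[where n=n]) (auto simp: hfun_smult_vec mat_smult_vec[OF hfun_carrier])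

lemma hfun_one: "hfun (\<lambda>_. 1) = 1\<^sub>m n"
  by (rule mat_eqI_vec[where n=n]) (auto simp: hfun_const_vec)

definition eproj :: "complex \<Rightarrow> complex mat" where
  "eproj \<mu> = hfun (\<lambda>z. if z = \<mu> then 1 else 0)"

lemma eproj_carrier [simp]: "eproj \<mu> \<in> carrier_mat n n"
  unfolding eproj_def by simp

lemma eproj_psd: "psd_mat (eproj \<mu>)"
proof -
  have d: "dim_row (eproj \<mu>) = n" using eproj_carrier carrier_matD by blast
  show ?thesis unfolding psd_mat_def d hermitian_iff[OF eproj_carrier]
    unfolding eproj_def by (auto simp: sweight_norm)
qed

lemma rfun_accretive:
  assumes "\<And>\<mu>. \<mu> \<in> eigs X \<Longrightarrow> 0 < g (Re \<mu>)"
  shows "accretive n (rfun g)"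
  unfolding accretive_def
proof (intro conjI ballI impI rfun_carrier)
  fix x :: "complex vec" assume x: "x \<in> carrier_vec n" "x \<noteq> 0\<^sub>v n"
  let ?s = "\<Sum>\<mu>\<in>eigs X. g (Re \<mu>) * sweight x \<mu>"
  have nn: "0 \<le> g (Re \<mu>) * sweight x \<mu>" if "\<mu> \<in> eigs X" for \<mu>
    using assms[OF that] sweight_norm(2)[OF x(1)] by simp
  have "?s \<noteq> 0"
  proof
    assume "?s = 0"
    then have "\<forall>\<mu>\<in>eigs X. g (Re \<mu>) * sweight x \<mu> = 0"
      using nn finite_eigs[OF carr] by (subst (asm) sum_nonneg_eq_0_iff) auto
    then have "\<forall>\<mu>\<in>eigs X. sweight x \<mu> = 0" using assms by force
    then have "Re (x \<bullet>c x) = 0" using norm_sweight[OF x(1)] by simp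
    then show False using cip_self(3)[OF x(1)] x(2) by simp
  qed
  moreover have "0 \<le> ?s" using nn by (intro sum_nonneg) auto
  ultimately show "0 < Re (qform (rfun g) x)" by (simp add: rfun_qform[OF x(1)])
qed

lemma eigs_pos_accretive: "accretive n X \<Longrightarrow> \<mu> \<in> eigs X \<Longrightarrow> 0 < Re \<mu>"
  using eigs_bounds(3)[of \<mu>] unfolding accretive_def by blast

lemma rfun_inverse_vec:
  assumes "accretive n X" and u: "u \<in> carrier_vec n"
  shows "X *\<^sub>v (rfun inverse *\<^sub>v u) = u" "rfun inverse *\<^sub>v (X *\<^sub>v u) = u"
proof -
  have 1: "rfun (\<lambda>t. t * inverse t) *\<^sub>v u = u" "rfun (\<lambda>t. inverse t * t) *\<^sub>v u = u"
    using rfun_one_vec[OF u] rfun_cong[of _ "\<lambda>_. 1"] eigs_pos_accretive[OF assms(1)]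
    by (metis (no_types, lifting) less_numeral_extra(3) right_inverse left_inverse)+
  show "X *\<^sub>v (rfun inverse *\<^sub>v u) = u" using rfun_mult_vec[OF u, of "\<lambda>t. t" inverse] 1(1) by (simp add: rfun_id)
  show "rfun inverse *\<^sub>v (X *\<^sub>v u) = u" using rfun_mult_vec[OF u, of inverse "\<lambda>t. t"] 1(2) by (simp add: rfun_id)
qed

end

section \<open>Positive unital linear maps\<close>

locale unital_positive =
  fixes n :: nat and \<Phi> :: "complex mat \<Rightarrow> complex mat"
  assumes pul: "positive_unital_linear n \<Phi>"
begin

lemma carrier [simp]: "X \<in> carrier_mat n n \<Longrightarrow> \<Phi> X \<in> carrier_mat n n"
  using pul unfolding positive_unital_linear_def by blast

lemma add: "X \<in> carrier_mat n n \<Longrightarrow> Y \<in> carrier_mat n n \<Longrightarrow> \<Phi> (X + Y) = \<Phi> X + \<Phi> Y"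
  using pul unfolding positive_unital_linear_def by blast

lemma smult: "X \<in> carrier_mat n n \<Longrightarrow> \<Phi> (c \<cdot>\<^sub>m X) = c \<cdot>\<^sub>m \<Phi> X"
  using pul unfolding positive_unital_linear_def by blast

lemma psd: "X \<in> carrier_mat n n \<Longrightarrow> psd_mat X \<Longrightarrow> psd_mat (\<Phi> X)"
  using pul unfolding positive_unital_linear_def by blast

lemma one: "\<Phi> (1\<^sub>m n) = 1\<^sub>m n"
  using pul unfolding positive_unital_linear_def by blast

lemma vec_carrier [simp]: "X \<in> carrier_mat n n \<Longrightarrow> x \<in> carrier_vec n \<Longrightarrow> \<Phi> X *\<^sub>v x \<in> carrier_vec n"
  using mult_mat_vec_carrier[OF carrier] .

text \<open>\<Phi> is applied to the spectral resolution: \<Phi>(g(X)) is the sum of g(\<mu>) times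
  the positive semidefinite matrices \<Phi>(\<open>eproj\<close> \<mu>). Positivity of \<Phi> is
  used below only through these pieces and through differences.\<close>

lemma hfun_cip:
  assumes "herm n X" and x: "x \<in> carrier_vec n" and y: "y \<in> carrier_vec n"
  shows "(\<Phi> (herm.hfun X g) *\<^sub>v x) \<bullet>c y = (\<Sum>\<mu>\<in>eigs X. g \<mu> * ((\<Phi> (herm.eproj X \<mu>) *\<^sub>v x) \<bullet>c y))"
proof -
  interpret herm n X by fact
  have "(\<Phi> (hfun (\<lambda>z. \<Sum>\<mu>\<in>I. g \<mu> * (if z = \<mu> then 1 else 0))) *\<^sub>v x) \<bullet>c y = (\<Sum>\<mu>\<in>I. g \<mu> * ((\<Phi> (eproj \<mu>) *\<^sub>v x) \<bullet>c y))"
    if "finite I" for I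
    using that
  proof (induction I rule: finite_induct)
    case empty
    \<comment> \<open>That \<Phi> vanishes at the zero matrix is read off from homogeneity with the
      scalar 0.\<close>
    have "hfun (\<lambda>_. 0) = 0 \<cdot>\<^sub>m hfun (\<lambda>_. 0)" using hfun_smult[of 0 "\<lambda>_. 0"] by simp
    then have "\<Phi> (hfun (\<lambda>_. 0)) = 0 \<cdot>\<^sub>m \<Phi> (hfun (\<lambda>_. 0))" using smult[OF hfun_carrier] by metis
    then have "\<Phi> (hfun (\<lambda>_. 0)) *\<^sub>v x = 0 \<cdot>\<^sub>v (\<Phi> (hfun (\<lambda>_. 0)) *\<^sub>v x)"
      using mat_smult_vec[OF carrier[OF hfun_carrier] x] by metis
    then have "(\<Phi> (hfun (\<lambda>_. 0)) *\<^sub>v x) \<bullet>c y = 0 * ((\<Phi> (hfun (\<lambda>_. 0)) *\<^sub>v x) \<bullet>c y)"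
      using cip_smult_left[OF vec_carrier[OF hfun_carrier x] y] by metis
    then show ?case by simp
  next
    case (insert \<nu> I)
    let ?h = "\<lambda>z. \<Sum>\<mu>\<in>I. g \<mu> * (if z = \<mu> then 1 else 0)"
    have "hfun (\<lambda>z. \<Sum>\<mu>\<in>insert \<nu> I. g \<mu> * (if z = \<mu> then 1 else 0)) = hfun (\<lambda>z. g \<nu> * (if z = \<nu> then 1 else 0) + ?h z)"
      using insert.hyps by simp
    also have "\<dots> = g \<nu> \<cdot>\<^sub>m eproj \<nu> + hfun ?h"
      unfolding hfun_add[of "\<lambda>z. g \<nu> * (if z = \<nu> then 1 else 0)" ?h] hfun_smult[of "g \<nu>"] eproj_def ..
    finally have "\<Phi> (hfun (\<lambda>z. \<Sum>\<mu>\<in>insert \<nu> I. g \<mu> * (if z = \<mu> then 1 else 0))) = g \<nu> \<cdot>\<^sub>m \<Phi> (eproj \<nu>) + \<Phi> (hfun ?h)"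
      by (simp add: add smult)
    then show ?case using insert x y
      by (simp add: mat_add_vec[where n=n] mat_smult_vec[where n=n] cip_simps[where n=n])
  qed
  from this[OF finite_eigs[OF carr]]
  have "(\<Phi> (hfun (\<lambda>z. \<Sum>\<mu>\<in>eigs X. g \<mu> * (if z = \<mu> then 1 else 0))) *\<^sub>v x) \<bullet>c y = (\<Sum>\<mu>\<in>eigs X. g \<mu> * ((\<Phi> (eproj \<mu>) *\<^sub>v x) \<bullet>c y))" .
  moreover have "hfun (\<lambda>z. \<Sum>\<mu>\<in>eigs X. g \<mu> * (if z = \<mu> then 1 else 0)) = hfun g"
    using finite_eigs[OF carr] by (intro hfun_cong) (simp add: if_distrib cong: if_cong)
  ultimately show ?thesis by simp
qed

lemma psd_image:
  assumes X: "X \<in> carrier_mat n n" "psd_mat X" and x: "x \<in> carrier_vec n"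
  shows "0 \<le> Re (qform (\<Phi> X) x)" "Im (qform (\<Phi> X) x) = 0" "hermitian_mat (\<Phi> X)"
proof -
  have d: "dim_row (\<Phi> X) = n" using carrier[OF X(1)] carrier_matD by blast
  show "0 \<le> Re (qform (\<Phi> X) x)" "Im (qform (\<Phi> X) x) = 0" "hermitian_mat (\<Phi> X)"
    using psd[OF X] x unfolding psd_mat_def d by auto
qed

text \<open>A Hermitian matrix is a real combination of positive semidefinite spectral projections,
  and \<Phi> keeps each of them Hermitian.\<close>

lemma hermitian_image:
  assumes X: "X \<in> carrier_mat n n" "hermitian_mat X"
  shows "hermitian_mat (\<Phi> X)"
  unfolding hermitian_iff[OF carrier[OF X(1)]]
proof
  fix x :: "complex vec" assume x: "x \<in> carrier_vec n"
  interpret herm n X using X by unfold_locales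
  have "qform (\<Phi> X) x = (\<Sum>\<mu>\<in>eigs X. \<mu> * qform (\<Phi> (eproj \<mu>)) x)"
    using hfun_cip[OF _ x x, of X "\<lambda>z. z"] herm_axioms by (simp add: hfun_id qform_def)
  moreover have "Im (\<mu> * qform (\<Phi> (eproj \<mu>)) x) = 0" if "\<mu> \<in> eigs X" for \<mu>
    using eigs_real[OF that] psd_image(2)[OF eproj_carrier eproj_psd x, of \<mu>]
    by (metis Im_complex_of_real add.right_neutral mult_zero_left mult_zero_right times_complex.sel(2))
  ultimately show "Im (qform (\<Phi> X) x) = 0" by simp
qed

lemma mono:
  assumes X: "X \<in> carrier_mat n n" "hermitian_mat X" and Y: "Y \<in> carrier_mat n n" "hermitian_mat Y"
    and le: "\<And>x. x \<in> carrier_vec n \<Longrightarrow> Re (qform X x) \<le> Re (qform Y x)" and u: "u \<in> carrier_vec n"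
  shows "Re (qform (\<Phi> X) u) \<le> Re (qform (\<Phi> Y) u)"
proof -
  let ?D = "Y + (-1) \<cdot>\<^sub>m X"
  have D: "?D \<in> carrier_mat n n" using X Y by auto
  have q: "qform ?D x = qform Y x - qform X x" if "x \<in> carrier_vec n" for x
    using X Y that by (simp add: qform_linear[where n=n])
  have d: "dim_row ?D = n" using D carrier_matD by blast
  have "psd_mat ?D" unfolding psd_mat_def d hermitian_iff[OF D]
    using le X Y by (auto simp: q hermitian_iff)
  then have "0 \<le> Re (qform (\<Phi> ?D) u)" by (rule psd_image(1)[OF D _ u])
  also have "\<Phi> ?D = \<Phi> Y + (-1) \<cdot>\<^sub>m \<Phi> X" using X Y by (simp add: add smult)
  also have "qform (\<Phi> Y + (-1) \<cdot>\<^sub>m \<Phi> X) u = qform (\<Phi> Y) u - qform (\<Phi> X) u"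
    using X Y u by (simp add: qform_linear[where n=n])
  finally show ?thesis by simp
qed

text \<open>Write G as its Hermitian part plus i K with K Hermitian; \<Phi>(K) is Hermitian again
  and contributes nothing to the real part.\<close>

lemma Re_image:
  assumes G: "G \<in> carrier_mat n n" and u: "u \<in> carrier_vec n"
  shows "Re (qform (\<Phi> G) u) = Re (qform (\<Phi> (mat_re G)) u)"
proof -
  define K where "K = (- \<i>) \<cdot>\<^sub>m (G + (-1) \<cdot>\<^sub>m mat_re G)"
  have K: "K \<in> carrier_mat n n" "G + (-1) \<cdot>\<^sub>m mat_re G \<in> carrier_mat n n" unfolding K_def using G by auto
  have qK: "qform K x = (- \<i>) * (qform G x - complex_of_real (Re (qform G x)))" if "x \<in> carrier_vec n" for x
    unfolding K_def using G K(2) that by (simp add: qform_linear[where n=n] qform_mat_re)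
  have hK: "hermitian_mat K" unfolding hermitian_iff[OF K(1)] by (simp add: qK)
  have "G = mat_re G + \<i> \<cdot>\<^sub>m K"
  proof (rule mat_eqI_qform[OF G])
    show "mat_re G + \<i> \<cdot>\<^sub>m K \<in> carrier_mat n n" using G K by auto
    fix x :: "complex vec" assume x: "x \<in> carrier_vec n"
    show "qform G x = qform (mat_re G + \<i> \<cdot>\<^sub>m K) x"
      using G K x by (simp add: qform_linear[where n=n] qK qform_mat_re algebra_simps)
  qed
  then have "\<Phi> G = \<Phi> (mat_re G) + \<i> \<cdot>\<^sub>m \<Phi> K" using G K add smult by (metis mat_re_carrier smult_carrier_mat)
  then have "qform (\<Phi> G) u = qform (\<Phi> (mat_re G)) u + \<i> * qform (\<Phi> K) u"
    using G K u by (simp add: qform_linear[where n=n])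
  moreover have "Im (qform (\<Phi> K) u) = 0"
    using hermitian_image[OF K(1) hK] u by (simp add: hermitian_iff[OF carrier[OF K(1)]])
  ultimately show ?thesis by simp
qed

lemma mono_Re:
  assumes X: "X \<in> carrier_mat n n" and Y: "Y \<in> carrier_mat n n"
    and le: "\<And>x. x \<in> carrier_vec n \<Longrightarrow> Re (qform X x) \<le> Re (qform Y x)" and u: "u \<in> carrier_vec n"
  shows "Re (qform (\<Phi> X) u) \<le> Re (qform (\<Phi> Y) u)"
  unfolding Re_image[OF X u] Re_image[OF Y u] using X Y le u
  by (intro mono) (auto simp: qform_mat_re_Re hermitian_mat_re)

text \<open>A polarised form of Choi's inequality \<open>\<Phi>(X)\<inverse> \<le> \<Phi>(X\<inverse>)\<close> that mentions no inverse of \<open>\<Phi>(X)\<close>.\<close>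

lemma choi:
  assumes X: "accretive n X" "hermitian_mat X" and Y: "Y \<in> carrier_mat n n"
    and inv: "\<And>x. x \<in> carrier_vec n \<Longrightarrow> X *\<^sub>v (Y *\<^sub>v x) = x"
    and u: "u \<in> carrier_vec n" and y: "y \<in> carrier_vec n"
  shows "2 * Re (y \<bullet>c u) \<le> Re (qform (\<Phi> Y) u) + Re (qform (\<Phi> X) y)"
proof -
  interpret herm n X using X by unfold_locales (auto simp: accretive_def)
  have YI: "Y = rfun inverse"
  proof (rule mat_eqI_vec[OF Y rfun_carrier])
    fix x :: "complex vec" assume x: "x \<in> carrier_vec n"
    show "Y *\<^sub>v x = rfun inverse *\<^sub>v x"
      using rfun_inverse_vec(2)[OF X(1) mult_mat_vec_carrier[OF Y x]] inv[OF x] by simp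
  qed
  let ?E = "\<lambda>\<mu>. \<Phi> (eproj \<mu>)"
  \<comment> \<open>Let m = Re \<mu> > 0. The form of \<Phi>(\<open>eproj\<close> \<mu>) at u - m y,
    divided by m, is nonnegative. Summed over the spectrum, the three terms assemble to \<Phi>(Y),
    to the identity (\<Phi> is unital) and to \<Phi>(X).\<close>
  have summand: "0 \<le> inverse (Re \<mu>) * Re (qform (?E \<mu>) u) - 2 * Re ((?E \<mu> *\<^sub>v y) \<bullet>c u) + Re \<mu> * Re (qform (?E \<mu>) y)"
    if \<mu>: "\<mu> \<in> eigs X" for \<mu>
  proof -
    define m where "m = Re \<mu>"
    have m: "m > 0" unfolding m_def by (rule eigs_pos_accretive[OF X(1) \<mu>])
    let ?y = "complex_of_real m \<cdot>\<^sub>v y"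
    have Ec: "?E \<mu> \<in> carrier_mat n n" by simp
    have Eh: "hermitian_mat (?E \<mu>)" using psd_image(3)[OF eproj_carrier eproj_psd u] .
    have Ey: "?E \<mu> *\<^sub>v y \<in> carrier_vec n" using y by simp
    have "0 \<le> Re (qform (?E \<mu>) (u - ?y))" using u y by (intro psd_image(1)[OF eproj_carrier eproj_psd]) auto
    also have "\<dots> = Re (qform (?E \<mu>) u) - 2 * Re ((?E \<mu> *\<^sub>v ?y) \<bullet>c u) + Re (qform (?E \<mu>) ?y)"
      using y by (intro Re_qform_diff[OF Eh Ec u]) auto
    also have "Re ((?E \<mu> *\<^sub>v ?y) \<bullet>c u) = m * Re ((?E \<mu> *\<^sub>v y) \<bullet>c u)"
      using Ey u y by (simp add: mv_smult[OF Ec] cip_simps[where n=n])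
    also have "Re (qform (?E \<mu>) ?y) = m * (m * Re (qform (?E \<mu>) y))"
      using Ey y by (simp add: qform_def mv_smult[OF Ec] cip_simps[where n=n])
    finally have "0 \<le> inverse m * (Re (qform (?E \<mu>) u) - 2 * (m * Re ((?E \<mu> *\<^sub>v y) \<bullet>c u)) + m * (m * Re (qform (?E \<mu>) y)))"
      using m by simp
    also have "\<dots> = inverse m * Re (qform (?E \<mu>) u) - 2 * Re ((?E \<mu> *\<^sub>v y) \<bullet>c u) + m * Re (qform (?E \<mu>) y)"
      using m by (simp add: field_simps)
    finally show ?thesis unfolding m_def .
  qed
  have re: "Re (complex_of_real a * z) = a * Re z" for a z by simp
  have r1: "Re (qform (\<Phi> Y) u) = (\<Sum>\<mu>\<in>eigs X. inverse (Re \<mu>) * Re (qform (?E \<mu>) u))"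
    unfolding YI rfun_def qform_def hfun_cip[OF herm_axioms u u] by (simp only: Re_sum re)
  have r2: "Re (qform (\<Phi> X) y) = (\<Sum>\<mu>\<in>eigs X. Re \<mu> * Re (qform (?E \<mu>) y))"
  proof -
    have "qform (\<Phi> (rfun (\<lambda>t. t))) y = (\<Sum>\<mu>\<in>eigs X. complex_of_real (Re \<mu>) * qform (?E \<mu>) y)"
      unfolding rfun_def qform_def hfun_cip[OF herm_axioms y y] ..
    then show ?thesis unfolding rfun_id by (simp only: Re_sum re)
  qed
  have r3: "Re (y \<bullet>c u) = (\<Sum>\<mu>\<in>eigs X. Re ((?E \<mu> *\<^sub>v y) \<bullet>c u))"
    using hfun_cip[OF herm_axioms y u, of "\<lambda>_. 1"] y by (simp add: hfun_one one)
  have "0 \<le> (\<Sum>\<mu>\<in>eigs X. inverse (Re \<mu>) * Re (qform (?E \<mu>) u) - 2 * Re ((?E \<mu> *\<^sub>v y) \<bullet>c u) + Re \<mu> * Re (qform (?E \<mu>) y))"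
    by (intro sum_nonneg summand)
  also have "\<dots> = Re (qform (\<Phi> Y) u) - 2 * Re (y \<bullet>c u) + Re (qform (\<Phi> X) y)"
    unfolding r1 r2 r3 by (simp add: sum.distrib sum_subtractf sum_distrib_left)
  finally show ?thesis by simp
qed

text \<open>If the form of \<Phi>(X) at y were nonpositive, Choi's inequality at the vectors e y and
  y would bound a term linear in e by one quadratic in e for every real e, which fails for small
  positive e.\<close>

lemma image_accretive:
  assumes X: "accretive n X" "hermitian_mat X" and Y: "Y \<in> carrier_mat n n"
    and inv: "\<And>x. x \<in> carrier_vec n \<Longrightarrow> X *\<^sub>v (Y *\<^sub>v x) = x"
    and y: "y \<in> carrier_vec n" "y \<noteq> 0\<^sub>v n"
  shows "0 < Re (qform (\<Phi> X) y)"
proof (rule ccontr)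
  assume "\<not> 0 < Re (qform (\<Phi> X) y)"
  have N: "Re (y \<bullet>c y) > 0" using cip_self[OF y(1)] y(2) by (auto simp: order.order_iff_strict)
  let ?q = "Re (qform (\<Phi> Y) y)"
  have *: "2 * e * Re (y \<bullet>c y) \<le> e\<^sup>2 * ?q" for e :: real
  proof -
    have v: "\<Phi> Y *\<^sub>v y \<in> carrier_vec n" using Y y by simp
    have "2 * Re (y \<bullet>c (complex_of_real e \<cdot>\<^sub>v y)) \<le> Re (qform (\<Phi> Y) (complex_of_real e \<cdot>\<^sub>v y)) + Re (qform (\<Phi> X) y)"
      using y by (intro choi[OF X Y inv]) auto
    moreover have "Re (qform (\<Phi> Y) (complex_of_real e \<cdot>\<^sub>v y)) = e\<^sup>2 * ?q"
      using v y Y by (simp add: qform_def mv_smult[OF carrier[OF Y]] cip_simps[where n=n] power2_eq_square)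
    ultimately show ?thesis using \<open>\<not> 0 < Re (qform (\<Phi> X) y)\<close> y by (simp add: cip_simps[where n=n])
  qed
  have q: "?q > 0" using *[of 1] N by simp
  \<comment> \<open>The minimiser of e^2 q - 2 e |y|^2, where the inequality reads 2 \<le> 1 up to a
    positive factor.\<close>
  have "2 * (Re (y \<bullet>c y) / ?q) * Re (y \<bullet>c y) \<le> (Re (y \<bullet>c y) / ?q)\<^sup>2 * ?q" by (rule *)
  then show False using q N by (simp add: power2_eq_square field_simps)
qed

end

text \<open>The Bhatia-Kittaneh inequality for \<open>a + b \<le> I\<close>. With \<open>z = a x + b y\<close>, positivity of
  \<open>\<langle>a (x - z), x - z\<rangle> + \<langle>b (y - z), y - z\<rangle>\<close> gives \<open>|z|\<^sup>2 \<le> \<langle>a x, x\<rangle> + \<langle>b y, y\<rangle>\<close>; the bound follows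
  with \<open>\<langle>a x, x\<rangle> - |a x|\<^sup>2 \<le> |x|\<^sup>2 / 4\<close>.\<close>

lemma bhatia_kittaneh:
  assumes a: "a \<in> carrier_mat n n" "hermitian_mat a" and b: "b \<in> carrier_mat n n" "hermitian_mat b"
    and pos: "\<And>x. x \<in> carrier_vec n \<Longrightarrow> 0 \<le> Re (qform a x)" "\<And>x. x \<in> carrier_vec n \<Longrightarrow> 0 \<le> Re (qform b x)"
    and le: "\<And>x. x \<in> carrier_vec n \<Longrightarrow> Re (qform a x) + Re (qform b x) \<le> Re (x \<bullet>c x)"
    and y: "y \<in> carrier_vec n"
  shows "16 * Re ((a *\<^sub>v (b *\<^sub>v y)) \<bullet>c (a *\<^sub>v (b *\<^sub>v y))) \<le> Re (y \<bullet>c y)"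
proof -
  have v: "a *\<^sub>v x \<in> carrier_vec n" "b *\<^sub>v x \<in> carrier_vec n" if "x \<in> carrier_vec n" for x
    using mult_mat_vec_carrier[OF a(1) that] mult_mat_vec_carrier[OF b(1) that] .
  have quarter: "Re (qform c x) \<le> Re ((c *\<^sub>v x) \<bullet>c (c *\<^sub>v x)) + Re (x \<bullet>c x) / 4"
    if c: "c \<in> carrier_mat n n" "hermitian_mat c" and x: "x \<in> carrier_vec n" for c x
  proof -
    have cx: "c *\<^sub>v x \<in> carrier_vec n" using mult_mat_vec_carrier[OF c(1) x] .
    have "0 \<le> Re ((c *\<^sub>v x - (1/2) \<cdot>\<^sub>v x) \<bullet>c (c *\<^sub>v x - (1/2) \<cdot>\<^sub>v x))"
      using cx x by (intro cip_self(2)[where n=n]) auto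
    moreover have "Re (x \<bullet>c (c *\<^sub>v x)) = Re ((c *\<^sub>v x) \<bullet>c x)" using cip_commute[OF x cx] by simp
    ultimately show ?thesis using cx x by (simp add: cip_simps[where n=n] qform_def)
  qed
  have cross: "8 * Re ((a *\<^sub>v x) \<bullet>c (b *\<^sub>v y)) \<le> Re (x \<bullet>c x) + Re (y \<bullet>c y)"
    if x: "x \<in> carrier_vec n" and y: "y \<in> carrier_vec n" for x y
  proof -
    define z where "z = a *\<^sub>v x + b *\<^sub>v y"
    have z: "z \<in> carrier_vec n" using v x y by (simp add: z_def)
    have "0 \<le> Re (qform a (x - z)) + Re (qform b (y - z))" using pos x y z by simp
    also have "\<dots> = Re (qform a x) + Re (qform b y) - 2 * (Re ((a *\<^sub>v z) \<bullet>c x) + Re ((b *\<^sub>v z) \<bullet>c y)) + (Re (qform a z) + Re (qform b z))"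
      unfolding Re_qform_diff[OF a(2,1) x z] Re_qform_diff[OF b(2,1) y z] by simp
    also have "Re ((a *\<^sub>v z) \<bullet>c x) + Re ((b *\<^sub>v z) \<bullet>c y) = Re (z \<bullet>c z)"
    proof -
      have "z \<bullet>c z = z \<bullet>c (a *\<^sub>v x) + z \<bullet>c (b *\<^sub>v y)"
        using cip_add_right[OF v(1)[OF x] v(2)[OF y] z] by (simp add: z_def)
      then show ?thesis using hermitian_cip[OF a(2,1) z x] hermitian_cip[OF b(2,1) z y] by simp
    qed
    finally have "Re (z \<bullet>c z) \<le> Re (qform a x) + Re (qform b y)" using le[OF z] by simp
    moreover have "Re (z \<bullet>c z) = Re ((a *\<^sub>v x) \<bullet>c (a *\<^sub>v x)) + Re ((b *\<^sub>v y) \<bullet>c (b *\<^sub>v y)) + 2 * Re ((a *\<^sub>v x) \<bullet>c (b *\<^sub>v y))"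
      using v x y cip_commute[of "b *\<^sub>v y" n "a *\<^sub>v x"] by (simp add: z_def cip_simps[where n=n])
    ultimately show ?thesis using quarter[OF a x] quarter[OF b y] by linarith
  qed
  define w where "w = a *\<^sub>v (b *\<^sub>v y)"
  have w: "w \<in> carrier_vec n" using v y by (simp add: w_def)
  have bvy: "b *\<^sub>v y \<in> carrier_vec n" using v y by simp
  have "8 * Re ((a *\<^sub>v (4 \<cdot>\<^sub>v w)) \<bullet>c (b *\<^sub>v y)) \<le> Re ((4 \<cdot>\<^sub>v w) \<bullet>c (4 \<cdot>\<^sub>v w)) + Re (y \<bullet>c y)"
    using w y by (intro cross) auto
  moreover have "(a *\<^sub>v (4 \<cdot>\<^sub>v w)) \<bullet>c (b *\<^sub>v y) = 4 * (w \<bullet>c w)"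
    using hermitian_cip[OF a(2,1) _ bvy, of "4 \<cdot>\<^sub>v w"] w by (simp add: w_def[symmetric] cip_simps[where n=n])
  ultimately show ?thesis using w unfolding w_def[symmetric] by (simp add: cip_simps[where n=n])
qed

text \<open>Put a = (c Z1)^r and b = (k / Z2)^r. The hypothesis confines the spectra of c Z1 and k /
  Z2 to (0,1], where raising to a power r \<ge> 1 decreases; hence a + b is at most the identity and
  the Bhatia-Kittaneh bound applies.\<close>

lemma power_bound:
  assumes Z1: "accretive n Z1" "hermitian_mat Z1" and Z2: "accretive n Z2" "hermitian_mat Z2"
    and ck: "0 < c" "0 < k"
    and le: "\<And>u. u \<in> carrier_vec n \<Longrightarrow> c * Re (qform Z1 u) + k * Re (qform (herm.rfun Z2 inverse) u) \<le> Re (u \<bullet>c u)"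
    and r: "1 \<le> r" and u: "u \<in> carrier_vec n"
  shows "16 * Re (qform (herm.rfun Z1 (\<lambda>t. (c * t) powr (2 * r))) u) \<le> Re (qform (herm.rfun Z2 (\<lambda>t. (t / k) powr (2 * r))) u)"
proof -
  interpret Z1: herm n Z1 using Z1 by unfold_locales (auto simp: accretive_def)
  interpret Z2: herm n Z2 using Z2 by unfold_locales (auto simp: accretive_def)
  note p1 = Z1.eigs_pos_accretive[OF Z1(1)] and p2 = Z2.eigs_pos_accretive[OF Z2(1)]
  have acci: "accretive n (Z2.rfun inverse)" using p2 by (intro Z2.rfun_accretive) simp
  have e1: "c * Re \<mu> \<le> 1" if "\<mu> \<in> eigs Z1" for \<mu>
  proof -
    have "Re \<mu> \<le> 1 / c"
    proof (rule Z1.eigs_bounds(1)[OF that])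
      fix x :: "complex vec" assume x: "x \<in> carrier_vec n"
      have "0 \<le> k * Re (qform (Z2.rfun inverse) x)" using accretive_nonneg[OF acci x] ck by simp
      then have "c * Re (qform Z1 x) \<le> Re (x \<bullet>c x)" using le[OF x] by linarith
      then show "Re (qform Z1 x) \<le> 1 / c * Re (x \<bullet>c x)" using ck by (simp add: field_simps)
    qed
    then show ?thesis using ck by (simp add: field_simps)
  qed
  have e2: "k \<le> Re \<mu>" if "\<mu> \<in> eigs Z2" for \<mu>
  proof (rule Z2.eigs_bounds(2)[OF that])
    fix x :: "complex vec" assume x: "x \<in> carrier_vec n"
    \<comment> \<open>Testing at the root of Z2 applied to x turns the upper bound on the inverse of
      Z2 into a lower bound on Z2.\<close>
    let ?s = "Z2.rfun sqrt *\<^sub>v x"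
    have s: "?s \<in> carrier_vec n" using x by simp
    have "k * Re (qform (Z2.rfun inverse) ?s) \<le> Re (?s \<bullet>c ?s)"
      using le[OF s] accretive_nonneg[OF Z1(1) s] ck by (smt (verit) mult_nonneg_nonneg)
    moreover have "?s \<bullet>c ?s = qform Z2 x"
    proof -
      have "Z2.rfun (\<lambda>t. (sqrt t)\<^sup>2) = Z2.rfun (\<lambda>t. t)" using p2 by (intro Z2.rfun_cong) (simp add: less_imp_le)
      then show ?thesis using Z2.rfun_norm[OF x, of sqrt] by (simp add: Z2.rfun_id)
    qed
    moreover have "qform (Z2.rfun inverse) ?s = x \<bullet>c x"
    proof -
      have "qform (Z2.rfun inverse) ?s = (Z2.rfun sqrt *\<^sub>v (Z2.rfun inverse *\<^sub>v ?s)) \<bullet>c x"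
        unfolding qform_def using Z2.rfun_adjoint[of "Z2.rfun inverse *\<^sub>v ?s" x sqrt] x by simp
      also have "Z2.rfun sqrt *\<^sub>v (Z2.rfun inverse *\<^sub>v ?s) = Z2.rfun (\<lambda>t. sqrt t * (inverse t * sqrt t)) *\<^sub>v x"
        by (simp add: Z2.rfun_mult_vec[OF x])
      also have "Z2.rfun (\<lambda>t. sqrt t * (inverse t * sqrt t)) = Z2.rfun (\<lambda>_. 1)"
      proof (rule Z2.rfun_cong)
        fix \<nu> assume "\<nu> \<in> eigs Z2"
        then have "0 < Re \<nu>" by (rule p2)
        then show "sqrt (Re \<nu>) * (inverse (Re \<nu>) * sqrt (Re \<nu>)) = 1"
          by (simp add: field_simps)
      qed
      finally show ?thesis using Z2.rfun_one_vec[OF x] by simp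
    qed
    ultimately show "k * Re (x \<bullet>c x) \<le> Re (qform Z2 x)" by simp
  qed
  let ?a = "Z1.rfun (\<lambda>t. (c * t) powr r)" and ?b = "Z2.rfun (\<lambda>t. (k / t) powr r)"
  have acc: "accretive n ?a" "accretive n ?b"
    using p1 p2 ck by (auto intro!: Z1.rfun_accretive Z2.rfun_accretive simp: less_imp_neq[THEN not_sym])
  \<comment> \<open>Chosen so that b y = u. Both sides then become squared norms, hence forms of
    2r-th powers.\<close>
  let ?y = "Z2.rfun (\<lambda>t. (t / k) powr r) *\<^sub>v u"
  have y: "?y \<in> carrier_vec n" using u by simp
  have "16 * Re ((?a *\<^sub>v (?b *\<^sub>v ?y)) \<bullet>c (?a *\<^sub>v (?b *\<^sub>v ?y))) \<le> Re (?y \<bullet>c ?y)"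
  proof (rule bhatia_kittaneh[OF _ _ _ _ _ _ _ y])
    fix x :: "complex vec" assume x: "x \<in> carrier_vec n"
    show "0 \<le> Re (qform ?a x)" "0 \<le> Re (qform ?b x)" using accretive_nonneg acc x by auto
    have "Re (qform ?a x) \<le> Re (qform (Z1.rfun (\<lambda>t. c * t + 0 * t)) x)"
    proof (rule Z1.rfun_mono[OF x])
      fix \<mu> assume \<mu>: "\<mu> \<in> eigs Z1"
      have "(c * Re \<mu>) powr r \<le> (c * Re \<mu>) powr 1"
        using p1[OF \<mu>] e1[OF \<mu>] ck r by (intro powr_mono') auto
      then show "(c * Re \<mu>) powr r \<le> c * Re \<mu> + 0 * Re \<mu>" using p1[OF \<mu>] ck by simp
    qed
    also have "\<dots> = c * Re (qform Z1 x)" unfolding Z1.rfun_linear_qform[OF x] Z1.rfun_id by simp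
    finally have 1: "Re (qform ?a x) \<le> c * Re (qform Z1 x)" .
    have "Re (qform ?b x) \<le> Re (qform (Z2.rfun (\<lambda>t. k * inverse t + 0 * t)) x)"
    proof (rule Z2.rfun_mono[OF x])
      fix \<mu> assume \<mu>: "\<mu> \<in> eigs Z2"
      have "(k / Re \<mu>) powr r \<le> (k / Re \<mu>) powr 1"
        using p2[OF \<mu>] e2[OF \<mu>] ck r by (intro powr_mono') auto
      then show "(k / Re \<mu>) powr r \<le> k * inverse (Re \<mu>) + 0 * Re \<mu>" using p2[OF \<mu>] ck by (simp add: divide_inverse)
    qed
    also have "\<dots> = k * Re (qform (Z2.rfun inverse) x)" unfolding Z2.rfun_linear_qform[OF x] by simp
    finally show "Re (qform ?a x) + Re (qform ?b x) \<le> Re (x \<bullet>c x)" using 1 le[OF x] by linarith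
  qed auto
  moreover have "?b *\<^sub>v ?y = u"
  proof -
    have "?b *\<^sub>v ?y = Z2.rfun (\<lambda>t. (k / t) powr r * (t / k) powr r) *\<^sub>v u" by (rule Z2.rfun_mult_vec[OF u])
    also have "Z2.rfun (\<lambda>t. (k / t) powr r * (t / k) powr r) = Z2.rfun (\<lambda>_. 1)"
    proof (rule Z2.rfun_cong)
      fix \<mu> assume "\<mu> \<in> eigs Z2"
      then have "0 < Re \<mu>" by (rule p2)
      then have "(k / Re \<mu>) powr r * (Re \<mu> / k) powr r = ((k / Re \<mu>) * (Re \<mu> / k)) powr r"
        by (simp only: powr_mult)
      then show "(k / Re \<mu>) powr r * (Re \<mu> / k) powr r = 1" using ck \<open>0 < Re \<mu>\<close> by simp
    qed
    finally show ?thesis using Z2.rfun_one_vec[OF u] by simp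
  qed
  moreover have sq: "(x powr r)\<^sup>2 = x powr (2 * r)" for x :: real
    by (simp add: power2_eq_square powr_add[symmetric])
  ultimately show ?thesis using u by (simp only: Z1.rfun_norm Z2.rfun_norm sq)
qed

section \<open>The power inequalities\<close>

lemma qform_smult:
  assumes "X \<in> carrier_mat n n" "x \<in> carrier_vec n"
  shows "qform (c \<cdot>\<^sub>m X) x = c * qform X x"
  using assms by (rule qform_linear(3)[of X n X x c, OF _ assms(1)])

text \<open>The range p \<ge> 2 is \<open>power_bound\<close> with r = p/2 after pulling out the
  scalars. The range p \<le> 2 takes the case p = 2 and applies Loewner-Heinz with exponent
  p/2.\<close>

lemma power_comparison:
  assumes Z1: "accretive n Z1" "hermitian_mat Z1" and Z2: "accretive n Z2" "hermitian_mat Z2"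
    and ck: "0 < c" "0 < k"
    and le: "\<And>u. u \<in> carrier_vec n \<Longrightarrow> c * Re (qform Z1 u) + k * Re (qform (herm.rfun Z2 inverse) u) \<le> Re (u \<bullet>c u)"
  shows "2 \<le> p \<Longrightarrow> loewner_le (mat_rpow Z1 p) (complex_of_real (1 / 16 * (1 / (c * k)) powr p) \<cdot>\<^sub>m mat_rpow Z2 p)"
    "0 < p \<Longrightarrow> p \<le> 2 \<Longrightarrow> loewner_le (mat_rpow Z1 p) (complex_of_real ((1 / (4 * (c * k))) powr p) \<cdot>\<^sub>m mat_rpow Z2 p)"
proof -
  interpret Z1: herm n Z1 using Z1 by unfold_locales (auto simp: accretive_def)
  interpret Z2: herm n Z2 using Z2 by unfold_locales (auto simp: accretive_def)
  note p1 = Z1.eigs_pos_accretive[OF Z1(1)] and p2 = Z2.eigs_pos_accretive[OF Z2(1)]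
  have rp: "mat_rpow Z1 p = Z1.rfun (\<lambda>t. t powr p)" "mat_rpow Z2 p = Z2.rfun (\<lambda>t. t powr p)" for p
    unfolding mat_rpow_def by (rule matfun_powr_rfun[OF Z1], rule matfun_powr_rfun[OF Z2])
  have conv: "loewner_le (mat_rpow Z1 p) (complex_of_real d \<cdot>\<^sub>m mat_rpow Z2 p)"
    if "\<And>u. u \<in> carrier_vec n \<Longrightarrow> Re (qform (Z1.rfun (\<lambda>t. t powr p)) u) \<le> d * Re (qform (Z2.rfun (\<lambda>t. t powr p)) u)" for p d
  proof -
    let ?X = "Z1.rfun (\<lambda>t. t powr p)" and ?Y = "Z2.rfun (\<lambda>t. t powr p)"
    have Y: "complex_of_real d \<cdot>\<^sub>m ?Y \<in> carrier_mat n n" by simp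
    have q: "qform (complex_of_real d \<cdot>\<^sub>m ?Y) u = complex_of_real d * qform ?Y u" if "u \<in> carrier_vec n" for u
      using that by (intro qform_linear(3)[of _ n]) auto
    show ?thesis unfolding rp loewner_le_iff[OF Z1.rfun_carrier Y] hermitian_iff[OF Y]
      using that by (simp add: q Z2.rfun_qform)
  qed
  have scale: "Re (qform (Z1.rfun (\<lambda>t. (c * t) powr p)) u) = c powr p * Re (qform (Z1.rfun (\<lambda>t. t powr p)) u)"
    "Re (qform (Z2.rfun (\<lambda>t. (d * t) powr p)) u) = d powr p * Re (qform (Z2.rfun (\<lambda>t. t powr p)) u)"
    if u: "u \<in> carrier_vec n" and d: "d > 0" for u p d
  proof -
    have 1: "Z1.rfun (\<lambda>t. (c * t) powr p) = Z1.rfun (\<lambda>t. c powr p * t powr p + 0 * t)"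
      using p1 ck by (intro Z1.rfun_cong) (simp add: powr_mult less_imp_le)
    show "Re (qform (Z1.rfun (\<lambda>t. (c * t) powr p)) u) = c powr p * Re (qform (Z1.rfun (\<lambda>t. t powr p)) u)"
      unfolding 1 Z1.rfun_linear_qform[OF u] by simp
    have 2: "Z2.rfun (\<lambda>t. (d * t) powr p) = Z2.rfun (\<lambda>t. d powr p * t powr p + 0 * t)"
      using p2 d by (intro Z2.rfun_cong) (simp add: powr_mult less_imp_le)
    show "Re (qform (Z2.rfun (\<lambda>t. (d * t) powr p)) u) = d powr p * Re (qform (Z2.rfun (\<lambda>t. t powr p)) u)"
      unfolding 2 Z2.rfun_linear_qform[OF u] by simp
  qed
  have big: "Re (qform (Z1.rfun (\<lambda>t. t powr p)) u) \<le> (1 / 16 * (1 / (c * k)) powr p) * Re (qform (Z2.rfun (\<lambda>t. t powr p)) u)"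
    if p: "2 \<le> p" and u: "u \<in> carrier_vec n" for p u
  proof -
    have "16 * Re (qform (Z1.rfun (\<lambda>t. (c * t) powr (2 * (p / 2)))) u) \<le> Re (qform (Z2.rfun (\<lambda>t. (t / k) powr (2 * (p / 2)))) u)"
      using p by (intro power_bound[OF Z1 Z2 ck le _ u]) auto
    then have "16 * Re (qform (Z1.rfun (\<lambda>t. (c * t) powr p)) u) \<le> Re (qform (Z2.rfun (\<lambda>t. (1 / k * t) powr p)) u)" by simp
    then have "16 * (c powr p * Re (qform (Z1.rfun (\<lambda>t. t powr p)) u)) \<le> (1 / k) powr p * Re (qform (Z2.rfun (\<lambda>t. t powr p)) u)"
      using scale[OF u, of "1 / k" p] ck by simp
    moreover have "(1 / k) powr p = c powr p * (1 / (c * k)) powr p" using ck by (simp flip: powr_mult)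
    ultimately have "c powr p * (16 * Re (qform (Z1.rfun (\<lambda>t. t powr p)) u))
        \<le> c powr p * ((1 / (c * k)) powr p * Re (qform (Z2.rfun (\<lambda>t. t powr p)) u))"
      by (simp add: ac_simps)
    then have "16 * Re (qform (Z1.rfun (\<lambda>t. t powr p)) u) \<le> (1 / (c * k)) powr p * Re (qform (Z2.rfun (\<lambda>t. t powr p)) u)"
      by (rule mult_left_le_imp_le) (use ck in simp)
    then show ?thesis by simp
  qed
  then show "2 \<le> p \<Longrightarrow> loewner_le (mat_rpow Z1 p) (complex_of_real (1 / 16 * (1 / (c * k)) powr p) \<cdot>\<^sub>m mat_rpow Z2 p)"
    by (intro conv)
  assume p: "0 < p" "p \<le> 2"
  define d where "d = 1 / (4 * (c * k))"
  have d: "d > 0" using ck by (simp add: d_def)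
  let ?X = "Z1.rfun (\<lambda>t. t powr 2)" and ?Y = "Z2.rfun (\<lambda>t. (d * t) powr 2)"
  have X: "accretive n ?X" "hermitian_mat ?X" using p1 by (auto intro!: Z1.rfun_accretive simp: less_imp_neq[THEN not_sym])
  have Y: "accretive n ?Y" "hermitian_mat ?Y" using p2 d by (auto intro!: Z2.rfun_accretive simp: less_imp_neq[THEN not_sym])
  have sq: "Re (qform ?X u) \<le> Re (qform ?Y u)" if u: "u \<in> carrier_vec n" for u
  proof -
    \<comment> \<open>At p = 2 the constant is a perfect square; it can be moved into the matrix as
      the factor d before taking the power p/2.\<close>
    have "1 / 16 * (1 / (c * k)) powr 2 = d powr 2" using ck by (simp add: d_def power2_eq_square)
    then show ?thesis using big[OF _ u, of 2] scale(2)[OF u d, of 2] by simp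
  qed
  show "loewner_le (mat_rpow Z1 p) (complex_of_real ((1 / (4 * (c * k))) powr p) \<cdot>\<^sub>m mat_rpow Z2 p)"
    unfolding d_def[symmetric]
  proof (rule conv)
    fix u :: "complex vec" assume u: "u \<in> carrier_vec n"
    have "Re (qform (herm.rfun ?X (\<lambda>t. t powr (p / 2))) u) \<le> Re (qform (herm.rfun ?Y (\<lambda>t. t powr (p / 2))) u)"
      using p by (intro loewner_heinz[OF X Y sq _ _ u]) auto
    then show "Re (qform (Z1.rfun (\<lambda>t. t powr p)) u) \<le> d powr p * Re (qform (Z2.rfun (\<lambda>t. t powr p)) u)"
      unfolding rfun_rfun(2)[OF Z1.herm_axioms] rfun_rfun(2)[OF Z2.herm_axioms]
      by (simp add: powr_powr scale(2)[OF u d, symmetric])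
  qed
qed

section \<open>From the sector and spectral bounds to the theorem\<close>

text \<open>\<open>sector_mat\<close> speaks of unit vectors only; both conclusions are homogeneous
  of degree 2, so normalising x suffices.\<close>

lemma sector_scale:
  assumes A: "A \<in> carrier_mat n n" and sec: "sector_mat \<theta> A" and x: "x \<in> carrier_vec n"
  shows "\<bar>Im (qform A x)\<bar> \<le> Re (qform A x) * tan \<theta>" "x \<noteq> 0\<^sub>v n \<Longrightarrow> 0 < Re (qform A x)"
proof -
  have "\<bar>Im (qform A x)\<bar> \<le> Re (qform A x) * tan \<theta> \<and> 0 < Re (qform A x)" if x0: "x \<noteq> 0\<^sub>v n"
  proof -
    define N where "N = Re (x \<bullet>c x)"
    have N: "N > 0" "x \<bullet>c x = complex_of_real N"
      using cip_self[OF x] x0 by (auto simp: N_def order.order_iff_strict complex_eq_iff)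
    define a where "a = 1 / sqrt N"
    have a: "a\<^sup>2 = 1 / N" "a > 0" using N by (auto simp: a_def power_divide)
    let ?y = "complex_of_real a \<cdot>\<^sub>v x"
    have Ax: "A *\<^sub>v x \<in> carrier_vec n" using mult_mat_vec_carrier[OF A x] .
    have aa: "complex_of_real a * (complex_of_real a * z) = complex_of_real (a\<^sup>2) * z" for z by (simp add: power2_eq_square)
    have y: "?y \<in> carrier_vec n" using x by simp
    have "?y \<bullet>c ?y = complex_of_real (a\<^sup>2) * (x \<bullet>c x)" using x by (simp add: cip_simps[where n=n] aa)
    then have y1: "?y \<bullet>c ?y = 1" using N a by simp
    have q: "qform A ?y = complex_of_real (a\<^sup>2) * qform A x"
      using x Ax by (simp add: qform_def mv_smult[OF A] cip_simps[where n=n] aa)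
    have "dim_row A = n" using A by simp
    then have "0 < Re (qform A ?y) \<and> \<bar>Im (qform A ?y)\<bar> \<le> Re (qform A ?y) * tan \<theta>"
      using sec y y1 unfolding sector_mat_def by metis
    then have "0 < a\<^sup>2 * Re (qform A x)" "\<bar>a\<^sup>2 * Im (qform A x)\<bar> \<le> a\<^sup>2 * Re (qform A x) * tan \<theta>"
      unfolding q by auto
    moreover have "\<bar>a\<^sup>2 * Im (qform A x)\<bar> = a\<^sup>2 * \<bar>Im (qform A x)\<bar>" by (simp add: abs_mult)
    ultimately show ?thesis using a(2) by (simp add: zero_less_mult_iff mult.assoc)
  qed
  moreover have "qform A (0\<^sub>v n) = 0" using mv_zero[OF A] by (simp add: qform_def)
  ultimately show "\<bar>Im (qform A x)\<bar> \<le> Re (qform A x) * tan \<theta>" "x \<noteq> 0\<^sub>v n \<Longrightarrow> 0 < Re (qform A x)"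
    by (cases "x = 0\<^sub>v n"; auto)+
qed

text \<open>On a spectrum within [m, M] the product (t - m)(M - t) is nonnegative, and division by t
  gives t + m M / t \<le> M + m.\<close>

lemma kantorovich_bound:
  assumes P: "accretive n P" "hermitian_mat P" and m: "0 < m" and u: "u \<in> carrier_vec n"
    and lo: "\<And>x. x \<in> carrier_vec n \<Longrightarrow> m * Re (x \<bullet>c x) \<le> Re (qform P x)"
    and hi: "\<And>x. x \<in> carrier_vec n \<Longrightarrow> Re (qform P x) \<le> M * Re (x \<bullet>c x)"
  shows "Re (qform P u) + m * M * Re (qform (herm.rfun P inverse) u) \<le> (M + m) * Re (u \<bullet>c u)"
proof -
  interpret herm n P using P by unfold_locales (auto simp: accretive_def)
  have "Re (qform P u) + m * M * Re (qform (rfun inverse) u) = Re (qform (rfun (\<lambda>t. 1 * t + (m * M) * inverse t)) u)"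
    unfolding rfun_linear_qform[OF u] rfun_id by simp
  also have "\<dots> \<le> Re (qform (rfun (\<lambda>t. (M + m) * 1 + 0 * t)) u)"
  proof (rule rfun_mono[OF u])
    fix \<mu> assume \<mu>: "\<mu> \<in> eigs P"
    have b: "m \<le> Re \<mu>" "Re \<mu> \<le> M" using eigs_bounds(2)[OF \<mu> lo] eigs_bounds(1)[OF \<mu> hi] by auto
    then have pos: "Re \<mu> > 0" using m by simp
    have "0 \<le> (Re \<mu> - m) * (M - Re \<mu>)" using b by simp
    then have "Re \<mu> * Re \<mu> + m * M \<le> (M + m) * Re \<mu>" by (simp add: algebra_simps)
    then have "(Re \<mu> * Re \<mu> + m * M) / Re \<mu> \<le> M + m" using pos by (simp add: pos_divide_le_eq)
    moreover have "(Re \<mu> * Re \<mu> + m * M) / Re \<mu> = Re \<mu> + m * M * inverse (Re \<mu>)"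
      using pos by (simp add: field_simps)
    ultimately show "1 * Re \<mu> + m * M * inverse (Re \<mu>) \<le> (M + m) * 1 + 0 * Re \<mu>" by simp
  qed
  also have "\<dots> = (M + m) * Re (u \<bullet>c u)"
    unfolding rfun_linear_qform[OF u] by (simp add: qform_def rfun_one_vec[OF u])
  finally show ?thesis .
qed

theorem theorem2p6:
  fixes n :: nat and \<theta> m M :: real and A B :: "complex mat"
    and \<Phi> :: "complex mat \<Rightarrow> complex mat"
    and f f1 f2 :: "complex \<Rightarrow> complex"
  assumes "0 \<le> \<theta>" "\<theta> < pi / 2"
    and "A \<in> carrier_mat n n" "B \<in> carrier_mat n n"
    and "sector_mat \<theta> A" "sector_mat \<theta> B"
    and "0 < m" "m \<le> M"
    and "loewner_le (m \<cdot>\<^sub>m 1\<^sub>m n) (mat_re A)" "loewner_le (mat_re A) (M \<cdot>\<^sub>m 1\<^sub>m n)"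
    and "loewner_le (m \<cdot>\<^sub>m 1\<^sub>m n) (mat_re B)" "loewner_le (mat_re B) (M \<cdot>\<^sub>m 1\<^sub>m n)"
    and "positive_unital_linear n \<Phi>"
    and "op_mean_fun f" "op_mean_fun f1" "op_mean_fun f2"
    and "mean_le (adjoint_mean f) f1" "mean_le f1 f"
    and "mean_le (adjoint_mean f) f2" "mean_le f2 f"
  shows "(\<forall>p. 0 < p \<and> p \<le> 2 \<longrightarrow>
           loewner_le (mat_rpow (mat_re (\<Phi> (mean_op f1 A B))) p)
             (complex_of_real ((1 / cos \<theta>) powr (2 * p) * kantorovich m M powr p) \<cdot>\<^sub>m
                mat_rpow (mat_re (\<Phi> (mean_op f2 A B))) p)) \<and>
         (\<forall>p. 2 \<le> p \<longrightarrow>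
           loewner_le (mat_rpow (mat_re (\<Phi> (mean_op f1 A B))) p)
             (complex_of_real ((1 / cos \<theta>) powr (2 * p) * 4 powr (p - 2) * kantorovich m M powr p) \<cdot>\<^sub>m
                mat_rpow (mat_re (\<Phi> (mean_op f2 A B))) p))"
proof -
  note A = assms(3) and B = assms(4) and m0 = assms(7)
  have M0: "M > 0" using assms(7,8) by simp
  have acc: "accretive n A" "accretive n B"
    using sector_scale(2)[OF A assms(5)] sector_scale(2)[OF B assms(6)] A B by (auto simp: accretive_def)
  have tan: "0 \<le> tan \<theta>" using assms(1,2) by (cases "\<theta> = 0") (auto intro!: less_imp_le tan_gt_zero)
  interpret sector_pair n A B "tan \<theta>"
    by unfold_locales (use acc tan sector_scale(1)[OF A assms(5)] sector_scale(1)[OF B assms(6)] in auto)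
  interpret re: pd_pair n P Q by unfold_locales (use herm_PQ in auto)
  interpret \<Phi>: unital_positive n \<Phi> using assms(13) by unfold_locales
  have hol: "g holomorphic_on slit" and real: "\<And>t. t > 0 \<Longrightarrow> g (complex_of_real t) \<in> \<real>"
    and pos: "\<And>t. t > 0 \<Longrightarrow> 0 < Re (g (complex_of_real t))" if "op_mean_fun g" for g
    using that by (auto simp: op_mean_fun_def)
  note lim = op_mean_fun_hkern_limit
  \<comment> \<open>The slope belongs to f alone. It serves f1 from above and 1/f2 through the
    adjoint mean; sharing it is what allows both bounds to use the same weights 1 - s and s.\<close>
  obtain s where s: "0 \<le> s" "s \<le> 1" and tangent: "\<And>t. t > 0 \<Longrightarrow> Re (f (complex_of_real t)) \<le> (1 - s) + s * t"
    using hkern_limit_tangent[OF lim[OF assms(14)]] by metis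
  have f_upper: "Re (g (complex_of_real t)) \<le> (1 - s) + s * t" if "mean_le g f" "t > 0" for g t
    using that tangent[OF that(2)] unfolding mean_le_def by force
  \<comment> \<open>The adjoint mean lying below g means 1/g(t) \<le> f(1/t); the tangent bound is
    then used at 1/t.\<close>
  have f_lower: "inverse (Re (g (complex_of_real t))) \<le> (1 - s) + s * inverse t" if "mean_le (adjoint_mean f) g" "t > 0" for g t
  proof -
    have it: "inverse t > 0" using that by simp
    define r where "r = Re (f (complex_of_real (inverse t)))"
    have r: "r > 0" unfolding r_def using pos[OF assms(14) it] .
    have "f (complex_of_real (inverse t)) = complex_of_real r"
      unfolding r_def using real[OF assms(14) it] by (simp only: of_real_Re)
    then have "adjoint_mean f (complex_of_real t) = complex_of_real (inverse r)"
      unfolding adjoint_mean_def by simp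
    then have "inverse r \<le> Re (g (complex_of_real t))" using that unfolding mean_le_def by (metis Re_complex_of_real)
    then have "inverse (Re (g (complex_of_real t))) \<le> inverse (inverse r)" using r by (intro le_imp_inverse_le) auto
    then show ?thesis using tangent[OF it] r by (simp add: r_def)
  qed
  define X where "X = (\<lambda>g. mean_op g P Q)"
  have Xc: "X g \<in> carrier_mat n n" for g unfolding X_def by simp
  have Xh: "hermitian_mat (X g)" if "op_mean_fun g" for g
    unfolding X_def by (rule re.mean_hermitian) (use hol real that in auto)
  have Xacc: "accretive n (X g)" if g: "op_mean_fun g" for g
    unfolding accretive_def
  proof (intro conjI ballI impI Xc)
    fix x :: "complex vec" assume x: "x \<in> carrier_vec n" "x \<noteq> 0\<^sub>v n"
    have "re.R *\<^sub>v x \<noteq> 0\<^sub>v n" using re.R_vec(3)[OF x(1)] x(2) mv_zero[OF re.R_carrier(2)] by auto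
    moreover have "accretive n (re.hT.rfun (\<lambda>t. Re (g (complex_of_real t))))"
      using pos[OF g] re.T_eigs_pos by (intro re.hT.rfun_accretive) auto
    moreover have "qform (X g) x = qform (re.hT.rfun (\<lambda>t. Re (g (complex_of_real t)))) (re.R *\<^sub>v x)"
      unfolding X_def using hol[OF g] real[OF g] x(1) by (rule re.mean_qform(2))
    ultimately show "0 < Re (qform (X g) x)" using x by (simp add: accretive_def)
  qed
  have inv: "\<exists>Y. Y \<in> carrier_mat n n \<and> hermitian_mat Y \<and> (\<forall>x\<in>carrier_vec n. X g *\<^sub>v (Y *\<^sub>v x) = x) \<and>
     (mean_le (adjoint_mean f) g \<longrightarrow> (\<forall>u\<in>carrier_vec n. Re (qform Y u) \<le> (1 - s) * Re (qform (re.hA.rfun inverse) u) + s * Re (qform (re.hB.rfun inverse) u)))"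
    if g: "op_mean_fun g" for g
  proof -
    obtain Y where "Y \<in> carrier_mat n n" "hermitian_mat Y" "\<And>x. x \<in> carrier_vec n \<Longrightarrow> X g *\<^sub>v (Y *\<^sub>v x) = x"
      "\<And>\<alpha> \<beta> u. (\<And>t. t > 0 \<Longrightarrow> inverse (Re (g (complex_of_real t))) \<le> \<alpha> + \<beta> * inverse t) \<Longrightarrow> u \<in> carrier_vec n \<Longrightarrow>
        Re (qform Y u) \<le> \<alpha> * Re (qform (re.hA.rfun inverse) u) + \<beta> * Re (qform (re.hB.rfun inverse) u)"
      unfolding X_def using re.mean_inverse[OF hol[OF g] real[OF g] pos[OF g]] by metis
    then show ?thesis using f_lower by (intro exI[of _ Y]) blast
  qed
  define Z where "Z = (\<lambda>g. mat_re (\<Phi> (mean_op g A B)))"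
  have Zc: "Z g \<in> carrier_mat n n" for g unfolding Z_def by simp
  have Zh: "hermitian_mat (Z g)" for g unfolding Z_def by (intro hermitian_mat_re[of _ n]) simp
  have Zq: "Re (qform (Z g) u) = Re (qform (\<Phi> (mean_op g A B)) u)" if "u \<in> carrier_vec n" for g u
    unfolding Z_def using that by (intro qform_mat_re_Re) auto
  have lowZ: "Re (qform (\<Phi> (X g)) u) \<le> Re (qform (Z g) u)" if g: "op_mean_fun g" and u: "u \<in> carrier_vec n" for g u
    unfolding Zq[OF u] X_def using mean_compare(1)[OF lim[OF g] hol[OF g]] u by (intro \<Phi>.mono_Re) auto
  have Zacc: "accretive n (Z g)" if g: "op_mean_fun g" for g
  proof -
    obtain Y where Y: "Y \<in> carrier_mat n n" "\<And>x. x \<in> carrier_vec n \<Longrightarrow> X g *\<^sub>v (Y *\<^sub>v x) = x" using inv[OF g] by blast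
    show ?thesis unfolding accretive_def
      using Zc lowZ[OF g] \<Phi>.image_accretive[OF Xacc[OF g] Xh[OF g] Y] by (auto intro: less_le_trans)
  qed
  define S where "S = 1 + (tan \<theta>)\<^sup>2"
  have S: "S > 0" by (simp add: S_def add_pos_nonneg)
  \<comment> \<open>The arithmetic means of P, Q and of their inverses, with equal weights. The
    Kantorovich bound therefore applies to P and to Q separately and survives the averaging.\<close>
  define W where "W = complex_of_real (1 - s) \<cdot>\<^sub>m P + complex_of_real s \<cdot>\<^sub>m Q"
  define V where "V = complex_of_real (1 - s) \<cdot>\<^sub>m re.hA.rfun inverse + complex_of_real s \<cdot>\<^sub>m re.hB.rfun inverse"
  have WV: "W \<in> carrier_mat n n" "V \<in> carrier_mat n n" unfolding W_def V_def by auto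
  have Wq: "Re (qform W u) = (1 - s) * Re (qform P u) + s * Re (qform Q u)" if "u \<in> carrier_vec n" for u
    unfolding W_def using that by (simp add: qform_linear(1)[where n=n] qform_smult[where n=n])
  have Vq: "Re (qform V u) = (1 - s) * Re (qform (re.hA.rfun inverse) u) + s * Re (qform (re.hB.rfun inverse) u)" if "u \<in> carrier_vec n" for u
    unfolding V_def using that by (simp add: qform_linear(1)[where n=n] qform_smult[where n=n])
  have one: "complex_of_real a \<cdot>\<^sub>m 1\<^sub>m n \<in> carrier_mat n n" for a by simp
  have oneq: "Re (qform (complex_of_real a \<cdot>\<^sub>m 1\<^sub>m n) u) = a * Re (u \<bullet>c u)" if "u \<in> carrier_vec n" for a u
    using that by (simp add: qform_smult[where n=n] qform_one)
  have PQb: "m * Re (u \<bullet>c u) \<le> Re (qform P u)" "Re (qform P u) \<le> M * Re (u \<bullet>c u)"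
    "m * Re (u \<bullet>c u) \<le> Re (qform Q u)" "Re (qform Q u) \<le> M * Re (u \<bullet>c u)" if "u \<in> carrier_vec n" for u
    using assms(9-12) that
    unfolding loewner_le_iff[OF one re.carrA] loewner_le_iff[OF re.carrA one] loewner_le_iff[OF one re.carrB] loewner_le_iff[OF re.carrB one]
    by (auto simp: oneq)
  have WVsum: "Re (qform (\<Phi> W) u) + m * M * Re (qform (\<Phi> V) u) \<le> (M + m) * Re (u \<bullet>c u)" if u: "u \<in> carrier_vec n" for u
  proof -
    let ?L = "W + complex_of_real (m * M) \<cdot>\<^sub>m V"
    have "Re (qform (\<Phi> ?L) u) \<le> Re (qform (\<Phi> (complex_of_real (M + m) \<cdot>\<^sub>m 1\<^sub>m n)) u)"
    proof (rule \<Phi>.mono_Re[OF _ one _ u])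
      fix x :: "complex vec" assume x: "x \<in> carrier_vec n"
      have kA: "Re (qform P x) + m * M * Re (qform (re.hA.rfun inverse) x) \<le> (M + m) * Re (x \<bullet>c x)"
        by (rule kantorovich_bound[OF acc_PQ(1) herm_PQ(1) m0 x PQb(1,2)])
      have kB: "Re (qform Q x) + m * M * Re (qform (re.hB.rfun inverse) x) \<le> (M + m) * Re (x \<bullet>c x)"
        by (rule kantorovich_bound[OF acc_PQ(2) herm_PQ(2) m0 x PQb(3,4)])
      have "Re (qform ?L x) = (1 - s) * (Re (qform P x) + m * M * Re (qform (re.hA.rfun inverse) x))
          + s * (Re (qform Q x) + m * M * Re (qform (re.hB.rfun inverse) x))"
        using WV x by (simp add: qform_linear(1)[where n=n] qform_smult[where n=n] Wq Vq algebra_simps)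
      also have "\<dots> \<le> (1 - s) * ((M + m) * Re (x \<bullet>c x)) + s * ((M + m) * Re (x \<bullet>c x))"
        using kA kB s by (intro add_mono mult_left_mono) auto
      also have "\<dots> = Re (qform (complex_of_real (M + m) \<cdot>\<^sub>m 1\<^sub>m n) x)" unfolding oneq[OF x] by (simp add: algebra_simps)
      finally show "Re (qform ?L x) \<le> Re (qform (complex_of_real (M + m) \<cdot>\<^sub>m 1\<^sub>m n) x)" .
    qed (use WV in auto)
    moreover have "\<Phi> ?L = \<Phi> W + complex_of_real (m * M) \<cdot>\<^sub>m \<Phi> V" using WV by (simp add: \<Phi>.add \<Phi>.smult)
    moreover have "\<Phi> (complex_of_real (M + m) \<cdot>\<^sub>m 1\<^sub>m n) = complex_of_real (M + m) \<cdot>\<^sub>m 1\<^sub>m n"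
      using \<Phi>.smult[of "1\<^sub>m n"] \<Phi>.one by simp
    ultimately show ?thesis using WV u by (simp add: qform_linear(1)[where n=n] qform_smult[where n=n] qform_one del: of_real_add of_real_mult)
  qed
  \<comment> \<open>Dividing Z1 / S + m M times the inverse of Z2 by M + m gives the normalised
    hypothesis of \<open>power_comparison\<close>; consequently 1/(c k) = 4 S K.\<close>
  define c where "c = 1 / (S * (M + m))"
  define k where "k = m * M / (M + m)"
  have ck: "c > 0" "k > 0" unfolding c_def k_def using S m0 M0 by auto
  have main: "c * Re (qform (Z f1) u) + k * Re (qform (herm.rfun (Z f2) inverse) u) \<le> Re (u \<bullet>c u)" if u: "u \<in> carrier_vec n" for u
  proof -
    interpret Z2: herm n "Z f2" using Zc Zh by unfold_locales
    \<comment> \<open>The factor S = sec^2 \<theta> is paid only here; the comparison used for f2 is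
      the lower one, with constant 1.\<close>
    have "Re (qform (Z f1) u) \<le> Re (qform (\<Phi> (complex_of_real S \<cdot>\<^sub>m X f1)) u)"
      unfolding Zq[OF u]
    proof (rule \<Phi>.mono_Re[OF mean_op_carrier _ _ u])
      show "complex_of_real S \<cdot>\<^sub>m X f1 \<in> carrier_mat n n" using Xc by simp
      show "Re (qform (mean_op f1 A B) x) \<le> Re (qform (complex_of_real S \<cdot>\<^sub>m X f1) x)" if x: "x \<in> carrier_vec n" for x
        using mean_compare(2)[OF lim[OF assms(15)] hol[OF assms(15)] x] qform_smult[OF Xc x, of "complex_of_real S" f1]
        by (simp add: X_def S_def)
    qed
    also have "\<dots> = S * Re (qform (\<Phi> (X f1)) u)"
      using Xc u by (simp add: \<Phi>.smult qform_smult[where n=n])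
    also have "\<dots> \<le> S * Re (qform (\<Phi> W) u)"
    proof (intro mult_left_mono \<Phi>.mono_Re[OF Xc WV(1) _ u])
      show "Re (qform (X f1) x) \<le> Re (qform W x)" if x: "x \<in> carrier_vec n" for x
        unfolding Wq[OF x] X_def using f_upper[OF assms(18)] by (intro re.mean_le_linear[OF hol[OF assms(15)] real[OF assms(15)] x]) auto
    qed (use S in auto)
    finally have 1: "Re (qform (Z f1) u) \<le> S * Re (qform (\<Phi> W) u)" .
    obtain Y where Y: "Y \<in> carrier_mat n n" "\<And>x. x \<in> carrier_vec n \<Longrightarrow> X f2 *\<^sub>v (Y *\<^sub>v x) = x"
      and Yle: "\<And>u. u \<in> carrier_vec n \<Longrightarrow> Re (qform Y u) \<le> Re (qform V u)"
      using inv[OF assms(16)] assms(19) Vq by auto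
    \<comment> \<open>At this vector the form of Z f2 equals the pairing of y with u, which absorbs
      one of the two copies on the left of Choi's inequality and leaves the form of the
      inverse.\<close>
    let ?y = "Z2.rfun inverse *\<^sub>v u"
    have y: "?y \<in> carrier_vec n" using u by simp
    have Zy: "Z f2 *\<^sub>v ?y = u" using Z2.rfun_inverse_vec(1)[OF Zacc[OF assms(16)] u] .
    have "2 * Re (?y \<bullet>c u) \<le> Re (qform (\<Phi> Y) u) + Re (qform (\<Phi> (X f2)) ?y)"
      by (rule \<Phi>.choi[OF Xacc[OF assms(16)] Xh[OF assms(16)] Y u y])
    also have "Re (qform (\<Phi> (X f2)) ?y) \<le> Re (qform (Z f2) ?y)" by (rule lowZ[OF assms(16) y])
    also have "Re (qform (Z f2) ?y) = Re (?y \<bullet>c u)" unfolding qform_def Zy using cip_commute[OF u y] by simp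
    also have "Re (qform (\<Phi> Y) u) \<le> Re (qform (\<Phi> V) u)" by (rule \<Phi>.mono_Re[OF Y(1) WV(2) Yle u])
    finally have 2: "Re (qform (Z2.rfun inverse) u) \<le> Re (qform (\<Phi> V) u)" by (simp add: qform_def)
    have "c * Re (qform (Z f1) u) + k * Re (qform (Z2.rfun inverse) u) \<le> c * (S * Re (qform (\<Phi> W) u)) + k * Re (qform (\<Phi> V) u)"
      using 1 2 ck by (intro add_mono mult_left_mono) auto
    also have "\<dots> = (Re (qform (\<Phi> W) u) + m * M * Re (qform (\<Phi> V) u)) / (M + m)"
      unfolding c_def k_def using S m0 M0 by (simp add: add_divide_distrib)
    also have "\<dots> \<le> Re (u \<bullet>c u)" using WVsum[OF u] m0 M0 by (simp add: pos_divide_le_eq mult.commute)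
    finally show ?thesis .
  qed
  have cos: "cos \<theta> > 0" using assms(1,2) by (intro cos_gt_zero_pi) auto
  have Scos: "S = (1 / cos \<theta>)\<^sup>2"
  proof -
    have "S * (cos \<theta>)\<^sup>2 = (cos \<theta>)\<^sup>2 + (sin \<theta>)\<^sup>2"
      unfolding S_def tan_def using cos by (simp add: power_divide field_simps)
    then show ?thesis using cos by (simp add: power_divide field_simps)
  qed
  define K where "K = kantorovich m M"
  have K: "K > 0" unfolding K_def kantorovich_def using m0 M0 by (intro divide_pos_pos) auto
  have SK: "1 / (4 * (c * k)) = S * K"
    unfolding c_def k_def K_def kantorovich_def using S m0 M0 by (simp add: power2_eq_square field_simps)
  then have SK4: "1 / (c * k) = 4 * (S * K)" by (simp add: field_simps)
  have Sp: "S powr p = (1 / cos \<theta>) powr (2 * p)" for p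
    unfolding Scos using cos by (simp add: powr_powr flip: powr_numeral)
  note pc = power_comparison[OF Zacc[OF assms(15)] Zh Zacc[OF assms(16)] Zh ck main]
  show ?thesis
  proof (intro conjI allI impI)
    fix p :: real assume p: "0 < p \<and> p \<le> 2"
    have "(1 / (4 * (c * k))) powr p = (1 / cos \<theta>) powr (2 * p) * K powr p"
      unfolding SK using S K by (simp add: powr_mult Sp)
    then show "loewner_le (mat_rpow (mat_re (\<Phi> (mean_op f1 A B))) p)
             (complex_of_real ((1 / cos \<theta>) powr (2 * p) * kantorovich m M powr p) \<cdot>\<^sub>m
                mat_rpow (mat_re (\<Phi> (mean_op f2 A B))) p)"
      using pc(2)[of p] p unfolding Z_def K_def by simp
  next
    fix p :: real assume p: "2 \<le> p"
    \<comment> \<open>Since 1/(c k) = 4 S K, the factor 4^p combines with 1/16 to 4^(p-2).\<close>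
    have "1 / 16 * (1 / (c * k)) powr p = (1 / cos \<theta>) powr (2 * p) * 4 powr (p - 2) * K powr p"
    proof -
      have "(4 * (S * K)) powr p = 4 powr p * ((1 / cos \<theta>) powr (2 * p) * K powr p)"
        using S K by (simp add: powr_mult Sp)
      moreover have "4 powr (p - 2) = 4 powr p / (16::real)" by (simp add: powr_diff)
      ultimately show ?thesis unfolding SK4 by simp
    qed
    then show "loewner_le (mat_rpow (mat_re (\<Phi> (mean_op f1 A B))) p)
             (complex_of_real ((1 / cos \<theta>) powr (2 * p) * 4 powr (p - 2) * kantorovich m M powr p) \<cdot>\<^sub>m
                mat_rpow (mat_re (\<Phi> (mean_op f2 A B))) p)"
      using pc(1)[of p] p unfolding Z_def K_def by simp
  qed
qed

end
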